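(* Let $M$ be a compact $n$-dimensional manifold ($n\ge2$) with volume form $\mu$, and let $L_\infty(M,\mu)=(L,(l_k))$ be its multisymplectic $L_\infty$-algebra. Then $L_0/dL_{-1}=\Omega^{n-2}(M)/d\Omega^{n-3}(M)$, with the bracket induced by $l_2$, is a central extension of the Lie algebra $\mathfrak X_{\mathrm{ex}}(M,\mu)$ of exact divergence free vector fields, via $[\alpha]\mapsto X_\alpha$. Moreover, the quotient map $L_0\to L_0/dL_{-1}$ defines a (surjective) $L_\infty$-morphism from $L_\infty(M,\mu)$ to the Lie algebra $\Omega^{n-2}(M)/d\Omega^{n-3}(M)$.
   Context: Each $\alpha\in\Omega^{n-2}(M)$ determines a unique vector field $X_\alpha$ with $\iota_{X_\alpha}\mu=-d\alpha$; such vector fields are called exact divergence free, and they form the Lie algebra $\mathfrak X_{\mathrm{ex}}(M,\mu)$ under the commutator of vector fields. Convention: $\Omega^{j}(M)=0$ for $j<0$. $L_\infty(M,\mu)$ is the following $L_\infty$-algebra: $L_{-i}=\Omega^{n-2-i}(M)$ for $i\in\{0,\dots,n-2\}$; $l_1=d$ (and $l_1=0$ on $L_0$); and for $k\in\{2,\dots,n\}$ and $\alpha_1,\dots,\alpha_k\in L_0=\Omega^{n-2}(M)$, $$l_k(\alpha_1,\dots,\alpha_k)=-(-1)^{\frac{k(k+1)}2}\,\iota_{X_{\alpha_k}}\cdots\iota_{X_{\alpha_1}}\mu ,$$ with $l_k$ ($k\ge2$) zero when some argument has nonzero degree, and all other brackets zero. It is known to be a grounded $L_\infty$-algebra, meaning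 an $L_\infty$-algebra in non-positive degrees whose brackets $l_k$, $k\ge2$, vanish unless all arguments are in $L_0$, and vanish if some argument is in $l_1L_{-1}$. An $L_\infty$-morphism from a grounded $L_\infty$-algebra $(L,l_k)$ to a Lie algebra $(\mathfrak g,[\cdot,\cdot])$ amounts to a linear map $f_1:L_0\to\mathfrak g$ with $f_1\circ l_1=0$ on $L_{-1}$ and $f_1(l_2(x,y))=[f_1(x),f_1(y)]$ for all $x,y\in L_0$. *)

theory Defs
  imports "HOL-Analysis.Analysis" "HOL-Algebra.Module" "HOL-Algebra.AbelCoset"
begin

section \<open>Smooth manifolds\<close>

text \<open>These two predicates are only meant for open \<open>S\<close>, where the derivative at a point does not depend
  on the values outside \<open>S\<close>.\<close>

primrec Ck_on :: "nat \<Rightarrow> 'e::real_normed_vector set \<Rightarrow> ('e \<Rightarrow> 'f::real_normed_vector) \<Rightarrow> bool" where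
  "Ck_on 0 S f \<longleftrightarrow> continuous_on S f"
| "Ck_on (Suc k) S f \<longleftrightarrow>
     f differentiable_on S \<and> (\<forall>v. Ck_on k S (\<lambda>x. frechet_derivative f (at x) v))"

definition smooth_on :: "'e::real_normed_vector set \<Rightarrow> ('e \<Rightarrow> 'f::real_normed_vector) \<Rightarrow> bool" where
  "smooth_on S f \<longleftrightarrow> (\<forall>k. Ck_on k S f)"

text \<open>The manifold is the whole type \<open>'a\<close>; the type class provides the Hausdorff and second
  countability axioms. Its dimension is \<open>DIM('e)\<close>, where \<open>'e\<close> is the model space. A chart is a pair
  \<open>(U, \<phi>)\<close>, where only the values of \<open>\<phi>\<close> on \<open>U\<close> matter. The atlas need not be maximal.\<close>

type_synonym ('a, 'e) atlas = "('a set \<times> ('a \<Rightarrow> 'e)) set"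

definition smooth_atlas ::
  "('a::{t2_space, second_countable_topology}, 'e::euclidean_space) atlas \<Rightarrow> bool" where
  "smooth_atlas A \<longleftrightarrow>
     (\<Union>(U, \<phi>)\<in>A. U) = UNIV \<and>
     (\<forall>(U, \<phi>)\<in>A. open U \<and> open (\<phi> ` U) \<and> homeomorphism U (\<phi> ` U) \<phi> (inv_into U \<phi>)) \<and>
     (\<forall>(U, \<phi>)\<in>A. \<forall>(V, \<psi>)\<in>A. smooth_on (\<phi> ` (U \<inter> V)) (\<psi> \<circ> inv_into U \<phi>))"

definition smooth_fun :: "('a, 'e::euclidean_space) atlas \<Rightarrow> ('a \<Rightarrow> real) \<Rightarrow> bool" where
  "smooth_fun A f \<longleftrightarrow> (\<forall>(U, \<phi>)\<in>A. smooth_on (\<phi> ` U) (f \<circ> inv_into U \<phi>))"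

section \<open>Vector fields and differential forms\<close>

text \<open>Tangent vectors at \<open>p\<close> are the derivations at \<open>p\<close> of the algebra of smooth functions. They are
  total functionals, normalised to vanish on functions that are not smooth, so that
  equality of tangent vectors is equality in HOL.\<close>

type_synonym 'a tvec = "('a \<Rightarrow> real) \<Rightarrow> real"
type_synonym 'a vfield = "'a \<Rightarrow> 'a tvec"

definition tangent_space :: "('a, 'e::euclidean_space) atlas \<Rightarrow> 'a \<Rightarrow> 'a tvec set" where
  "tangent_space A p = {v.
     (\<forall>f g. smooth_fun A f \<longrightarrow> smooth_fun A g \<longrightarrow> v (\<lambda>q. f q + g q) = v f + v g) \<and>
     (\<forall>c f. smooth_fun A f \<longrightarrow> v (\<lambda>q. c * f q) = c * v f) \<and>
     (\<forall>f g. smooth_fun A f \<longrightarrow> smooth_fun A g \<longrightarrow> v (\<lambda>q. f q * g q) = f p * v g + g p * v f) \<and>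
     (\<forall>f. \<not> smooth_fun A f \<longrightarrow> v f = 0)}"

definition vector_fields :: "('a, 'e::euclidean_space) atlas \<Rightarrow> 'a vfield set" where
  "vector_fields A = {X. (\<forall>p. X p \<in> tangent_space A p) \<and>
     (\<forall>f. smooth_fun A f \<longrightarrow> smooth_fun A (\<lambda>p. X p f))}"

definition commutator :: "'a vfield \<Rightarrow> 'a vfield \<Rightarrow> 'a vfield" where
  "commutator X Y = (\<lambda>p f. X p (\<lambda>q. Y q f) - Y p (\<lambda>q. X q f))"

text \<open>The value of a \<open>k\<close>-form at a point is an alternating multilinear map on \<open>k\<close>-tuples (lists of
  length \<open>k\<close>) of tangent vectors at that point, extended by zero to all other lists.\<close>

type_synonym 'a dform = "'a \<Rightarrow> 'a tvec list \<Rightarrow> real"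

definition alt_multilinear :: "'a tvec set \<Rightarrow> nat \<Rightarrow> ('a tvec list \<Rightarrow> real) \<Rightarrow> bool" where
  "alt_multilinear T k w \<longleftrightarrow>
     (\<forall>vs. \<not> (length vs = k \<and> set vs \<subseteq> T) \<longrightarrow> w vs = 0) \<and>
     (\<forall>vs i u v a b. length vs = k \<longrightarrow> set vs \<subseteq> T \<longrightarrow> i < k \<longrightarrow> u \<in> T \<longrightarrow> v \<in> T \<longrightarrow>
        w (vs[i := (\<lambda>f. a * u f + b * v f)]) = a * w (vs[i := u]) + b * w (vs[i := v])) \<and>
     (\<forall>vs i j. length vs = k \<longrightarrow> set vs \<subseteq> T \<longrightarrow> i < j \<longrightarrow> j < k \<longrightarrow> vs ! i = vs ! j \<longrightarrow> w vs = 0)"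

definition eval_form :: "'a dform \<Rightarrow> 'a vfield list \<Rightarrow> 'a \<Rightarrow> real" where
  "eval_form \<omega> Xs = (\<lambda>p. \<omega> p (map (\<lambda>X. X p) Xs))"

definition diff_forms :: "('a, 'e::euclidean_space) atlas \<Rightarrow> nat \<Rightarrow> 'a dform set" where
  "diff_forms A k = {\<omega>. (\<forall>p. alt_multilinear (tangent_space A p) k (\<omega> p)) \<and>
     (\<forall>Xs. length Xs = k \<longrightarrow> set Xs \<subseteq> vector_fields A \<longrightarrow> smooth_fun A (eval_form \<omega> Xs))}"

text \<open>The exterior derivative is characterised by the invariant formula
  \[ d\omega(X_0,\dots,X_k) = \sum_i (-1)^i X_i(\omega(X_0,\dots,\hat X_i,\dots,X_k))
     + \sum_{i<j} (-1)^{i+j} \omega([X_i,X_j],X_0,\dots,\hat X_i,\dots,\hat X_j,\dots,X_k). \]\<close>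

definition invariant_formula :: "nat \<Rightarrow> 'a dform \<Rightarrow> 'a vfield list \<Rightarrow> 'a \<Rightarrow> real" where
  "invariant_formula k \<omega> Xs p =
     (\<Sum>i\<le>k. (-1) ^ i * (Xs ! i) p (eval_form \<omega> (nths Xs (- {i})))) +
     (\<Sum>j\<le>k. \<Sum>i<j. (-1) ^ (i + j) *
        eval_form \<omega> (commutator (Xs ! i) (Xs ! j) # nths Xs (- {i, j})) p)"

definition ext_deriv :: "('a, 'e::euclidean_space) atlas \<Rightarrow> nat \<Rightarrow> 'a dform \<Rightarrow> 'a dform" where
  "ext_deriv A k \<omega> = (THE \<eta>. \<eta> \<in> diff_forms A (Suc k) \<and>
     (\<forall>Xs. length Xs = Suc k \<longrightarrow> set Xs \<subseteq> vector_fields A \<longrightarrow>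
        eval_form \<eta> Xs = invariant_formula k \<omega> Xs))"

text \<open>Forms of integer degree, with no nonzero forms in negative degree.\<close>

definition Omega :: "('a, 'e::euclidean_space) atlas \<Rightarrow> int \<Rightarrow> 'a dform set" where
  "Omega A j = (if 0 \<le> j then diff_forms A (nat j) else {\<lambda>p vs. 0})"

definition d_Omega :: "('a, 'e::euclidean_space) atlas \<Rightarrow> int \<Rightarrow> 'a dform \<Rightarrow> 'a dform" where
  "d_Omega A j \<omega> = (if 0 \<le> j then ext_deriv A (nat j) \<omega> else (\<lambda>p vs. 0))"

definition int_prod :: "'a vfield \<Rightarrow> 'a dform \<Rightarrow> 'a dform" where
  "int_prod X \<omega> = (\<lambda>p vs. \<omega> p (X p # vs))"

definition volume_form :: "('a, 'e::euclidean_space) atlas \<Rightarrow> 'a dform \<Rightarrow> bool" where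
  "volume_form A \<mu> \<longleftrightarrow> \<mu> \<in> Omega A (int DIM('e)) \<and> (\<forall>p. \<exists>vs. \<mu> p vs \<noteq> 0)"

section \<open>Real Lie algebras\<close>

text \<open>Real vector spaces are modules in the sense of HOL-Algebra over the ring of reals. The ring
  multiplication and the unit that the module record inherits are not used by its axioms and are
  left unspecified.\<close>

definition real_ring :: "real ring" where
  "real_ring = \<lparr>carrier = UNIV, mult = (*), one = 1, zero = 0, add = (+)\<rparr>"

record 'v lie_alg = "(real, 'v) module" +
  bracket :: "'v \<Rightarrow> 'v \<Rightarrow> 'v"

definition lie_algebra :: "'v lie_alg \<Rightarrow> bool" where
  "lie_algebra G \<longleftrightarrow> module real_ring G \<and>
     (\<forall>x\<in>carrier G. \<forall>y\<in>carrier G. bracket G x y \<in> carrier G) \<and>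
     (\<forall>x\<in>carrier G. \<forall>y\<in>carrier G. \<forall>z\<in>carrier G.
        bracket G (x \<oplus>\<^bsub>G\<^esub> y) z = bracket G x z \<oplus>\<^bsub>G\<^esub> bracket G y z \<and>
        bracket G z (x \<oplus>\<^bsub>G\<^esub> y) = bracket G z x \<oplus>\<^bsub>G\<^esub> bracket G z y) \<and>
     (\<forall>c. \<forall>x\<in>carrier G. \<forall>y\<in>carrier G.
        bracket G (c \<odot>\<^bsub>G\<^esub> x) y = c \<odot>\<^bsub>G\<^esub> bracket G x y \<and>
        bracket G x (c \<odot>\<^bsub>G\<^esub> y) = c \<odot>\<^bsub>G\<^esub> bracket G x y) \<and>
     (\<forall>x\<in>carrier G. bracket G x x = \<zero>\<^bsub>G\<^esub>) \<and>
     (\<forall>x\<in>carrier G. \<forall>y\<in>carrier G. \<forall>z\<in>carrier G.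
        bracket G x (bracket G y z) \<oplus>\<^bsub>G\<^esub> bracket G y (bracket G z x)
          \<oplus>\<^bsub>G\<^esub> bracket G z (bracket G x y) = \<zero>\<^bsub>G\<^esub>)"

definition real_linear ::
  "(real, 'v, 'x) module_scheme \<Rightarrow> (real, 'w, 'y) module_scheme \<Rightarrow> ('v \<Rightarrow> 'w) \<Rightarrow> bool" where
  "real_linear V W f \<longleftrightarrow>
     (\<forall>x\<in>carrier V. f x \<in> carrier W) \<and>
     (\<forall>x\<in>carrier V. \<forall>y\<in>carrier V. f (x \<oplus>\<^bsub>V\<^esub> y) = f x \<oplus>\<^bsub>W\<^esub> f y) \<and>
     (\<forall>c. \<forall>x\<in>carrier V. f (c \<odot>\<^bsub>V\<^esub> x) = c \<odot>\<^bsub>W\<^esub> f x)"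

definition lie_hom :: "'v lie_alg \<Rightarrow> 'w lie_alg \<Rightarrow> ('v \<Rightarrow> 'w) \<Rightarrow> bool" where
  "lie_hom G H f \<longleftrightarrow> real_linear G H f \<and>
     (\<forall>x\<in>carrier G. \<forall>y\<in>carrier G. f (bracket G x y) = bracket H (f x) (f y))"

definition lie_center :: "'v lie_alg \<Rightarrow> 'v set" where
  "lie_center G = {z \<in> carrier G. \<forall>x\<in>carrier G. bracket G z x = \<zero>\<^bsub>G\<^esub>}"

definition central_extension :: "'v lie_alg \<Rightarrow> 'w lie_alg \<Rightarrow> ('v \<Rightarrow> 'w) \<Rightarrow> bool" where
  "central_extension E G \<pi> \<longleftrightarrow> lie_algebra E \<and> lie_algebra G \<and> lie_hom E G \<pi> \<and>
     \<pi> ` carrier E = carrier G \<and> a_kernel E G \<pi> \<subseteq> lie_center E"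

section \<open>Grounded L-infinity algebras\<close>

text \<open>The data of an L-infinity algebra: a graded vector space and its brackets. The
  bracket of arity \<open>k\<close> is \<open>brk\<close> applied to lists of \<open>k\<close> homogeneous elements, each tagged with its
  degree.\<close>

record 'v linf =
  grade :: "int \<Rightarrow> (real, 'v) module"
  brk :: "(int \<times> 'v) list \<Rightarrow> 'v"

definition linf_boundaries :: "'v linf \<Rightarrow> 'v set" where
  "linf_boundaries L = (\<lambda>x. brk L [(-1, x)]) ` carrier (grade L (-1))"

definition linf_coset :: "'v linf \<Rightarrow> 'v \<Rightarrow> 'v set" where
  "linf_coset L x = linf_boundaries L +>\<^bsub>grade L 0\<^esub> x"

text \<open>The quotient of degree \<open>0\<close> by the boundaries. As for quotient rings in HOL-Algebra, the induced
  operations are unions over all representatives; such a union is a single coset exactly when the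
  operation is well defined.\<close>

definition linf_quotient :: "'v linf \<Rightarrow> 'v set lie_alg" where
  "linf_quotient L =
     \<lparr>carrier = a_rcosets\<^bsub>grade L 0\<^esub> (linf_boundaries L), mult = undefined, one = undefined,
      zero = linf_boundaries L, add = set_add (grade L 0),
      smult = (\<lambda>c C. \<Union>x\<in>C. linf_coset L (c \<odot>\<^bsub>grade L 0\<^esub> x)),
      bracket = (\<lambda>C D. \<Union>x\<in>C. \<Union>y\<in>D. linf_coset L (brk L [(0, x), (0, y)]))\<rparr>"

text \<open>L-infinity morphisms from a grounded L-infinity algebra to a Lie algebra. For degree reasons
  all components other than the linear map \<open>f\<close> on degree \<open>0\<close> vanish, and so do all
  equations other than those below.\<close>

definition grounded_linf_morphism :: "'v linf \<Rightarrow> 'w lie_alg \<Rightarrow> ('v \<Rightarrow> 'w) \<Rightarrow> bool" where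
  "grounded_linf_morphism L G f \<longleftrightarrow> real_linear (grade L 0) G f \<and>
     (\<forall>x\<in>carrier (grade L (-1)). f (brk L [(-1, x)]) = \<zero>\<^bsub>G\<^esub>) \<and>
     (\<forall>x\<in>carrier (grade L 0). \<forall>y\<in>carrier (grade L 0).
        f (brk L [(0, x), (0, y)]) = bracket G (f x) (f y))"

section \<open>The multisymplectic L-infinity algebra of a volume form\<close>

definition form_space :: "'a dform set \<Rightarrow> (real, 'a dform) module" where
  "form_space S =
     \<lparr>carrier = S, mult = undefined, one = undefined,
      zero = (\<lambda>p vs. 0), add = (\<lambda>\<alpha> \<beta> p vs. \<alpha> p vs + \<beta> p vs), smult = (\<lambda>c \<alpha> p vs. c * \<alpha> p vs)\<rparr>"

definition is_ham_field ::
  "('a, 'e::euclidean_space) atlas \<Rightarrow> 'a dform \<Rightarrow> 'a dform \<Rightarrow> 'a vfield \<Rightarrow> bool" where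
  "is_ham_field A \<mu> \<alpha> X \<longleftrightarrow> X \<in> vector_fields A \<and>
     int_prod X \<mu> = (\<lambda>p vs. - d_Omega A (int DIM('e) - 2) \<alpha> p vs)"

definition ham_field :: "('a, 'e::euclidean_space) atlas \<Rightarrow> 'a dform \<Rightarrow> 'a dform \<Rightarrow> 'a vfield" where
  "ham_field A \<mu> \<alpha> = (THE X. is_ham_field A \<mu> \<alpha> X)"

definition exact_div_free :: "('a, 'e::euclidean_space) atlas \<Rightarrow> 'a dform \<Rightarrow> 'a vfield lie_alg" where
  "exact_div_free A \<mu> =
     \<lparr>carrier = {X. \<exists>\<alpha>\<in>Omega A (int DIM('e) - 2). is_ham_field A \<mu> \<alpha> X},
      mult = undefined, one = undefined,
      zero = (\<lambda>p f. 0), add = (\<lambda>X Y p f. X p f + Y p f), smult = (\<lambda>c X p f. c * X p f),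
      bracket = commutator\<rparr>"

definition multisymplectic_linf ::
  "('a, 'e::euclidean_space) atlas \<Rightarrow> 'a dform \<Rightarrow> 'a dform linf" where
  "multisymplectic_linf A \<mu> =
     \<lparr>grade = (\<lambda>j. form_space
        (if - (int DIM('e) - 2) \<le> j \<and> j \<le> 0 then Omega A (int DIM('e) - 2 + j) else {\<lambda>p vs. 0})),
      brk = (\<lambda>xs. let k = length xs in
        if k = 1 then
          (if fst (hd xs) < 0 then d_Omega A (int DIM('e) - 2 + fst (hd xs)) (snd (hd xs))
           else (\<lambda>p vs. 0))
        else if 2 \<le> k \<and> k \<le> DIM('e) \<and> (\<forall>x\<in>set xs. fst x = 0) then
          (\<lambda>p vs. - ((-1) ^ (k * (k + 1) div 2)) *
             fold (\<lambda>x. int_prod (ham_field A \<mu> (snd x))) xs \<mu> p vs)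
        else (\<lambda>p vs. 0))\<rparr>"

text \<open>The map sending the class of \<open>\<alpha>\<close> to the vector field of \<open>\<alpha>\<close>.\<close>

definition class_field ::
  "('a, 'e::euclidean_space) atlas \<Rightarrow> 'a dform \<Rightarrow> 'a dform set \<Rightarrow> 'a vfield" where
  "class_field A \<mu> C = the_elem (ham_field A \<mu> ` C)"

end

theory Submission
  imports Defs "HOL-Library.Function_Algebras"
begin

text \<open>
  Write \<open>X\<^sub>\<alpha>\<close> for the field with \<open>\<iota>\<^bsub>X\<^sub>\<alpha>\<^esub> \<mu> = - d\<alpha>\<close>, so that
  \<open>l\<^sub>2(\<alpha>, \<beta>) = \<iota>\<^bsub>X\<^sub>\<beta>\<^esub> \<iota>\<^bsub>X\<^sub>\<alpha>\<^esub> \<mu>\<close>. The statement is Cartan calculus applied to \<open>\<mu>\<close>. The form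
  \<open>\<mu>\<close> is closed because there are no forms above the top degree, and \<open>\<iota>\<^sub>X \<mu>\<close> is closed for a
  Hamiltonian field \<open>X = X\<^sub>\<alpha>\<close> because \<open>d d \<alpha> = 0\<close>; hence the Lie derivative \<open>L\<^sub>X \<mu>\<close> vanishes. For a second
  such field \<open>Y = X\<^sub>\<beta>\<close> this gives \<open>\<iota>\<^bsub>[X,Y]\<^esub> \<mu> = L\<^sub>X \<iota>\<^sub>Y \<mu> = d \<iota>\<^sub>X \<iota>\<^sub>Y \<mu> = - d l\<^sub>2(\<alpha>, \<beta>)\<close>, that is,
  \<open>X\<close> of \<open>l\<^sub>2(\<alpha>, \<beta>)\<close> is \<open>[X\<^sub>\<alpha>, X\<^sub>\<beta>]\<close> (\<open>is_ham_br\<close>). The same rules show that the cyclic sum of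
  \<open>l\<^sub>2(\<alpha>, l\<^sub>2(\<beta>, \<gamma>))\<close> is \<open>- d \<iota>\<^sub>Z \<iota>\<^sub>Y \<iota>\<^sub>X \<mu>\<close> with \<open>Z = X\<^sub>\<gamma>\<close> (\<open>ham_jacobi\<close>), so the Jacobi identity holds
  modulo exact forms. Since \<open>X\<^sub>\<alpha> = 0\<close> for exact \<open>\<alpha>\<close>, the bracket descends to the quotient, and a class
  with \<open>X\<^sub>\<alpha> = 0\<close> is central because \<open>l\<^sub>2(\<alpha>, \<beta>)\<close> contracts \<open>\<mu>\<close> with \<open>X\<^sub>\<alpha>\<close>.

  Most of the work is to have this calculus, and the field \<open>X\<^sub>\<alpha>\<close>, for tangent vectors that are derivations of
  the algebra of smooth functions. The calculus itself is algebra: it uses only that smooth functions form a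
  ring on which vector fields act by derivations (locale \<open>lie_rinehart\<close>). There a form is an alternating
  multilinear map on lists of fields, \<open>L\<close> and \<open>d\<close> are defined by recursion on the list through
  Cartan's formulas, and all identities follow by induction on the degree; the invariant formula for
  \<open>d\<close> is the unfolded recursion (\<open>D_eq_sum\<close>).

  The geometry enters through finitely many frames (\<open>finite_frames\<close>): functions \<open>r\<^sub>i\<close> without common zero and
  \<open>n\<close>-tuples of vector fields with \<open>r\<^sub>i X = \<Sum>\<^sub>j \<theta>\<^sub>i\<^sub>j(X) E\<^sub>i\<^sub>j\<close> for every \<open>X\<close>. They come from coordinate
  fields multiplied by a bump function; that derivations at a point are combinations of coordinate
  derivatives is Hadamard's lemma. Frames show that a multilinear map on
  fields depends only on the values of the fields at each point (\<open>tensorial\<close>), so that it is a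
  form (\<open>form_of_forms\<close>); that forms of degree above \<open>n\<close> vanish (\<open>above_top_degree\<close>); and, by Cramer's rule,
  that \<open>X \<mapsto> \<iota>\<^sub>X \<mu>\<close> is a bijection onto forms of degree \<open>n - 1\<close>
  (\<open>contraction_injective\<close>, \<open>contraction_surjective\<close>).
\<close>

section \<open>Smooth functions on open sets\<close>

lemma Ck_on_cong:
  assumes "open S" "\<And>x. x \<in> S \<Longrightarrow> f x = g x"
  shows "Ck_on k S f \<Longrightarrow> Ck_on k S g"
  using assms(2)
proof (induction k arbitrary: f g)
  case 0
  then show ?case using continuous_on_cong[of S S f g] by simp
next
  case (Suc k)
  have der: "(g has_derivative frechet_derivative f (at x)) (at x)" if x: "x \<in> S" for x
  proof -
    have "f differentiable at x"
      using Suc.prems(1) x assms(1) by (auto simp: differentiable_on_eq_differentiable_at)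
    then have "(f has_derivative frechet_derivative f (at x)) (at x)"
      by (simp add: frechet_derivative_works)
    then show ?thesis
      using has_derivative_transform_within_open[OF _ assms(1) x, of f _ UNIV g] Suc.prems(2) by simp
  qed
  have "g differentiable_on S"
    using der assms(1) by (auto simp: differentiable_on_eq_differentiable_at differentiable_def)
  moreover have "Ck_on k S (\<lambda>x. frechet_derivative g (at x) v)" for v
  proof (rule Suc.IH)
    show "Ck_on k S (\<lambda>x. frechet_derivative f (at x) v)" using Suc.prems(1) by simp
    show "frechet_derivative f (at x) v = frechet_derivative g (at x) v" if "x \<in> S" for x
      using frechet_derivative_at[OF der[OF that]] by simp
  qed
  ultimately show ?case by simp
qed

text \<open>It is enough to exhibit some derivative: the operator \<open>frechet_derivative\<close> in the definition of
  \<open>Ck_on\<close> agrees with it on the open set, because derivatives there are unique.\<close>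

lemma Ck_on_SucI:
  assumes "open S" "\<And>x. x \<in> S \<Longrightarrow> (f has_derivative f' x) (at x)" "\<And>v. Ck_on k S (\<lambda>x. f' x v)"
  shows "Ck_on (Suc k) S f"
proof -
  have "f differentiable_on S"
    using assms(1,2) by (auto simp: differentiable_on_eq_differentiable_at differentiable_def)
  moreover have "Ck_on k S (\<lambda>x. frechet_derivative f (at x) v)" for v
    by (rule Ck_on_cong[OF assms(1) _ assms(3)[of v]]) (simp add: frechet_derivative_at[OF assms(2), symmetric])
  ultimately show ?thesis by simp
qed

lemma Ck_on_SucD:
  assumes "open S" "Ck_on (Suc k) S f"
  shows "x \<in> S \<Longrightarrow> (f has_derivative frechet_derivative f (at x)) (at x)"
    and "Ck_on k S (\<lambda>x. frechet_derivative f (at x) v)"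
  using assms by (auto simp: differentiable_on_eq_differentiable_at frechet_derivative_works)

lemma Ck_on_continuous: "open S \<Longrightarrow> Ck_on k S f \<Longrightarrow> continuous_on S f"
  by (cases k) (auto dest: differentiable_imp_continuous_on)

lemma Ck_on_Suc_imp: "Ck_on (Suc k) S f \<Longrightarrow> Ck_on k S f"
proof (induction k arbitrary: f)
  case 0
  then show ?case by (auto dest: differentiable_imp_continuous_on)
next
  case (Suc k)
  from Suc.prems have "f differentiable_on S" "\<And>v. Ck_on (Suc k) S (\<lambda>x. frechet_derivative f (at x) v)"
    by simp_all
  then show ?case using Suc.IH by simp
qed

lemma Ck_on_subset:
  assumes "open S" "T \<subseteq> S" "open T"
  shows "Ck_on k S f \<Longrightarrow> Ck_on k T f"
proof (induction k arbitrary: f)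
  case 0
  then show ?case using assms continuous_on_subset by auto
next
  case (Suc k)
  then show ?case using assms differentiable_on_subset by auto
qed

lemma Ck_on_Un:
  assumes "open S" "open T"
  shows "Ck_on k S f \<Longrightarrow> Ck_on k T f \<Longrightarrow> Ck_on k (S \<union> T) f"
proof (induction k arbitrary: f)
  case 0
  then show ?case using assms by (simp add: continuous_on_open_Un)
next
  case (Suc k)
  then show ?case
    using assms by (auto simp: differentiable_on_eq_differentiable_at open_Un)
qed

lemma Ck_on_const: "Ck_on k S (\<lambda>x. c)"
proof (induction k arbitrary: c)
  case (Suc k)
  have "frechet_derivative (\<lambda>x. c) (at x) = (\<lambda>v. 0)" for x :: 'a
    by (rule frechet_derivative_at[symmetric]) simp
  then show ?case using Suc by (simp add: differentiable_on_const)
qed simp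

lemma Ck_on_linear:
  assumes "bounded_linear f" "open S" shows "Ck_on k S f"
proof (cases k)
  case 0
  then show ?thesis using assms linear_continuous_on by simp
next
  case (Suc l)
  show ?thesis unfolding Suc
    by (rule Ck_on_SucI[OF assms(2) _ Ck_on_const]) (rule bounded_linear_imp_has_derivative[OF assms(1)])
qed

lemma Ck_on_add:
  assumes "open S"
  shows "Ck_on k S f \<Longrightarrow> Ck_on k S g \<Longrightarrow> Ck_on k S (\<lambda>x. f x + g x)"
proof (induction k arbitrary: f g)
  case 0
  then show ?case by (simp add: continuous_on_add)
next
  case (Suc k)
  show ?case
    by (rule Ck_on_SucI[OF assms has_derivative_add Suc.IH];
        rule Ck_on_SucD[OF assms Suc.prems(1)] Ck_on_SucD[OF assms Suc.prems(2)]; assumption?)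
qed

lemma Ck_on_linear_comp:
  assumes "open S" "bounded_linear h"
  shows "Ck_on k S f \<Longrightarrow> Ck_on k S (\<lambda>x. h (f x))"
proof (induction k arbitrary: f)
  case 0
  then show ?case using assms by (simp add: bounded_linear.continuous_on)
next
  case (Suc k)
  show ?case
    by (rule Ck_on_SucI[OF assms(1) bounded_linear.has_derivative[OF assms(2)] Suc.IH];
        rule Ck_on_SucD[OF assms(1) Suc.prems]; assumption?)
qed

lemma Ck_on_bilinear:
  assumes "open S" "bounded_bilinear h"
  shows "Ck_on k S f \<Longrightarrow> Ck_on k S g \<Longrightarrow> Ck_on k S (\<lambda>x. h (f x) (g x))"
proof (induction k arbitrary: f g)
  case 0
  then show ?case using assms by (simp add: bounded_bilinear.continuous_on)
next
  case (Suc k)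
  note f = Ck_on_SucD[OF assms(1) Suc.prems(1)] and g = Ck_on_SucD[OF assms(1) Suc.prems(2)]
  show ?case
  proof (rule Ck_on_SucI[OF assms(1)])
    fix x assume "x \<in> S"
    then show "((\<lambda>x. h (f x) (g x)) has_derivative
        (\<lambda>v. h (f x) (frechet_derivative g (at x) v) + h (frechet_derivative f (at x) v) (g x))) (at x)"
      by (intro bounded_bilinear.FDERIV[OF assms(2)] f g)
  next
    fix v
    show "Ck_on k S (\<lambda>x. h (f x) (frechet_derivative g (at x) v) + h (frechet_derivative f (at x) v) (g x))"
      by (rule Ck_on_add[OF assms(1) Suc.IH[OF Ck_on_Suc_imp[OF Suc.prems(1)] g(2)]
            Suc.IH[OF f(2) Ck_on_Suc_imp[OF Suc.prems(2)]]])
  qed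
qed

lemmas Ck_on_mult = Ck_on_bilinear[OF _ bounded_bilinear_mult]
lemmas Ck_on_scaleR = Ck_on_bilinear[OF _ bounded_bilinear_scaleR]

lemma Ck_on_sum:
  assumes "open S"
  shows "(\<And>i. i \<in> I \<Longrightarrow> Ck_on k S (f i)) \<Longrightarrow> Ck_on k S (\<lambda>x. \<Sum>i\<in>I. f i x)"
  by (induction I rule: infinite_finite_induct) (auto simp: Ck_on_const intro!: Ck_on_add[OF assms])

text \<open>The directions \<open>v\<close> in \<open>Ck_on\<close> are constant, whereas the chain rule differentiates \<open>g\<close> in the varying
  direction \<open>f'(x) v\<close>. Expanding this direction in the standard basis leaves a sum of products of
  functions that are handled by induction.\<close>

lemma Ck_on_compose:
  fixes f :: "'a::euclidean_space \<Rightarrow> 'b::euclidean_space" and g :: "'b \<Rightarrow> 'c::real_normed_vector"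
  assumes "open S" "open T" "f ` S \<subseteq> T"
  shows "Ck_on k S f \<Longrightarrow> Ck_on k T g \<Longrightarrow> Ck_on k S (\<lambda>x. g (f x))"
proof (induction k arbitrary: g)
  case 0
  then show ?case using assms(3) by (auto intro: continuous_on_compose2)
next
  case (Suc k)
  note f = Ck_on_SucD[OF assms(1) Suc.prems(1)] and g = Ck_on_SucD[OF assms(2) Suc.prems(2)]
  show ?case
  proof (rule Ck_on_SucI[OF assms(1)])
    fix x assume x: "x \<in> S"
    have lin: "linear (frechet_derivative g (at (f x)))"
      using g(1)[of "f x"] x assms(3) has_derivative_linear by blast
    have "((\<lambda>x. g (f x)) has_derivative
        (\<lambda>v. frechet_derivative g (at (f x)) (frechet_derivative f (at x) v))) (at x)"
      by (rule has_derivative_compose[OF f(1)[OF x] g(1)]) (use x assms(3) in auto)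
    also have "(\<lambda>v. frechet_derivative g (at (f x)) (frechet_derivative f (at x) v))
        = (\<lambda>v. \<Sum>b\<in>Basis. (frechet_derivative f (at x) v \<bullet> b) *\<^sub>R frechet_derivative g (at (f x)) b)"
    proof
      fix v
      have "frechet_derivative g (at (f x)) (\<Sum>b\<in>Basis. (frechet_derivative f (at x) v \<bullet> b) *\<^sub>R b)
        = (\<Sum>b\<in>Basis. (frechet_derivative f (at x) v \<bullet> b) *\<^sub>R frechet_derivative g (at (f x)) b)"
        by (simp add: linear_sum[OF lin] linear_scale[OF lin])
      then show "frechet_derivative g (at (f x)) (frechet_derivative f (at x) v)
        = (\<Sum>b\<in>Basis. (frechet_derivative f (at x) v \<bullet> b) *\<^sub>R frechet_derivative g (at (f x)) b)"
        by (simp add: euclidean_representation)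
    qed
    finally show "((\<lambda>x. g (f x)) has_derivative (\<lambda>v. \<Sum>b\<in>Basis.
        (frechet_derivative f (at x) v \<bullet> b) *\<^sub>R frechet_derivative g (at (f x)) b)) (at x)" .
  next
    fix v
    show "Ck_on k S (\<lambda>x. \<Sum>b\<in>Basis. (frechet_derivative f (at x) v \<bullet> b) *\<^sub>R frechet_derivative g (at (f x)) b)"
    proof (rule Ck_on_sum[OF assms(1)])
      fix b :: 'b
      show "Ck_on k S (\<lambda>x. (frechet_derivative f (at x) v \<bullet> b) *\<^sub>R frechet_derivative g (at (f x)) b)"
        by (rule Ck_on_scaleR[OF assms(1) Ck_on_linear_comp[OF assms(1) bounded_linear_inner_left f(2)]
              Suc.IH[OF Ck_on_Suc_imp[OF Suc.prems(1)] g(2)]])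
    qed
  qed
qed

lemma Ck_on_inverse:
  fixes f :: "'a::real_normed_vector \<Rightarrow> real"
  assumes "open S" "\<And>x. x \<in> S \<Longrightarrow> f x \<noteq> 0"
  shows "Ck_on k S f \<Longrightarrow> Ck_on k S (\<lambda>x. inverse (f x))"
proof (induction k)
  case 0
  then show ?case using assms(2) by (auto intro: continuous_on_inverse)
next
  case (Suc k)
  note f = Ck_on_SucD[OF assms(1) Suc.prems]
  have inv: "Ck_on k S (\<lambda>x. inverse (f x))" by (rule Suc.IH[OF Ck_on_Suc_imp[OF Suc.prems]])
  show ?case
  proof (rule Ck_on_SucI[OF assms(1)])
    fix x assume x: "x \<in> S"
    show "((\<lambda>x. inverse (f x)) has_derivative
        (\<lambda>v. (- 1) * (inverse (f x) * (frechet_derivative f (at x) v * inverse (f x))))) (at x)"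
      by (rule has_derivative_eq_rhs[OF Deriv.has_derivative_inverse[OF assms(2)[OF x] f(1)[OF x]]]) (simp add: mult.assoc)
  next
    fix v
    show "Ck_on k S (\<lambda>x. (- 1) * (inverse (f x) * (frechet_derivative f (at x) v * inverse (f x))))"
      by (rule Ck_on_mult[OF assms(1) Ck_on_const Ck_on_mult[OF assms(1) inv Ck_on_mult[OF assms(1) f(2) inv]]])
  qed
qed

section \<open>A flat function and Hadamard's lemma\<close>

text \<open>The functions \<open>t\<^sup>-\<^sup>m exp (- 1/t)\<close>, extended by zero to \<open>t \<le> 0\<close>. Their linear
  combinations are closed under differentiation, so all of them are smooth by one induction.\<close>

definition flat :: "nat \<Rightarrow> real \<Rightarrow> real" where
  "flat m t = (if t \<le> 0 then 0 else inverse t ^ m / exp (inverse t))"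

lemma flat_tendsto_0: "(flat m \<longlongrightarrow> 0) (at_right 0)"
proof -
  have "((\<lambda>t. inverse t ^ m / exp (inverse t)) \<longlongrightarrow> (0::real)) (at_right 0)"
    by (rule filterlim_compose[OF tendsto_power_div_exp_0 filterlim_inverse_at_top_right])
  then show ?thesis
    by (rule Lim_transform_eventually) (auto simp: flat_def eventually_at_right_less intro: eventually_mono[OF eventually_at_right_less])
qed

lemma flat_derivative:
  "(flat m has_real_derivative (flat (m + 2) t - of_nat m * flat (m + 1) t)) (at t)"
proof -
  consider "t < 0" | "t = 0" | "t > 0" by linarith
  then show ?thesis
  proof cases
    case 1
    have "((\<lambda>t. 0) has_real_derivative 0) (at t)" by simp
    then have "(flat m has_real_derivative 0) (at t)"
      by (rule DERIV_cong_ev[THEN iffD1, rotated 3, OF _ ]) (use 1 in \<open>auto simp: flat_def eventually_nhds intro!: exI[of _ "{..<0}"]\<close>)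
    then show ?thesis using 1 by (simp add: flat_def)
  next
    case 2
    have "((\<lambda>h. flat m h / h) \<longlongrightarrow> 0) (at_right 0)"
      by (rule Lim_transform_eventually[OF flat_tendsto_0[of "Suc m"]])
         (auto simp: flat_def field_simps intro: eventually_mono[OF eventually_at_right_less])
    moreover have "((\<lambda>h. flat m h / h) \<longlongrightarrow> 0) (at_left 0)"
      by (rule Lim_transform_eventually[OF tendsto_const])
         (auto simp: flat_def eventually_at_filter)
    ultimately have "((\<lambda>h. flat m h / h) \<longlongrightarrow> 0) (at 0)" by (simp add: filterlim_split_at)
    then show ?thesis using 2 by (simp add: DERIV_def flat_def)
  next
    case 3
    define y where "y = inverse t"
    have inv: "(inverse has_real_derivative - (y * y)) (at t)"
      using DERIV_inverse[of t] 3 by (simp add: y_def power2_eq_square)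
    have "((\<lambda>t. inverse t ^ m / exp (inverse t)) has_real_derivative
        (of_nat m * (- (y * y) * y ^ (m - Suc 0)) * exp y - y ^ m * (exp y * - (y * y))) / (exp y * exp y)) (at t)"
      using DERIV_divide[OF DERIV_power[OF inv, of m] DERIV_chain2[OF DERIV_exp inv]] by (simp add: y_def)
    also have "(of_nat m * (- (y * y) * y ^ (m - Suc 0)) * exp y - y ^ m * (exp y * - (y * y))) / (exp y * exp y)
        = y ^ (m + 2) / exp y - of_nat m * (y ^ (m + 1) / exp y)"
      by (cases m) (simp_all add: field_simps)
    also have "\<dots> = flat (m + 2) t - of_nat m * flat (m + 1) t"
      using 3 by (simp add: flat_def y_def)
    finally have "((\<lambda>t. inverse t ^ m / exp (inverse t)) has_real_derivative
        (flat (m + 2) t - of_nat m * flat (m + 1) t)) (at t)" .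
    then show ?thesis
      by (rule DERIV_cong_ev[THEN iffD1, rotated 3]) (use 3 in \<open>auto simp: flat_def eventually_nhds intro!: exI[of _ "{0<..}"]\<close>)
  qed
qed

lemma Ck_on_flat: "Ck_on k UNIV (flat m)"
proof (induction k arbitrary: m)
  case 0
  have "isCont (flat m) t" for t by (rule DERIV_isCont[OF flat_derivative])
  then show ?case by (simp add: continuous_at_imp_continuous_on)
next
  case (Suc k)
  show ?case
  proof (rule Ck_on_SucI)
    fix t show "(flat m has_derivative (\<lambda>v. (flat (m + 2) t + (- of_nat m) * flat (m + 1) t) * v)) (at t)"
      using flat_derivative[of m t] by (simp add: has_field_derivative_def)
  next
    fix v show "Ck_on k UNIV (\<lambda>t. (flat (m + 2) t + (- of_nat m) * flat (m + 1) t) * v)"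
      by (rule Ck_on_mult[OF open_UNIV Ck_on_add[OF open_UNIV Suc.IH Ck_on_mult[OF open_UNIV Ck_on_const Suc.IH]] Ck_on_const])
  qed simp
qed


lemma ray_in_convex:
  fixes c :: "'e::real_vector"
  assumes "convex U" "c \<in> U" "x \<in> U" "t \<in> {0..1}"
  shows "c + t *\<^sub>R (x - c) \<in> U"
  using convexD_alt[OF assms(1-3), of t] assms(4) by (simp add: algebra_simps)

lemma continuous_on_ray:
  fixes u :: "'e::euclidean_space \<Rightarrow> real"
  assumes "convex U" "c \<in> U" "continuous_on U u"
  shows "continuous_on (U \<times> {0..1}) (\<lambda>(x, t). t ^ m * u (c + t *\<^sub>R (x - c)))"
  unfolding case_prod_beta
proof (intro continuous_on_mult)
  show "continuous_on (U \<times> {0..1}) (\<lambda>z. u (c + snd z *\<^sub>R (fst z - c)))"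
    by (rule continuous_on_compose2[OF assms(3)])
       (use ray_in_convex[OF assms(1,2)] in \<open>auto intro!: continuous_intros\<close>)
qed (intro continuous_intros)

text \<open>Differentiating the integrand in the direction \<open>v\<close> replaces \<open>u\<close> by a directional derivative and
  produces a factor \<open>t\<close>. With arbitrary powers of \<open>t\<close> allowed, the family of such integrals is therefore closed
  under differentiation and smoothness follows by induction.\<close>

lemma Ck_on_ray_integral:
  fixes u :: "'e::euclidean_space \<Rightarrow> real"
  assumes U: "open U" "convex U" and c: "c \<in> U"
  shows "(\<And>l. Ck_on l U u) \<Longrightarrow> Ck_on k U (\<lambda>x. integral {0..1} (\<lambda>t. t ^ m * u (c + t *\<^sub>R (x - c))))"
proof (induction k arbitrary: u m)
  case 0
  have "continuous_on U (\<lambda>x. integral (cbox 0 1) (\<lambda>t. t ^ m * u (c + t *\<^sub>R (x - c))))"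
    using continuous_on_ray[OF U(2) c Ck_on_continuous[OF U(1) 0]]
    by (intro integral_continuous_on_param) (simp add: cbox_interval)
  then show ?case by (simp add: cbox_interval)
next
  case (Suc k)
  define du where "du x b = frechet_derivative u (at x) b" for x b
  have du: "Ck_on l U (\<lambda>x. du x b)" for l b
    unfolding du_def by (rule Ck_on_SucD(2)[OF U(1) Suc.prems])
  have u: "(u has_derivative (\<lambda>v. \<Sum>b\<in>Basis. (v \<bullet> b) * du x b)) (at x)" if "x \<in> U" for x
  proof -
    have u: "(u has_derivative frechet_derivative u (at x)) (at x)"
      by (rule Ck_on_SucD(1)[OF U(1) Suc.prems that])
    note lin = has_derivative_linear[OF u]
    have "frechet_derivative u (at x) v = (\<Sum>b\<in>Basis. (v \<bullet> b) * du x b)" for v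
    proof -
      have "frechet_derivative u (at x) (\<Sum>b\<in>Basis. (v \<bullet> b) *\<^sub>R b) = (\<Sum>b\<in>Basis. (v \<bullet> b) * du x b)"
        by (simp add: linear_sum[OF lin] linear_scale[OF lin] du_def)
      then show ?thesis by (simp add: euclidean_representation)
    qed
    then have "frechet_derivative u (at x) = (\<lambda>v. \<Sum>b\<in>Basis. (v \<bullet> b) * du x b)" by (rule ext)
    then show ?thesis using u by simp
  qed
  define K where "K x t = (\<Sum>b\<in>Basis. (t ^ Suc m * du (c + t *\<^sub>R (x - c)) b) *\<^sub>R blinfun_inner_left b)" for x t
  have ray: "continuous_on (U \<times> {0..1}) (\<lambda>z. snd z ^ Suc m * du (c + snd z *\<^sub>R (fst z - c)) b)" for b
    using continuous_on_ray[OF U(2) c Ck_on_continuous[OF U(1) du[of 0 b]], of "Suc m"]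
    by (simp add: case_prod_beta)
  have K_cont: "continuous_on (U \<times> cbox 0 1) (\<lambda>(x, t). K x t)"
    unfolding K_def case_prod_beta cbox_interval
    by (intro continuous_on_sum continuous_on_scaleR ray continuous_on_const)
  have slice: "continuous_on {0..1} (\<lambda>t. t ^ l * w (c + t *\<^sub>R (x - c)))" if x: "x \<in> U" and w: "continuous_on U w" for x l w
  proof -
    have "continuous_on {0..1} (\<lambda>t. (\<lambda>(x, t). t ^ l * w (c + t *\<^sub>R (x - c))) (x, t))"
      by (rule continuous_on_compose2[OF continuous_on_ray[OF U(2) c w]]) (use x in \<open>auto intro!: continuous_intros\<close>)
    then show ?thesis by simp
  qed
  have deriv: "((\<lambda>x. integral (cbox 0 1) (\<lambda>t. t ^ m * u (c + t *\<^sub>R (x - c)))) has_derivative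
      integral (cbox 0 1) (K x0)) (at x0 within U)" if x0: "x0 \<in> U" for x0
  proof (rule leibniz_rule[OF _ _ K_cont x0 U(2)])
    fix x t assume x: "x \<in> U" and t: "t \<in> cbox 0 (1::real)"
    then have y: "c + t *\<^sub>R (x - c) \<in> U" using ray_in_convex[OF U(2) c] by (simp add: cbox_interval)
    have "((\<lambda>x. c + t *\<^sub>R (x - c)) has_derivative (\<lambda>v. t *\<^sub>R v)) (at x within U)"
      by (auto intro!: derivative_eq_intros)
    from has_derivative_compose[OF this u[OF y]]
    have "((\<lambda>x. t ^ m * u (c + t *\<^sub>R (x - c))) has_derivative
      (\<lambda>v. t ^ m * (\<Sum>b\<in>Basis. ((t *\<^sub>R v) \<bullet> b) * du (c + t *\<^sub>R (x - c)) b))) (at x within U)"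
      by (rule has_derivative_mult_right)
    then show "((\<lambda>x. t ^ m * u (c + t *\<^sub>R (x - c))) has_derivative blinfun_apply (K x t)) (at x within U)"
      by (rule has_derivative_eq_rhs)
         (simp add: K_def blinfun.sum_left blinfun.scaleR_left sum_distrib_left fun_eq_iff mult_ac)
  next
    fix x assume "x \<in> U"
    then show "(\<lambda>t. t ^ m * u (c + t *\<^sub>R (x - c))) integrable_on cbox 0 1"
      unfolding cbox_interval
      by (intro integrable_continuous_interval slice Ck_on_continuous[OF U(1) Suc.prems[of 0]])
  qed
  show ?case
  proof (rule Ck_on_SucI[OF U(1)])
    fix x assume x: "x \<in> U"
    have K_int: "K x integrable_on {0..1}"
      unfolding K_def
      by (intro integrable_continuous_interval continuous_on_sum continuous_on_scaleR continuous_on_const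
          slice[OF x] Ck_on_continuous[OF U(1) du[of 0]])
    have term_int: "(\<lambda>t. t ^ Suc m * du (c + t *\<^sub>R (x - c)) b) integrable_on {0..1}" for b
      by (intro integrable_continuous_interval slice[OF x] Ck_on_continuous[OF U(1) du[of 0]])
    have int_K: "integral {0..1} (K x) v
        = (\<Sum>b\<in>Basis. (v \<bullet> b) * integral {0..1} (\<lambda>t. t ^ Suc m * du (c + t *\<^sub>R (x - c)) b))" for v
    proof -
      have "integral {0..1} (K x) v = integral {0..1} (\<lambda>t. K x t v)"
        using integral_linear[OF K_int blinfun.bounded_linear_left[of v]] by (simp add: o_def)
      also have "\<dots> = integral {0..1} (\<lambda>t. \<Sum>b\<in>Basis. (v \<bullet> b) * (t ^ Suc m * du (c + t *\<^sub>R (x - c)) b))"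
        by (simp add: K_def blinfun.sum_left blinfun.scaleR_left mult_ac)
      also have "\<dots> = (\<Sum>b\<in>Basis. integral {0..1} (\<lambda>t. (v \<bullet> b) * (t ^ Suc m * du (c + t *\<^sub>R (x - c)) b)))"
        by (rule integral_sum[OF finite_Basis integrable_on_mult_right[OF term_int]])
      finally show ?thesis by simp
    qed
    show "((\<lambda>x. integral {0..1} (\<lambda>t. t ^ m * u (c + t *\<^sub>R (x - c)))) has_derivative
        (\<lambda>v. \<Sum>b\<in>Basis. (v \<bullet> b) * integral {0..1} (\<lambda>t. t ^ Suc m * du (c + t *\<^sub>R (x - c)) b))) (at x)"
      using deriv[OF x] at_within_open[OF x U(1)]
      by (simp add: cbox_interval int_K[symmetric] del: power_Suc)
  next
    fix v
    show "Ck_on k U (\<lambda>x. \<Sum>b\<in>Basis. (v \<bullet> b) * integral {0..1} (\<lambda>t. t ^ Suc m * du (c + t *\<^sub>R (x - c)) b))"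
      by (rule Ck_on_sum[OF U(1) Ck_on_mult[OF U(1) Ck_on_const Suc.IH[OF du]]])
  qed
qed

text \<open>Hadamard's lemma: \<open>u x - u c\<close> is the integral of the derivative of \<open>u\<close> along the segment from \<open>c\<close> to \<open>x\<close>,
  and \<open>x - c\<close> can be taken out of the integral.\<close>

lemma hadamard:
  fixes u :: "'e::euclidean_space \<Rightarrow> real"
  assumes U: "open U" "convex U" and c: "c \<in> U" and u: "smooth_on U u"
  obtains g where "\<And>b. smooth_on U (g b)" "\<And>b. g b c = frechet_derivative u (at c) b"
    "\<And>x. x \<in> U \<Longrightarrow> u x = u c + (\<Sum>b\<in>Basis. ((x - c) \<bullet> b) * g b x)"
proof -
  have Ck: "Ck_on k U u" for k using u by (simp add: smooth_on_def)
  define du where "du x b = frechet_derivative u (at x) b" for x b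
  have du: "Ck_on l U (\<lambda>x. du x b)" for l b
    unfolding du_def by (rule Ck_on_SucD(2)[OF U(1) Ck])
  \<comment> \<open>The factor \<open>t ^ 0\<close> only brings the integrals into the form of \<open>Ck_on_ray_integral\<close>.\<close>
  define g where "g b x = integral {0..1} (\<lambda>t. t ^ 0 * du (c + t *\<^sub>R (x - c)) b)" for b x
  show thesis
  proof
    show "smooth_on U (g b)" for b
      unfolding smooth_on_def g_def using Ck_on_ray_integral[OF U c du] by blast
    show "g b c = frechet_derivative u (at c) b" for b
      by (simp add: g_def du_def)
    fix x assume x: "x \<in> U"
    have FTC: "((\<lambda>t. \<Sum>b\<in>Basis. ((x - c) \<bullet> b) * du (c + t *\<^sub>R (x - c)) b) has_integral
        u (c + 1 *\<^sub>R (x - c)) - u (c + 0 *\<^sub>R (x - c))) {0..1}"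
    proof (rule fundamental_theorem_of_calculus)
      fix t :: real assume "t \<in> {0..1}"
      then have y: "c + t *\<^sub>R (x - c) \<in> U" by (rule ray_in_convex[OF U(2) c x])
      note D = Ck_on_SucD(1)[OF U(1) Ck y]
      have "frechet_derivative u (at (c + t *\<^sub>R (x - c))) (\<Sum>b\<in>Basis. ((x - c) \<bullet> b) *\<^sub>R b)
          = (\<Sum>b\<in>Basis. ((x - c) \<bullet> b) * du (c + t *\<^sub>R (x - c)) b)"
        by (simp add: linear_sum[OF has_derivative_linear[OF D]] linear_scale[OF has_derivative_linear[OF D]] du_def)
      then have eq: "frechet_derivative u (at (c + t *\<^sub>R (x - c))) (x - c)
          = (\<Sum>b\<in>Basis. ((x - c) \<bullet> b) * du (c + t *\<^sub>R (x - c)) b)"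
        by (simp add: euclidean_representation)
      have "((\<lambda>t. c + t *\<^sub>R (x - c)) has_derivative (\<lambda>s. s *\<^sub>R (x - c))) (at t within {0..1})"
        by (auto intro!: derivative_eq_intros)
      from has_derivative_compose[OF this D]
      have "((\<lambda>t. u (c + t *\<^sub>R (x - c))) has_derivative
          (\<lambda>s. s *\<^sub>R (\<Sum>b\<in>Basis. ((x - c) \<bullet> b) * du (c + t *\<^sub>R (x - c)) b))) (at t within {0..1})"
        by (simp add: linear_scale[OF has_derivative_linear[OF D]] eq)
      then show "((\<lambda>t. u (c + t *\<^sub>R (x - c))) has_vector_derivative
          (\<Sum>b\<in>Basis. ((x - c) \<bullet> b) * du (c + t *\<^sub>R (x - c)) b)) (at t within {0..1})"
        by (simp add: has_vector_derivative_def)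
    qed simp
    have int: "(\<lambda>t. du (c + t *\<^sub>R (x - c)) b) integrable_on {0..1}" for b
    proof (rule integrable_continuous_interval)
      show "continuous_on {0..1} (\<lambda>t. du (c + t *\<^sub>R (x - c)) b)"
        by (rule continuous_on_compose2[OF Ck_on_continuous[OF U(1) du[of 0 b]]])
           (use ray_in_convex[OF U(2) c x] in \<open>auto intro!: continuous_intros\<close>)
    qed
    have "u x - u c = integral {0..1} (\<lambda>t. \<Sum>b\<in>Basis. ((x - c) \<bullet> b) * du (c + t *\<^sub>R (x - c)) b)"
      using integral_unique[OF FTC] by simp
    also have "\<dots> = (\<Sum>b\<in>Basis. integral {0..1} (\<lambda>t. ((x - c) \<bullet> b) * du (c + t *\<^sub>R (x - c)) b))"
      by (rule integral_sum[OF finite_Basis integrable_on_mult_right[OF int]])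
    finally show "u x = u c + (\<Sum>b\<in>Basis. ((x - c) \<bullet> b) * g b x)"
      by (simp add: g_def)
  qed
qed

section \<open>Cartan calculus of a Lie-Rinehart pair\<close>

lemma nths_drop_one: "i < length xs \<Longrightarrow> nths xs (- {i}) = take i xs @ drop (Suc i) xs"
proof (induction xs arbitrary: i)
  case (Cons x xs)
  show ?case
  proof (cases i)
    case 0
    then show ?thesis by (simp add: nths_Cons nths_all)
  next
    case (Suc j)
    then have "{l. Suc l \<noteq> i} = - {j}" by auto
    then show ?thesis using Cons Suc by (simp add: nths_Cons)
  qed
qed simp

lemma nths_Cons_drop:
  "nths (x # xs) (- {0}) = xs" "nths (x # xs) (- {Suc i}) = x # nths xs (- {i})"
  "nths (x # xs) (- {0, Suc j}) = nths xs (- {j})"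
  "nths (x # xs) (- {Suc i, Suc j}) = x # nths xs (- {i, j})"
proof -
  have "{l. Suc l \<noteq> Suc i} = - {i}" "{l. Suc l \<noteq> 0 \<and> Suc l \<noteq> Suc j} = - {j}"
    "{l. Suc l \<noteq> Suc i \<and> Suc l \<noteq> Suc j} = - {i, j}"
    by auto
  then show "nths (x # xs) (- {0}) = xs" "nths (x # xs) (- {Suc i}) = x # nths xs (- {i})"
    "nths (x # xs) (- {0, Suc j}) = nths xs (- {j})"
    "nths (x # xs) (- {Suc i, Suc j}) = x # nths xs (- {i, j})"
    by (simp_all add: nths_Cons nths_all)
qed

text \<open>Smooth functions \<open>C\<close> and vector fields \<open>V\<close>, reduced to their algebra: \<open>V\<close> is a \<open>C\<close>-module and a Lie
  algebra acting on \<open>C\<close> by derivations. Both are subsets of larger types, since smoothness is a predicate. The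
  last assumption turns identities between fields into identities between operators on \<open>C\<close>; the
  rules for the bracket are all obtained in this way.\<close>

locale lie_rinehart =
  fixes C :: "'r::comm_ring_1 set" and V :: "'x::ab_group_add set"
    and act :: "'x \<Rightarrow> 'r \<Rightarrow> 'r" and scale :: "'r \<Rightarrow> 'x \<Rightarrow> 'x" and br :: "'x \<Rightarrow> 'x \<Rightarrow> 'x"
  assumes C_0: "0 \<in> C"
    and C_add: "f \<in> C \<Longrightarrow> g \<in> C \<Longrightarrow> f + g \<in> C"
    and C_diff: "f \<in> C \<Longrightarrow> g \<in> C \<Longrightarrow> f - g \<in> C"
    and C_mult: "f \<in> C \<Longrightarrow> g \<in> C \<Longrightarrow> f * g \<in> C"
    and V_0: "0 \<in> V"
    and V_add: "X \<in> V \<Longrightarrow> Y \<in> V \<Longrightarrow> X + Y \<in> V"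
    and V_diff: "X \<in> V \<Longrightarrow> Y \<in> V \<Longrightarrow> X - Y \<in> V"
    and V_scale: "f \<in> C \<Longrightarrow> X \<in> V \<Longrightarrow> scale f X \<in> V"
    and V_br: "X \<in> V \<Longrightarrow> Y \<in> V \<Longrightarrow> br X Y \<in> V"
    and act_C: "X \<in> V \<Longrightarrow> f \<in> C \<Longrightarrow> act X f \<in> C"
    and act_add: "X \<in> V \<Longrightarrow> f \<in> C \<Longrightarrow> g \<in> C \<Longrightarrow> act X (f + g) = act X f + act X g"
    and act_mult: "X \<in> V \<Longrightarrow> f \<in> C \<Longrightarrow> g \<in> C \<Longrightarrow> act X (f * g) = f * act X g + g * act X f"
    and act_add_left: "X \<in> V \<Longrightarrow> Y \<in> V \<Longrightarrow> act (X + Y) f = act X f + act Y f"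
    and act_scale: "X \<in> V \<Longrightarrow> f \<in> C \<Longrightarrow> act (scale f X) g = f * act X g"
    and act_br: "X \<in> V \<Longrightarrow> Y \<in> V \<Longrightarrow> act (br X Y) f = act X (act Y f) - act Y (act X f)"
    and act_faithful: "X \<in> V \<Longrightarrow> Y \<in> V \<Longrightarrow> (\<And>f. f \<in> C \<Longrightarrow> act X f = act Y f) \<Longrightarrow> X = Y"
begin

lemma act_0 [simp]: "X \<in> V \<Longrightarrow> act X 0 = 0"
  using act_add[of X 0 0] C_0 by simp

lemma act_diff:
  assumes "X \<in> V" "f \<in> C" "g \<in> C" shows "act X (f - g) = act X f - act X g"
  using act_add[of X "f - g" g] assms C_diff by simp

lemma act_0_left [simp]: "act 0 f = 0"
  using act_add_left[of 0 0 f] V_0 by simp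

lemma act_diff_left:
  assumes "X \<in> V" "Y \<in> V" shows "act (X - Y) f = act X f - act Y f"
  using act_add_left[of "X - Y" Y f] assms V_diff by simp

lemmas V_closed = V_0 V_add V_diff V_scale V_br act_C C_0 C_add C_diff C_mult

lemmas act_expand = act_add act_diff act_mult act_add_left act_diff_left act_scale act_br

lemma br_self [simp]: "X \<in> V \<Longrightarrow> br X X = 0"
  by (rule act_faithful) (simp_all add: V_closed act_expand)

lemma br_add_left: "X \<in> V \<Longrightarrow> Y \<in> V \<Longrightarrow> Z \<in> V \<Longrightarrow> br (X + Y) Z = br X Z + br Y Z"
  by (rule act_faithful) (simp_all add: V_closed act_expand)

lemma br_add_right: "X \<in> V \<Longrightarrow> Y \<in> V \<Longrightarrow> Z \<in> V \<Longrightarrow> br X (Y + Z) = br X Y + br X Z"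
  by (rule act_faithful) (simp_all add: V_closed act_expand)

lemma br_anti: "X \<in> V \<Longrightarrow> Y \<in> V \<Longrightarrow> br X Y = - br Y X"
  using V_diff[OF V_0, of "br Y X"] act_diff_left[OF V_0, of "br Y X"]
  by (intro act_faithful) (simp_all add: V_br act_br)

lemma br_scale_right:
  "X \<in> V \<Longrightarrow> Y \<in> V \<Longrightarrow> f \<in> C \<Longrightarrow> br X (scale f Y) = scale f (br X Y) + scale (act X f) Y"
  by (rule act_faithful) (simp_all add: V_closed act_expand algebra_simps)

lemma br_scale_left:
  "X \<in> V \<Longrightarrow> Y \<in> V \<Longrightarrow> f \<in> C \<Longrightarrow> br (scale f X) Y = scale f (br X Y) - scale (act Y f) X"
  by (rule act_faithful) (simp_all add: V_closed act_expand algebra_simps)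

lemma br_jacobi:
  "X \<in> V \<Longrightarrow> Y \<in> V \<Longrightarrow> Z \<in> V \<Longrightarrow> br X (br Y Z) = br (br X Y) Z + br Y (br X Z)"
  by (rule act_faithful) (simp_all add: V_closed act_expand algebra_simps)

lemma br_jacobi_cyclic:
  "X \<in> V \<Longrightarrow> Y \<in> V \<Longrightarrow> Z \<in> V \<Longrightarrow> br X (br Y Z) + br Y (br Z X) + br Z (br X Y) = 0"
  by (rule act_faithful) (simp_all add: V_closed act_expand algebra_simps)

definition vlists :: "nat \<Rightarrow> 'x list set" where
  "vlists k = {Xs. length Xs = k \<and> set Xs \<subseteq> V}"

lemma vlists_0 [simp]: "Xs \<in> vlists 0 \<longleftrightarrow> Xs = []"
  by (auto simp: vlists_def)

lemma vlists_Cons [simp]: "X # Xs \<in> vlists (Suc k) \<longleftrightarrow> X \<in> V \<and> Xs \<in> vlists k"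
  by (auto simp: vlists_def)

lemma vlists_Nil [simp]: "[] \<in> vlists k \<longleftrightarrow> k = 0"
  by (auto simp: vlists_def)

lemma vlists_SucE:
  assumes "Xs \<in> vlists (Suc k)"
  obtains X Ys where "Xs = X # Ys" "X \<in> V" "Ys \<in> vlists k"
  using assms by (cases Xs) (auto simp: vlists_def)

text \<open>Alternating \<open>C\<close>-multilinear maps on \<open>k\<close>-tuples of fields, described through the first argument: with that
  argument fixed, such a map is again one of degree \<open>k - 1\<close>. This is the shape in which interior products enter,
  and it makes all the identities below inductions on the degree. Only the first two arguments are
  required to alternate; the recursion takes care of the others.\<close>

primrec aform :: "nat \<Rightarrow> ('x list \<Rightarrow> 'r) \<Rightarrow> bool" where
  "aform 0 F \<longleftrightarrow> F [] \<in> C"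
| "aform (Suc k) F \<longleftrightarrow>
     (\<forall>X\<in>V. aform k (\<lambda>Zs. F (X # Zs))) \<and>
     (\<forall>X\<in>V. \<forall>Y\<in>V. \<forall>Zs\<in>vlists k. F ((X + Y) # Zs) = F (X # Zs) + F (Y # Zs)) \<and>
     (\<forall>f\<in>C. \<forall>X\<in>V. \<forall>Zs\<in>vlists k. F (scale f X # Zs) = f * F (X # Zs)) \<and>
     (\<forall>X\<in>V. \<forall>Zs. X # Zs \<in> vlists k \<longrightarrow> F (X # X # Zs) = 0)"

declare aform.simps(2) [simp del]

lemma aform_SucI:
  assumes "\<And>X. X \<in> V \<Longrightarrow> aform k (\<lambda>Zs. F (X # Zs))"
    and "\<And>X Y Zs. X \<in> V \<Longrightarrow> Y \<in> V \<Longrightarrow> Zs \<in> vlists k \<Longrightarrow> F ((X + Y) # Zs) = F (X # Zs) + F (Y # Zs)"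
    and "\<And>f X Zs. f \<in> C \<Longrightarrow> X \<in> V \<Longrightarrow> Zs \<in> vlists k \<Longrightarrow> F (scale f X # Zs) = f * F (X # Zs)"
    and "\<And>l X Zs. k = Suc l \<Longrightarrow> X \<in> V \<Longrightarrow> Zs \<in> vlists l \<Longrightarrow> F (X # X # Zs) = 0"
  shows "aform (Suc k) F"
  unfolding aform.simps(2)
proof (intro conjI ballI allI impI)
  fix X Zs assume "X \<in> V" "X # Zs \<in> vlists k"
  then show "F (X # X # Zs) = 0" using assms(4) by (cases k) auto
qed (use assms in auto)

lemma aform_iota: "aform (Suc k) F \<Longrightarrow> X \<in> V \<Longrightarrow> aform k (\<lambda>Zs. F (X # Zs))"
  by (simp add: aform.simps)

lemma aform_add_left:
  "aform (Suc k) F \<Longrightarrow> X \<in> V \<Longrightarrow> Y \<in> V \<Longrightarrow> Zs \<in> vlists k \<Longrightarrow> F ((X + Y) # Zs) = F (X # Zs) + F (Y # Zs)"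
  by (simp add: aform.simps)

lemma aform_scale_left:
  "aform (Suc k) F \<Longrightarrow> f \<in> C \<Longrightarrow> X \<in> V \<Longrightarrow> Zs \<in> vlists k \<Longrightarrow> F (scale f X # Zs) = f * F (X # Zs)"
  by (simp add: aform.simps)

lemma aform_alternating:
  "aform (Suc (Suc k)) F \<Longrightarrow> X \<in> V \<Longrightarrow> Zs \<in> vlists k \<Longrightarrow> F (X # X # Zs) = 0"
  unfolding aform.simps(2)[of "Suc k"] by simp

lemma aform_smooth: "aform k F \<Longrightarrow> Xs \<in> vlists k \<Longrightarrow> F Xs \<in> C"
proof (induction k arbitrary: F Xs)
  case (Suc k)
  then show ?case by (elim vlists_SucE) (metis aform_iota)
qed simp

lemma aform_diff: "aform k F \<Longrightarrow> aform k G \<Longrightarrow> aform k (\<lambda>Zs. F Zs - G Zs)"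
proof (induction k arbitrary: F G)
  case (Suc k)
  note F = Suc.prems(1) and G = Suc.prems(2)
  show ?case
    by (rule aform_SucI)
       (use Suc in \<open>simp_all add: aform_iota aform_add_left[OF F] aform_scale_left[OF F]
          aform_add_left[OF G] aform_scale_left[OF G] aform_alternating[of _ F] aform_alternating[of _ G]
          algebra_simps\<close>)
qed (simp add: C_diff)

lemma aform_scale: "f \<in> C \<Longrightarrow> aform k F \<Longrightarrow> aform k (\<lambda>Zs. f * F Zs)"
proof (induction k arbitrary: F)
  case (Suc k)
  note F = Suc.prems(2)
  show ?case
    by (rule aform_SucI)
       (use Suc in \<open>simp_all add: aform_iota aform_add_left[OF F] aform_scale_left[OF F]
          aform_alternating[of _ F] algebra_simps\<close>)
qed (simp add: C_mult)

lemma aform_uminus: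
  assumes F: "aform k F" shows "aform k (\<lambda>Zs. - F Zs)"
  using aform_diff[OF aform_scale[OF C_0 F] F] by simp

lemma aform_diff_left:
  assumes F: "aform (Suc k) F" and V: "X \<in> V" "Y \<in> V" and Zs: "Zs \<in> vlists k"
  shows "F ((X - Y) # Zs) = F (X # Zs) - F (Y # Zs)"
  using aform_add_left[OF F V_diff[OF V] V(2) Zs] by (simp add: eq_diff_eq)

lemma aform_0_left: "aform (Suc k) F \<Longrightarrow> Zs \<in> vlists k \<Longrightarrow> F (0 # Zs) = 0"
  using aform_diff_left[of k F 0 0 Zs] V_0 by simp

text \<open>The usual polarisation of \<open>F (X + Y) (X + Y) = 0\<close>.\<close>

lemma aform_swap:
  assumes F: "aform (Suc (Suc k)) F" and X: "X \<in> V" and Y: "Y \<in> V" and Zs: "Zs \<in> vlists k"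
  shows "F (X # Y # Zs) = - F (Y # X # Zs)"
proof -
  have XY: "X + Y \<in> V" using X Y by (rule V_add)
  have split: "F (Z # (X + Y) # Zs) = F (Z # X # Zs) + F (Z # Y # Zs)" if "Z \<in> V" for Z
    using aform_add_left[OF aform_iota[OF F that] X Y Zs] by simp
  have "F ((X + Y) # (X + Y) # Zs) = F (X # (X + Y) # Zs) + F (Y # (X + Y) # Zs)"
    by (rule aform_add_left[OF F X Y]) (use XY Zs in simp)
  then have "0 = F (X # Y # Zs) + F (Y # X # Zs)"
    by (simp only: split[OF X] split[OF Y] aform_alternating[OF F X Zs] aform_alternating[OF F Y Zs]
        aform_alternating[OF F XY Zs] add_0_left add_0_right)
  then show ?thesis by (metis add_eq_0_iff add.commute)
qed

text \<open>The Lie derivative and the exterior derivative are defined by Cartan's formulas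
  \<open>\<iota>\<^sub>Y L\<^sub>X = L\<^sub>X \<iota>\<^sub>Y - \<iota>\<^bsub>[X,Y]\<^esub>\<close> and \<open>\<iota>\<^sub>X d = L\<^sub>X - d \<iota>\<^sub>X\<close>, read as recursions on the list of arguments, where
  \<open>\<iota>\<^sub>X F\<close> is \<open>\<lambda>Zs. F (X # Zs)\<close>. The degree of a form is the length of the lists that it is evaluated
  on. In the function \<open>D\<close> below, the value \<open>0\<close> at the empty list says that functions have no interior product, so
  that \<open>D F [X]\<close> is the derivative of the function \<open>F []\<close> along \<open>X\<close>. The product \<open>df \<and> F\<close> is \<open>wedge_d f F\<close>, again
  through its interior products.\<close>

fun Lie :: "'x \<Rightarrow> ('x list \<Rightarrow> 'r) \<Rightarrow> 'x list \<Rightarrow> 'r" where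
  "Lie X F [] = act X (F [])"
| "Lie X F (Y # Ys) = Lie X (\<lambda>Zs. F (Y # Zs)) Ys - F (br X Y # Ys)"

fun wedge_d :: "'r \<Rightarrow> ('x list \<Rightarrow> 'r) \<Rightarrow> 'x list \<Rightarrow> 'r" where
  "wedge_d f F [] = 0"
| "wedge_d f F (X # Xs) = act X f * F Xs - wedge_d f (\<lambda>Zs. F (X # Zs)) Xs"

fun D :: "('x list \<Rightarrow> 'r) \<Rightarrow> 'x list \<Rightarrow> 'r" where
  "D F [] = 0"
| "D F (X # Xs) = Lie X F Xs - D (\<lambda>Zs. F (X # Zs)) Xs"

lemma Lie_cong:
  "X \<in> V \<Longrightarrow> (\<And>Zs. Zs \<in> vlists k \<Longrightarrow> F Zs = G Zs) \<Longrightarrow> Ys \<in> vlists k \<Longrightarrow> Lie X F Ys = Lie X G Ys"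
proof (induction k arbitrary: F G Ys)
  case (Suc k)
  from \<open>Ys \<in> vlists (Suc k)\<close> obtain Y Zs where Ys: "Ys = Y # Zs" "Y \<in> V" "Zs \<in> vlists k"
    by (rule vlists_SucE)
  have "Lie X (\<lambda>Zs. F (Y # Zs)) Zs = Lie X (\<lambda>Zs. G (Y # Zs)) Zs"
    by (rule Suc.IH) (use Suc.prems Ys in auto)
  then show ?case using Suc.prems Ys V_br by simp
qed simp

lemma Lie_add:
  "X \<in> V \<Longrightarrow> aform k F \<Longrightarrow> aform k G \<Longrightarrow> Ys \<in> vlists k \<Longrightarrow>
     Lie X (\<lambda>Zs. F Zs + G Zs) Ys = Lie X F Ys + Lie X G Ys"
proof (induction k arbitrary: F G Ys)
  case 0
  then show ?case by (simp add: act_add)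
next
  case (Suc k)
  then show ?case by (elim vlists_SucE) (simp add: aform_iota)
qed

lemma Lie_diff:
  "X \<in> V \<Longrightarrow> aform k F \<Longrightarrow> aform k G \<Longrightarrow> Ys \<in> vlists k \<Longrightarrow>
     Lie X (\<lambda>Zs. F Zs - G Zs) Ys = Lie X F Ys - Lie X G Ys"
proof (induction k arbitrary: F G Ys)
  case 0
  then show ?case by (simp add: act_diff)
next
  case (Suc k)
  then show ?case by (elim vlists_SucE) (simp add: aform_iota)
qed

lemma Lie_scale:
  "X \<in> V \<Longrightarrow> f \<in> C \<Longrightarrow> aform k F \<Longrightarrow> Ys \<in> vlists k \<Longrightarrow>
     Lie X (\<lambda>Zs. f * F Zs) Ys = act X f * F Ys + f * Lie X F Ys"
proof (induction k arbitrary: F Ys)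
  case 0
  then show ?case by (simp add: act_mult algebra_simps)
next
  case (Suc k)
  then show ?case by (elim vlists_SucE) (simp add: aform_iota algebra_simps)
qed

lemma Lie_0 [simp]: "X \<in> V \<Longrightarrow> Lie X (\<lambda>Zs. 0) Ys = 0"
  by (induction Ys) simp_all

lemma aform_Lie: "X \<in> V \<Longrightarrow> aform k F \<Longrightarrow> aform k (Lie X F)"
proof (induction k arbitrary: F)
  case 0
  then show ?case by (simp add: act_C)
next
  case (Suc k)
  note X = Suc.prems(1) and F = Suc.prems(2)
  show ?case
  proof (rule aform_SucI)
    fix Y assume Y: "Y \<in> V"
    show "aform k (\<lambda>Zs. Lie X F (Y # Zs))"
      unfolding Lie.simps
      by (intro aform_diff Suc.IH[OF X] aform_iota[OF F] V_br X Y)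
  next
    fix Y Z Zs assume V: "Y \<in> V" "Z \<in> V" and Zs: "Zs \<in> vlists k"
    have "Lie X (\<lambda>Zs. F ((Y + Z) # Zs)) Zs = Lie X (\<lambda>Zs. F (Y # Zs) + F (Z # Zs)) Zs"
      by (rule Lie_cong[OF X _ Zs]) (simp add: aform_add_left[OF F V])
    also have "\<dots> = Lie X (\<lambda>Zs. F (Y # Zs)) Zs + Lie X (\<lambda>Zs. F (Z # Zs)) Zs"
      by (rule Lie_add[OF X aform_iota[OF F V(1)] aform_iota[OF F V(2)] Zs])
    finally show "Lie X F ((Y + Z) # Zs) = Lie X F (Y # Zs) + Lie X F (Z # Zs)"
      using X V Zs by (simp add: br_add_right V_br aform_add_left[OF F])
  next
    fix f Y Zs assume f: "f \<in> C" and Y: "Y \<in> V" and Zs: "Zs \<in> vlists k"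
    have "Lie X (\<lambda>Zs. F (scale f Y # Zs)) Zs = Lie X (\<lambda>Zs. f * F (Y # Zs)) Zs"
      by (rule Lie_cong[OF X _ Zs]) (simp add: aform_scale_left[OF F f Y])
    also have "\<dots> = act X f * F (Y # Zs) + f * Lie X (\<lambda>Zs. F (Y # Zs)) Zs"
      by (rule Lie_scale[OF X f aform_iota[OF F Y] Zs])
    finally show "Lie X F (scale f Y # Zs) = f * Lie X F (Y # Zs)"
      using X f Y Zs
      by (simp add: br_scale_right V_closed aform_add_left[OF F] aform_scale_left[OF F] algebra_simps)
  next
    fix l Y Zs assume k: "k = Suc l" and Y: "Y \<in> V" and Zs: "Zs \<in> vlists l"
    have "Lie X (\<lambda>Zs. F (Y # Y # Zs)) Zs = Lie X (\<lambda>Zs. 0) Zs"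
      by (rule Lie_cong[OF X _ Zs]) (simp add: aform_alternating[OF F[unfolded k] Y])
    moreover have "F (Y # br X Y # Zs) = - F (br X Y # Y # Zs)"
      by (rule aform_swap[OF F[unfolded k] Y V_br[OF X Y] Zs])
    ultimately show "Lie X F (Y # Y # Zs) = 0" using X by simp
  qed
qed

text \<open>Both sides have the same commutation rule with interior products, by the Jacobi identity for
  fields; in degree \<open>0\<close> the claim is the definition of the bracket.\<close>

lemma Lie_br:
  "X \<in> V \<Longrightarrow> Y \<in> V \<Longrightarrow> aform k F \<Longrightarrow> Zs \<in> vlists k \<Longrightarrow>
     Lie (br X Y) F Zs = Lie X (Lie Y F) Zs - Lie Y (Lie X F) Zs"
proof (induction k arbitrary: F Zs)
  case 0
  then show ?case by (simp add: act_br)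
next
  case (Suc k)
  note V = Suc.prems(1,2) and F = Suc.prems(3)
  from \<open>Zs \<in> vlists (Suc k)\<close> obtain Z Ws where Zs: "Zs = Z # Ws" "Z \<in> V" "Ws \<in> vlists k"
    by (rule vlists_SucE)
  have step: "Lie A (Lie B F) Zs = Lie A (Lie B (\<lambda>Zs. F (Z # Zs))) Ws - Lie A (\<lambda>Zs. F (br B Z # Zs)) Ws
      - (Lie B (\<lambda>Zs. F (br A Z # Zs)) Ws - F (br B (br A Z) # Ws))"
    if AB: "A \<in> V" "B \<in> V" for A B
  proof -
    have "Lie A (\<lambda>Zs. Lie B F (Z # Zs)) Ws
        = Lie A (Lie B (\<lambda>Zs. F (Z # Zs))) Ws - Lie A (\<lambda>Zs. F (br B Z # Zs)) Ws"
      unfolding Lie.simps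
      by (intro Lie_diff[OF AB(1), of k] aform_Lie[OF AB(2)] aform_iota[OF F] V_br AB Zs)
    then show ?thesis unfolding Zs(1) by simp
  qed
  have "F (br X (br Y Z) # Ws) = F (br (br X Y) Z # Ws) + F (br Y (br X Z) # Ws)"
    using V Zs by (simp add: br_jacobi[of X Y Z] V_br aform_add_left[OF F])
  moreover have "Lie (br X Y) (\<lambda>Zs. F (Z # Zs)) Ws
      = Lie X (Lie Y (\<lambda>Zs. F (Z # Zs))) Ws - Lie Y (Lie X (\<lambda>Zs. F (Z # Zs))) Ws"
    by (rule Suc.IH[OF V aform_iota[OF F Zs(2)] Zs(3)])
  ultimately show ?case
    unfolding step[OF V] step[OF V(2,1)] by (simp add: Zs(1) algebra_simps)
qed

lemma Lie_add_left:
  "X \<in> V \<Longrightarrow> Y \<in> V \<Longrightarrow> aform k F \<Longrightarrow> Zs \<in> vlists k \<Longrightarrow> Lie (X + Y) F Zs = Lie X F Zs + Lie Y F Zs"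
proof (induction k arbitrary: F Zs)
  case 0
  then show ?case by (simp add: act_add_left)
next
  case (Suc k)
  note F = Suc.prems(3)
  from Suc show ?case
    by (elim vlists_SucE) (simp add: aform_iota br_add_left V_br aform_add_left[OF F])
qed

lemma wedge_d_anti:
  "(\<And>Zs. Zs \<in> vlists k \<Longrightarrow> F Zs = - G Zs) \<Longrightarrow> Ys \<in> vlists (Suc k) \<Longrightarrow>
     wedge_d f F Ys = - wedge_d f G Ys"
proof (induction k arbitrary: F G Ys)
  case 0
  then show ?case by (elim vlists_SucE) simp
next
  case (Suc k)
  from \<open>Ys \<in> vlists (Suc (Suc k))\<close> obtain Y Zs where Ys: "Ys = Y # Zs" "Y \<in> V" "Zs \<in> vlists (Suc k)"
    by (rule vlists_SucE)
  have "wedge_d f (\<lambda>Zs. F (Y # Zs)) Zs = - wedge_d f (\<lambda>Zs. G (Y # Zs)) Zs"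
    by (rule Suc.IH) (use Suc.prems Ys in auto)
  then show ?case using Suc.prems(1) Ys by simp
qed

text \<open>The Lie derivative is not \<open>C\<close>-linear in the field: the defect is \<open>df \<and> \<iota>\<^sub>X F\<close>. The exterior derivative
  has the same kind of defect, \<open>d(f F) = f dF + df \<and> F\<close> (\<open>D_scale\<close> below), and the two cancel in
  \<open>L\<^sub>X - d \<iota>\<^sub>X\<close>.\<close>

lemma Lie_scale_left:
  "X \<in> V \<Longrightarrow> f \<in> C \<Longrightarrow> aform k F \<Longrightarrow> Zs \<in> vlists k \<Longrightarrow>
     Lie (scale f X) F Zs = f * Lie X F Zs + wedge_d f (\<lambda>Zs. F (X # Zs)) Zs"
proof (induction k arbitrary: F Zs)
  case 0
  then show ?case by (simp add: act_scale)
next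
  case (Suc k)
  note X = Suc.prems(1) and f = Suc.prems(2) and F = Suc.prems(3)
  from \<open>Zs \<in> vlists (Suc k)\<close> obtain Z Ws where Zs: "Zs = Z # Ws" "Z \<in> V" "Ws \<in> vlists k"
    by (rule vlists_SucE)
  have swap: "wedge_d f (\<lambda>Us. F (Z # X # Us)) Ws = - wedge_d f (\<lambda>Us. F (X # Z # Us)) Ws"
  proof (cases k)
    case (Suc l)
    show ?thesis
      by (rule wedge_d_anti[of l]) (use Suc Zs X F aform_swap[of l F Z X] in auto)
  qed (use Zs in simp)
  have "Lie (scale f X) (\<lambda>Zs. F (Z # Zs)) Ws
      = f * Lie X (\<lambda>Zs. F (Z # Zs)) Ws + wedge_d f (\<lambda>Us. F (Z # X # Us)) Ws"
    by (rule Suc.IH[OF X f aform_iota[OF F Zs(2)] Zs(3)])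
  then show ?case
    using X f Zs swap
    by (simp add: br_scale_left V_closed aform_diff_left[OF F] aform_scale_left[OF F] algebra_simps)
qed

lemma D_cong:
  "(\<And>Zs. Zs \<in> vlists k \<Longrightarrow> F Zs = G Zs) \<Longrightarrow> Ys \<in> vlists (Suc k) \<Longrightarrow> D F Ys = D G Ys"
proof (induction k arbitrary: F G Ys)
  case 0
  then show ?case by (elim vlists_SucE) simp
next
  case (Suc k)
  from \<open>Ys \<in> vlists (Suc (Suc k))\<close> obtain Y Zs where Ys: "Ys = Y # Zs" "Y \<in> V" "Zs \<in> vlists (Suc k)"
    by (rule vlists_SucE)
  have "D (\<lambda>Zs. F (Y # Zs)) Zs = D (\<lambda>Zs. G (Y # Zs)) Zs"
    by (rule Suc.IH) (use Suc.prems Ys in auto)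
  moreover have "Lie Y F Zs = Lie Y G Zs"
    by (rule Lie_cong[OF Ys(2) Suc.prems(1) Ys(3)])
  ultimately show ?case using Ys by simp
qed

lemma D_0 [simp]: "set Ys \<subseteq> V \<Longrightarrow> D (\<lambda>Zs. 0) Ys = 0"
  by (induction Ys) simp_all

lemma D_add:
  "aform k F \<Longrightarrow> aform k G \<Longrightarrow> Ys \<in> vlists (Suc k) \<Longrightarrow> D (\<lambda>Zs. F Zs + G Zs) Ys = D F Ys + D G Ys"
proof (induction k arbitrary: F G Ys)
  case 0
  then show ?case by (elim vlists_SucE) (simp add: act_add)
next
  case (Suc k)
  then show ?case
    by (elim vlists_SucE[of _ "Suc k"]) (simp add: Lie_add[of _ "Suc k"] aform_iota)
qed

lemma D_diff:
  "aform k F \<Longrightarrow> aform k G \<Longrightarrow> Ys \<in> vlists (Suc k) \<Longrightarrow> D (\<lambda>Zs. F Zs - G Zs) Ys = D F Ys - D G Ys"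
proof (induction k arbitrary: F G Ys)
  case 0
  then show ?case by (elim vlists_SucE) (simp add: act_diff)
next
  case (Suc k)
  then show ?case
    by (elim vlists_SucE[of _ "Suc k"]) (simp add: Lie_diff[of _ "Suc k"] aform_iota)
qed

lemma D_uminus:
  assumes F: "aform k F" and Ys: "Ys \<in> vlists (Suc k)"
  shows "D (\<lambda>Zs. - F Zs) Ys = - D F Ys"
proof -
  have "set Ys \<subseteq> V" using Ys by (simp add: vlists_def)
  then show ?thesis using D_diff[OF aform_scale[OF C_0 F] F Ys] by simp
qed

lemma D_scale:
  "f \<in> C \<Longrightarrow> aform k F \<Longrightarrow> Ys \<in> vlists (Suc k) \<Longrightarrow>
     D (\<lambda>Zs. f * F Zs) Ys = f * D F Ys + wedge_d f F Ys"
proof (induction k arbitrary: F Ys)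
  case 0
  then show ?case by (elim vlists_SucE) (simp add: act_mult algebra_simps)
next
  case (Suc k)
  then show ?case
    by (elim vlists_SucE[of _ "Suc k"]) (simp add: Lie_scale[of _ _ "Suc k"] aform_iota algebra_simps)
qed

text \<open>Linearity in the first argument is the cancellation of the two defects described above, and
  \<open>\<iota>\<^sub>X \<iota>\<^sub>X d = 0\<close> because \<open>L\<^sub>X\<close> commutes with \<open>\<iota>\<^sub>X\<close>.\<close>

lemma aform_D: "aform k F \<Longrightarrow> aform (Suc k) (D F)"
proof (induction k arbitrary: F)
  case 0
  show ?case
    by (rule aform_SucI) (use 0 in \<open>auto simp: act_C act_add_left act_scale\<close>)
next
  case (Suc k)
  note F = Suc.prems
  show ?case
  proof (rule aform_SucI)
    fix X assume X: "X \<in> V"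
    show "aform (Suc k) (\<lambda>Zs. D F (X # Zs))"
      unfolding D.simps by (intro aform_diff aform_Lie[OF X F] Suc.IH aform_iota[OF F X])
  next
    fix X Y Zs assume V: "X \<in> V" "Y \<in> V" and Zs: "Zs \<in> vlists (Suc k)"
    have "D (\<lambda>Zs. F ((X + Y) # Zs)) Zs = D (\<lambda>Zs. F (X # Zs) + F (Y # Zs)) Zs"
      by (rule D_cong[OF _ Zs]) (simp add: aform_add_left[OF F V])
    also have "\<dots> = D (\<lambda>Zs. F (X # Zs)) Zs + D (\<lambda>Zs. F (Y # Zs)) Zs"
      by (rule D_add[OF aform_iota[OF F V(1)] aform_iota[OF F V(2)] Zs])
    finally show "D F ((X + Y) # Zs) = D F (X # Zs) + D F (Y # Zs)"
      using Lie_add_left[OF V F Zs] by simp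
  next
    fix f X Zs assume f: "f \<in> C" and X: "X \<in> V" and Zs: "Zs \<in> vlists (Suc k)"
    have "D (\<lambda>Zs. F (scale f X # Zs)) Zs = D (\<lambda>Zs. f * F (X # Zs)) Zs"
      by (rule D_cong[OF _ Zs]) (simp add: aform_scale_left[OF F f X])
    also have "\<dots> = f * D (\<lambda>Zs. F (X # Zs)) Zs + wedge_d f (\<lambda>Zs. F (X # Zs)) Zs"
      by (rule D_scale[OF f aform_iota[OF F X] Zs])
    finally show "D F (scale f X # Zs) = f * D F (X # Zs)"
      using Lie_scale_left[OF X f F Zs] by (simp add: algebra_simps)
  next
    fix l X Zs assume l: "Suc k = Suc l" and X: "X \<in> V" and "Zs \<in> vlists l"
    then have Zs: "Zs \<in> vlists k" by simp
    have "D (\<lambda>Zs. F (X # X # Zs)) Zs = 0"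
    proof (cases k)
      case 0
      then show ?thesis using Zs by simp
    next
      case (Suc l)
      have "D (\<lambda>Zs. F (X # X # Zs)) Zs = D (\<lambda>Zs. 0) Zs"
        by (rule D_cong[OF _ Zs[unfolded Suc]]) (simp add: aform_alternating[OF F[unfolded Suc] X])
      then show ?thesis using Zs by (simp add: vlists_def)
    qed
    then show "D F (X # X # Zs) = 0" using X by (simp add: aform_0_left[OF F Zs])
  qed
qed

lemma aform_D_iota: "aform k F \<Longrightarrow> X \<in> V \<Longrightarrow> aform k (D (\<lambda>Zs. F (X # Zs)))"
proof (cases k)
  case (Suc l)
  then show "aform k F \<Longrightarrow> X \<in> V \<Longrightarrow> aform k (D (\<lambda>Zs. F (X # Zs)))"
    by (simp only: aform_D aform_iota)
qed (simp add: C_0)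

text \<open>Contracting with \<open>Y\<close> and using Cartan's formulas leaves the commutators \<open>[L\<^sub>X, L\<^sub>Y] = L\<^bsub>[X,Y]\<^esub>\<close> and, on
  \<open>\<iota>\<^sub>Y F\<close>, the induction hypothesis.\<close>

lemma Lie_D:
  "X \<in> V \<Longrightarrow> aform k F \<Longrightarrow> Zs \<in> vlists (Suc k) \<Longrightarrow> Lie X (D F) Zs = D (Lie X F) Zs"
proof (induction k arbitrary: F Zs)
  case 0
  then show ?case by (elim vlists_SucE) (simp add: act_br)
next
  case (Suc k)
  note X = Suc.prems(1) and F = Suc.prems(2)
  from Suc.prems(3) obtain Y Ys where Zs: "Zs = Y # Ys" "Y \<in> V" "Ys \<in> vlists (Suc k)"
    by (rule vlists_SucE)
  note iF = aform_iota[OF F]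
  have XY: "br X Y \<in> V" using X Zs V_br by blast
  have "Lie X (D F) Zs
      = Lie X (\<lambda>Ws. Lie Y F Ws - D (\<lambda>Zs. F (Y # Zs)) Ws) Ys - D F (br X Y # Ys)"
    using Zs by simp
  also have "Lie X (\<lambda>Ws. Lie Y F Ws - D (\<lambda>Zs. F (Y # Zs)) Ws) Ys
      = Lie X (Lie Y F) Ys - Lie X (D (\<lambda>Zs. F (Y # Zs))) Ys"
    by (rule Lie_diff[OF X aform_Lie[OF Zs(2) F] aform_D_iota[OF F Zs(2)] Zs(3)])
  also have "Lie X (D (\<lambda>Zs. F (Y # Zs))) Ys = D (Lie X (\<lambda>Zs. F (Y # Zs))) Ys"
    by (rule Suc.IH[OF X iF[OF Zs(2)] Zs(3)])
  also have "D F (br X Y # Ys)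
      = Lie X (Lie Y F) Ys - Lie Y (Lie X F) Ys - D (\<lambda>Zs. F (br X Y # Zs)) Ys"
    using Lie_br[OF X Zs(2) F Zs(3)] by simp
  also have "Lie X (Lie Y F) Ys - D (Lie X (\<lambda>Zs. F (Y # Zs))) Ys
      - (Lie X (Lie Y F) Ys - Lie Y (Lie X F) Ys - D (\<lambda>Zs. F (br X Y # Zs)) Ys)
      = Lie Y (Lie X F) Ys - (D (Lie X (\<lambda>Zs. F (Y # Zs))) Ys - D (\<lambda>Zs. F (br X Y # Zs)) Ys)"
    by simp
  also have "\<dots> = D (Lie X F) Zs"
    using D_diff[OF aform_Lie[OF X iF[OF Zs(2)]] iF[OF XY] Zs(3)] Zs(1) by simp
  finally show ?case .
qed

text \<open>\<open>\<iota>\<^sub>X d d F = L\<^sub>X d F - d L\<^sub>X F + d d \<iota>\<^sub>X F\<close>, where the last term vanishes by induction.\<close>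

lemma D_D:
  "aform k F \<Longrightarrow> Zs \<in> vlists (Suc (Suc k)) \<Longrightarrow> D (D F) Zs = 0"
proof (induction k arbitrary: F Zs)
  case 0
  then obtain X Y where Zs: "Zs = [X, Y]" "X \<in> V" "Y \<in> V"
    by (elim vlists_SucE) auto
  then show ?case by (simp add: act_br)
next
  case (Suc k)
  note F = Suc.prems(1)
  from Suc.prems(2) obtain X Ys where Zs: "Zs = X # Ys" "X \<in> V" "Ys \<in> vlists (Suc (Suc k))"
    by (rule vlists_SucE)
  note iF = aform_iota[OF F Zs(2)]
  have "D (\<lambda>Ws. D F (X # Ws)) Ys = D (Lie X F) Ys - D (D (\<lambda>Zs. F (X # Zs))) Ys"
    using D_diff[OF aform_Lie[OF Zs(2) F] aform_D[OF iF] Zs(3)] by simp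
  then show ?case
    using Lie_D[OF Zs(2) F Zs(3)] Suc.IH[OF iF Zs(3)] Zs(1) by simp
qed

lemma vlists_append [simp]:
  "Xs @ Ys \<in> vlists k \<longleftrightarrow> length Xs + length Ys = k \<and> set Xs \<subseteq> V \<and> set Ys \<subseteq> V"
  by (auto simp: vlists_def)

text \<open>Every question about an arbitrary argument is reduced to the first one by this lemma.\<close>

lemma aform_move_to_front:
  "aform k F \<Longrightarrow> Us @ X # Zs \<in> vlists k \<Longrightarrow> F (Us @ X # Zs) = (-1) ^ length Us * F (X # Us @ Zs)"
proof (induction Us arbitrary: k F)
  case (Cons U Us)
  then obtain l where k: "k = Suc (Suc l)" by (cases k; cases "k - 1") auto
  have V: "U \<in> V" "X \<in> V" "Us @ Zs \<in> vlists l" using Cons.prems(2) k by auto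
  have F: "aform (Suc (Suc l)) F" using Cons.prems(1) k by simp
  have "F (U # Us @ X # Zs) = (-1) ^ length Us * F (U # X # Us @ Zs)"
    by (rule Cons.IH[OF aform_iota[OF F V(1)]]) (use V in auto)
  moreover have "F (U # X # Us @ Zs) = - F (X # U # Us @ Zs)"
    by (rule aform_swap[OF F V])
  ultimately show ?case by simp
qed simp

lemma aform_repeat:
  assumes F: "aform (Suc k) F" and Zs: "Zs \<in> vlists k" and X: "X \<in> set Zs"
  shows "F (X # Zs) = 0"
proof -
  obtain Us Ws where eq: "Zs = Us @ X # Ws" using X by (auto simp: in_set_conv_decomp)
  have XV: "X \<in> V" using Zs X by (auto simp: vlists_def)
  obtain l where k: "k = Suc l" using Zs eq by (cases k) auto
  have "F (X # Zs) = (-1) ^ length Us * F (X # X # Us @ Ws)"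
    using aform_move_to_front[OF aform_iota[OF F XV], of Us X Ws] Zs eq by simp
  also have "F (X # X # Us @ Ws) = 0"
    by (rule aform_alternating[OF F[unfolded k] XV]) (use Zs eq k in auto)
  finally show ?thesis by simp
qed

lemma aform_update:
  assumes F: "aform k F" and Xs: "Xs \<in> vlists k" and i: "i < k" and X: "X \<in> V"
  shows "F (Xs[i := X]) = (-1) ^ i * F (X # take i Xs @ drop (Suc i) Xs)"
proof -
  have len: "length Xs = k" "set Xs \<subseteq> V" using Xs by (auto simp: vlists_def)
  have eq: "Xs[i := X] = take i Xs @ X # drop (Suc i) Xs"
    using i len by (simp add: upd_conv_take_nth_drop)
  have "Xs[i := X] \<in> vlists k"
    using len X i by (auto simp: vlists_def dest: set_update_subset_insert[THEN subsetD])
  then show ?thesis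
    using aform_move_to_front[OF F, of "take i Xs" X "drop (Suc i) Xs"] i len unfolding eq by simp
qed

lemma V_sum:
  "(\<And>j. j \<in> J \<Longrightarrow> c j \<in> C) \<Longrightarrow> (\<And>j. j \<in> J \<Longrightarrow> E j \<in> V) \<Longrightarrow> (\<Sum>j\<in>J. scale (c j) (E j)) \<in> V"
  by (induction J rule: infinite_finite_induct) (auto simp: V_0 V_add V_scale)

lemma C_sum: "(\<And>j. j \<in> J \<Longrightarrow> c j \<in> C) \<Longrightarrow> sum c J \<in> C"
  by (induction J rule: infinite_finite_induct) (auto simp: C_0 C_add)

lemma aform_sum:
  assumes F: "aform (Suc k) F" and Zs: "Zs \<in> vlists k"
    and "\<And>j. j \<in> J \<Longrightarrow> c j \<in> C" "\<And>j. j \<in> J \<Longrightarrow> E j \<in> V"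
  shows "F ((\<Sum>j\<in>J. scale (c j) (E j)) # Zs) = (\<Sum>j\<in>J. c j * F (E j # Zs))"
  using assms(3,4)
proof (induction J rule: infinite_finite_induct)
  case (insert j J)
  then have "(\<Sum>j\<in>J. scale (c j) (E j)) \<in> V" "c j \<in> C" "E j \<in> V" by (auto intro!: V_sum)
  then show ?case using insert Zs V_scale by (simp add: aform_add_left[OF F] aform_scale_left[OF F])
qed (simp_all add: aform_0_left[OF F Zs])

lemma vlists_drop_one: "Xs \<in> vlists (Suc k) \<Longrightarrow> i \<le> k \<Longrightarrow> nths Xs (- {i}) \<in> vlists k"
  by (auto simp: nths_drop_one vlists_def dest: in_set_takeD in_set_dropD)

text \<open>The signs arise from moving each bracket to the first place.\<close>

lemma Lie_eq_sum:
  "X \<in> V \<Longrightarrow> aform k F \<Longrightarrow> Ys \<in> vlists k \<Longrightarrow>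
     Lie X F Ys = act X (F Ys) - (\<Sum>j<k. (-1) ^ j * F (br X (Ys ! j) # nths Ys (- {j})))"
proof (induction k arbitrary: F Ys)
  case (Suc k)
  note X = Suc.prems(1) and F = Suc.prems(2)
  from Suc.prems(3) obtain Y Zs where Ys: "Ys = Y # Zs" "Y \<in> V" "Zs \<in> vlists k"
    by (rule vlists_SucE)
  have swap: "F (Y # br X (Zs ! j) # nths Zs (- {j})) = - F (br X (Zs ! j) # Y # nths Zs (- {j}))"
    if j: "j < k" for j
  proof -
    obtain l where k: "k = Suc l" using j by (cases k) auto
    have "Zs ! j \<in> V" using Ys j by (auto simp: vlists_def)
    then show ?thesis
      using F Ys X k j by (intro aform_swap[of l F]) (auto simp: V_br vlists_drop_one)
  qed
  have "Lie X (\<lambda>Zs. F (Y # Zs)) Zs = act X (F (Y # Zs))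
      - (\<Sum>j<k. (-1) ^ j * F (Y # br X (Zs ! j) # nths Zs (- {j})))"
    by (rule Suc.IH[OF X aform_iota[OF F Ys(2)] Ys(3)])
  also have "(\<Sum>j<k. (-1) ^ j * F (Y # br X (Zs ! j) # nths Zs (- {j})))
      = (\<Sum>j<k. (-1) ^ Suc j * F (br X (Zs ! j) # Y # nths Zs (- {j})))"
    by (intro sum.cong) (auto simp: swap)
  finally show ?case
    unfolding Ys by (simp add: sum.lessThan_Suc_shift nths_Cons_drop del: sum.lessThan_Suc)
qed simp

text \<open>The invariant formula. In the sum over \<open>i\<close> and \<open>j\<close>, the terms with \<open>i = 0\<close> and the derivative along the
  first field make up the Lie derivative; all other terms belong to the contracted form.\<close>

lemma D_eq_sum:
  "aform k F \<Longrightarrow> Xs \<in> vlists (Suc k) \<Longrightarrow>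
     D F Xs = (\<Sum>i\<le>k. (-1) ^ i * act (Xs ! i) (F (nths Xs (- {i})))) +
       (\<Sum>j\<le>k. \<Sum>i<j. (-1) ^ (i + j) * F (br (Xs ! i) (Xs ! j) # nths Xs (- {i, j})))"
proof (induction k arbitrary: F Xs)
  case 0
  then show ?case by (elim vlists_SucE) (simp add: nths_Cons)
next
  case (Suc k)
  note F = Suc.prems(1)
  from Suc.prems(2) obtain X Ys where Xs: "Xs = X # Ys" "X \<in> V" "Ys \<in> vlists (Suc k)"
    by (rule vlists_SucE)
  have swap: "F (X # br (Ys ! i) (Ys ! j) # nths Ys (- {i, j}))
      = - F (br (Ys ! i) (Ys ! j) # X # nths Ys (- {i, j}))" if ij: "i < j" "j \<le> k" for i j
  proof -
    obtain l where k: "k = Suc l" using ij by (cases k) auto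
    have V: "Ys ! i \<in> V" "Ys ! j \<in> V" using Xs ij by (auto simp: vlists_def)
    have "{m. m < length Ys \<and> m \<in> - {i, j}} = {..<length Ys} - {i, j}" by auto
    then have "length (nths Ys (- {i, j})) = l"
      using ij k Xs(3) by (simp add: length_nths vlists_def card_Diff_subset)
    then have "nths Ys (- {i, j}) \<in> vlists l"
      using Xs(3) by (auto simp: vlists_def dest: in_set_nthsD)
    then show ?thesis
      using F Xs k V by (intro aform_swap[of l F]) (auto simp: V_br)
  qed
  have "D (\<lambda>Zs. F (X # Zs)) Ys = (\<Sum>i\<le>k. (-1) ^ i * act (Ys ! i) (F (X # nths Ys (- {i})))) +
     (\<Sum>j\<le>k. \<Sum>i<j. (-1) ^ (i + j) * F (X # br (Ys ! i) (Ys ! j) # nths Ys (- {i, j})))"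
    by (rule Suc.IH[OF aform_iota[OF F Xs(2)] Xs(3)])
  also have "(\<Sum>j\<le>k. \<Sum>i<j. (-1) ^ (i + j) * F (X # br (Ys ! i) (Ys ! j) # nths Ys (- {i, j})))
    = - (\<Sum>j\<le>k. \<Sum>i<j. (-1) ^ (i + j) * F (br (Ys ! i) (Ys ! j) # X # nths Ys (- {i, j})))"
    unfolding sum_negf[symmetric] by (intro sum.cong) (auto simp: swap)
  finally have "D F (X # Ys) = Lie X F Ys - (\<Sum>i\<le>k. (-1) ^ i * act (Ys ! i) (F (X # nths Ys (- {i}))))
    + (\<Sum>j\<le>k. \<Sum>i<j. (-1) ^ (i + j) * F (br (Ys ! i) (Ys ! j) # X # nths Ys (- {i, j})))"
    by simp
  also have "Lie X F Ys = act X (F Ys) - (\<Sum>j\<le>k. (-1) ^ j * F (br X (Ys ! j) # nths Ys (- {j})))"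
    using Lie_eq_sum[OF Xs(2) F Xs(3)] by (simp add: lessThan_Suc_atMost)
  finally show ?case
    unfolding Xs
    by (simp add: sum.atMost_Suc_shift sum.lessThan_Suc_shift nths_Cons_drop sum.distrib sum_subtractf sum_negf
        del: sum.atMost_Suc sum.lessThan_Suc)
qed

end

section \<open>Forms as pointwise objects and as alternating maps on fields\<close>

definition act :: "'a vfield \<Rightarrow> ('a \<Rightarrow> real) \<Rightarrow> 'a \<Rightarrow> real" where
  "act X f = (\<lambda>p. X p f)"

definition fscale :: "('a \<Rightarrow> real) \<Rightarrow> 'a vfield \<Rightarrow> 'a vfield" where
  "fscale f X = (\<lambda>p g. f p * X p g)"

lemma sum_fun_apply: "(\<Sum>j\<in>J. F j) p = (\<Sum>j\<in>J. (F j p :: 'b :: comm_monoid_add))"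
  by (induction J rule: infinite_finite_induct) auto

lemma minus_one_power_apply [simp]: "((- 1) ^ k :: 'a \<Rightarrow> real) p = (- 1) ^ k"
  by (induction k) simp_all

text \<open>Functions and fields on a space whose tangent space at \<open>p\<close> is \<open>T p\<close>, with finitely many frames \<open>Es i\<close> of
  \<open>n\<close> fields each. Wherever \<open>r i\<close> does not vanish, the \<open>i\<close>-th frame spans the tangent space: \<open>expand\<close>
  gives coefficients \<open>\<theta> i j p v\<close>, which depend linearly on \<open>v\<close> and smoothly on the point. The factor \<open>r i\<close> keeps
  everything globally smooth, so that no restriction to open subsets is ever needed.\<close>

locale framed_algebra = lie_rinehart C V act fscale commutator
  for C :: "('a \<Rightarrow> real) set" and V :: "'a vfield set" +
  fixes T :: "'a \<Rightarrow> 'a tvec set" and n :: nat and I :: "'i set"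
    and r :: "'i \<Rightarrow> 'a \<Rightarrow> real" and Es :: "'i \<Rightarrow> 'a vfield list"
    and \<theta> :: "'i \<Rightarrow> nat \<Rightarrow> 'a \<Rightarrow> 'a tvec \<Rightarrow> real"
  assumes C_const: "(\<lambda>p. c) \<in> C"
    and act_const: "X \<in> V \<Longrightarrow> act X (\<lambda>p. c) = 0"
    and C_inverse: "f \<in> C \<Longrightarrow> (\<And>p. f p \<noteq> 0) \<Longrightarrow> (\<lambda>p. inverse (f p)) \<in> C"
    and V_T: "X \<in> V \<Longrightarrow> X p \<in> T p"
    and T_lin: "u \<in> T p \<Longrightarrow> v \<in> T p \<Longrightarrow> (\<lambda>f. a * u f + b * v f) \<in> T p"
    and I_finite: "finite I"
    and r_smooth: "i \<in> I \<Longrightarrow> r i \<in> C"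
    and r_cover: "\<exists>i\<in>I. r i p \<noteq> 0"
    and Es_vlists: "i \<in> I \<Longrightarrow> Es i \<in> vlists n"
    and Es_0: "i \<in> I \<Longrightarrow> j < n \<Longrightarrow> r i p = 0 \<Longrightarrow> (Es i ! j) p = 0"
    and \<theta>_smooth: "i \<in> I \<Longrightarrow> j < n \<Longrightarrow> X \<in> V \<Longrightarrow> (\<lambda>p. \<theta> i j p (X p)) \<in> C"
    and \<theta>_lin: "i \<in> I \<Longrightarrow> j < n \<Longrightarrow> u \<in> T p \<Longrightarrow> v \<in> T p \<Longrightarrow>
      \<theta> i j p (\<lambda>f. a * u f + b * v f) = a * \<theta> i j p u + b * \<theta> i j p v"
    and expand: "i \<in> I \<Longrightarrow> v \<in> T p \<Longrightarrow> r i p * v f = (\<Sum>j<n. \<theta> i j p v * (Es i ! j) p f)"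
begin

lemma Es_V: "i \<in> I \<Longrightarrow> j < n \<Longrightarrow> Es i ! j \<in> V"
  using Es_vlists[of i] by (auto simp: vlists_def)

lemma sum_vfield_apply: "(\<Sum>j\<in>J. fscale (c j) (E j)) p f = (\<Sum>j\<in>J. c j p * E j p f)"
  by (simp add: sum_fun_apply fscale_def)

lemma expand_field:
  assumes "i \<in> I" "X \<in> V"
  shows "fscale (r i) X = (\<Sum>j<n. fscale (\<lambda>p. \<theta> i j p (X p)) (Es i ! j))"
proof (intro ext)
  fix p f
  show "fscale (r i) X p f = (\<Sum>j<n. fscale (\<lambda>p. \<theta> i j p (X p)) (Es i ! j)) p f"
    unfolding sum_vfield_apply by (simp add: fscale_def expand[OF assms(1) V_T[OF assms(2)]])
qed

lemma expand_form:
  assumes i: "i \<in> I" and X: "X \<in> V" and F: "aform (Suc k) F" and Zs: "Zs \<in> vlists k"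
  shows "r i p * F (X # Zs) p = (\<Sum>j<n. \<theta> i j p (X p) * F (Es i ! j # Zs) p)"
proof -
  have "r i * F (X # Zs) = F (fscale (r i) X # Zs)"
    using aform_scale_left[OF F r_smooth[OF i] X Zs] by simp
  also have "\<dots> = (\<Sum>j<n. (\<lambda>p. \<theta> i j p (X p)) * F (Es i ! j # Zs))"
    unfolding expand_field[OF i X]
    by (rule aform_sum[OF F Zs]) (use i X \<theta>_smooth Es_V in auto)
  finally have "(r i * F (X # Zs)) p = (\<Sum>j<n. (\<lambda>p. \<theta> i j p (X p)) * F (Es i ! j # Zs)) p"
    by (rule arg_cong)
  then show ?thesis by (simp add: sum_fun_apply)
qed

text \<open>After multiplication by \<open>r i\<close> the value depends on the field only through its coefficients, and these
  depend only on its value at \<open>p\<close>.\<close>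

lemma tensorial_Cons:
  assumes F: "aform (Suc k) F" and X: "X \<in> V" and Y: "Y \<in> V" and Zs: "Zs \<in> vlists k" and eq: "X p = Y p"
  shows "F (X # Zs) p = F (Y # Zs) p"
proof -
  obtain i where i: "i \<in> I" "r i p \<noteq> 0" using r_cover by blast
  have "r i p * F (X # Zs) p = r i p * F (Y # Zs) p"
    using expand_form[OF i(1) X F Zs] expand_form[OF i(1) Y F Zs] eq by simp
  then show ?thesis using i by simp
qed

lemma tensorial:
  "aform k F \<Longrightarrow> Xs \<in> vlists k \<Longrightarrow> Ys \<in> vlists k \<Longrightarrow> map (\<lambda>X. X p) Xs = map (\<lambda>X. X p) Ys \<Longrightarrow>
     F Xs p = F Ys p"
proof (induction k arbitrary: F Xs Ys)
  case (Suc k)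
  note F = Suc.prems(1)
  obtain X Xs' where Xs: "Xs = X # Xs'" "X \<in> V" "Xs' \<in> vlists k"
    using Suc.prems(2) by (rule vlists_SucE)
  obtain Y Ys' where Ys: "Ys = Y # Ys'" "Y \<in> V" "Ys' \<in> vlists k"
    using Suc.prems(3) by (rule vlists_SucE)
  have "F Xs p = F (Y # Xs') p"
    unfolding Xs(1) by (rule tensorial_Cons[OF F]) (use Suc.prems(4) Xs Ys in auto)
  also have "\<dots> = F (Y # Ys') p"
    by (rule Suc.IH[OF aform_iota[OF F Ys(2)] Xs(3) Ys(3)]) (use Suc.prems(4) Xs Ys in auto)
  finally show ?case using Ys by simp
qed simp

text \<open>A field with a given value at \<open>p\<close>: the combination of a frame with constant coefficients. It is linear
  in the given vector, which is what makes \<open>form_of\<close> below multilinear.\<close>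

definition extension :: "'a \<Rightarrow> 'a tvec \<Rightarrow> 'a vfield" where
  "extension p v = (let i = SOME i. i \<in> I \<and> r i p \<noteq> 0 in
     \<Sum>j<n. fscale (\<lambda>q. \<theta> i j p v / r i p) (Es i ! j))"

lemma extension_V: "extension p v \<in> V"
  and extension_at: "v \<in> T p \<Longrightarrow> extension p v p = v"
  and extension_lin: "u \<in> T p \<Longrightarrow> v \<in> T p \<Longrightarrow>
    extension p (\<lambda>f. a * u f + b * v f)
      = fscale (\<lambda>q. a) (extension p u) + fscale (\<lambda>q. b) (extension p v)"
proof -
  define i where "i = (SOME i. i \<in> I \<and> r i p \<noteq> 0)"
  have i: "i \<in> I" "r i p \<noteq> 0" using someI_ex[of "\<lambda>i. i \<in> I \<and> r i p \<noteq> 0"] r_cover[of p]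
    by (auto simp: i_def)
  have eq: "extension p v = (\<Sum>j<n. fscale (\<lambda>q. \<theta> i j p v / r i p) (Es i ! j))" for v
    by (simp add: extension_def i_def Let_def)
  show "extension p v \<in> V"
    unfolding eq by (rule V_sum) (use i Es_V C_const in auto)
  show "extension p v p = v" if "v \<in> T p"
  proof
    fix f
    have "extension p v p f = (\<Sum>j<n. \<theta> i j p v * (Es i ! j) p f) / r i p"
      unfolding eq sum_vfield_apply by (simp add: sum_divide_distrib)
    then show "extension p v p f = v f" using expand[OF i(1) that, of f] i(2)
      by (metis nonzero_mult_div_cancel_left)
  qed
  show "extension p (\<lambda>f. a * u f + b * v f)
      = fscale (\<lambda>q. a) (extension p u) + fscale (\<lambda>q. b) (extension p v)" if uv: "u \<in> T p" "v \<in> T p"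
  proof (intro ext)
    fix q f
    have "extension p (\<lambda>f. a * u f + b * v f) q f
        = (\<Sum>j<n. (a * \<theta> i j p u + b * \<theta> i j p v) / r i p * (Es i ! j) q f)"
      unfolding eq sum_vfield_apply using i(1) uv by (intro sum.cong) (auto simp: \<theta>_lin)
    also have "\<dots> = a * extension p u q f + b * extension p v q f"
      unfolding eq sum_vfield_apply
      by (simp add: sum_distrib_left sum.distrib[symmetric] add_divide_distrib algebra_simps)
    finally show "extension p (\<lambda>f. a * u f + b * v f) q f
        = (fscale (\<lambda>q. a) (extension p u) + fscale (\<lambda>q. b) (extension p v)) q f"
      by (simp add: fscale_def)
  qed
qed

definition forms :: "nat \<Rightarrow> 'a dform set" where
  "forms k = {\<omega>. (\<forall>p. alt_multilinear (T p) k (\<omega> p)) \<and> (\<forall>Xs\<in>vlists k. eval_form \<omega> Xs \<in> C)}"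

text \<open>The form with a prescribed effect on fields. By \<open>tensorial\<close> it does not depend on how the tangent
  vectors are extended.\<close>

definition form_of :: "nat \<Rightarrow> ('a vfield list \<Rightarrow> 'a \<Rightarrow> real) \<Rightarrow> 'a dform" where
  "form_of k F = (\<lambda>p vs. if length vs = k \<and> set vs \<subseteq> T p then F (map (extension p) vs) p else 0)"

lemma alt_multilinearD:
  assumes "alt_multilinear S k w"
  shows "\<not> (length vs = k \<and> set vs \<subseteq> S) \<Longrightarrow> w vs = 0"
    and "length vs = k \<Longrightarrow> set vs \<subseteq> S \<Longrightarrow> i < k \<Longrightarrow> u \<in> S \<Longrightarrow> v \<in> S \<Longrightarrow>
      w (vs[i := (\<lambda>f. a * u f + b * v f)]) = a * w (vs[i := u]) + b * w (vs[i := v])"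
    and "length vs = k \<Longrightarrow> set vs \<subseteq> S \<Longrightarrow> i < j \<Longrightarrow> j < k \<Longrightarrow> vs ! i = vs ! j \<Longrightarrow> w vs = 0"
  using assms unfolding alt_multilinear_def by blast+

text \<open>The pointwise counterpart of fixing the first argument, which connects the definition of
  forms with the recursion in \<open>aform\<close>.\<close>

lemma alt_multilinear_Cons:
  assumes w: "alt_multilinear S (Suc k) w" and v: "v \<in> S"
  shows "alt_multilinear S k (\<lambda>vs. w (v # vs))"
  unfolding alt_multilinear_def
proof (intro conjI allI impI)
  fix vs i u u' a b assume "length vs = k" "set vs \<subseteq> S" "i < k" "u \<in> S" "u' \<in> S"
  then show "w (v # vs[i := (\<lambda>f. a * u f + b * u' f)]) = a * w (v # vs[i := u]) + b * w (v # vs[i := u'])"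
    using alt_multilinearD(2)[OF w, of "v # vs" "Suc i" u u' a b] v by simp
next
  fix vs i j assume "length vs = k" "set vs \<subseteq> S" "i < j" "j < k" "vs ! i = vs ! j"
  then show "w (v # vs) = 0"
    using alt_multilinearD(3)[OF w, of "v # vs" "Suc i" "Suc j"] v by simp
next
  fix vs assume "\<not> (length vs = k \<and> set vs \<subseteq> S)"
  then show "w (v # vs) = 0"
    using alt_multilinearD(1)[OF w, of "v # vs"] by auto
qed

lemma eval_int_prod: "eval_form (int_prod X \<omega>) = (\<lambda>Zs. eval_form \<omega> (X # Zs))"
  by (simp add: eval_form_def int_prod_def fun_eq_iff)

lemma int_prod_forms:
  assumes \<omega>: "\<omega> \<in> forms (Suc k)" and X: "X \<in> V"
  shows "int_prod X \<omega> \<in> forms k"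
proof -
  have "alt_multilinear (T p) k (int_prod X \<omega> p)" for p
    unfolding int_prod_def
    by (rule alt_multilinear_Cons) (use \<omega> V_T[OF X] in \<open>auto simp: forms_def\<close>)
  then show ?thesis using \<omega> X by (simp add: forms_def eval_int_prod)
qed

lemma aform_eval_form: "\<omega> \<in> forms k \<Longrightarrow> aform k (eval_form \<omega>)"
proof (induction k arbitrary: \<omega>)
  case 0
  then show ?case by (simp add: forms_def)
next
  case (Suc k)
  have alt: "alt_multilinear (T p) (Suc k) (\<omega> p)" for p
    using Suc.prems by (simp add: forms_def)
  have lin: "\<omega> p ((\<lambda>f. a * X p f + b * Y p f) # map (\<lambda>X. X p) Zs)
      = a * eval_form \<omega> (X # Zs) p + b * eval_form \<omega> (Y # Zs) p"
    if "X \<in> V" "Y \<in> V" "Zs \<in> vlists k" for p X Y a b Zs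
    using alt_multilinearD(2)[OF alt[of p], of "map (\<lambda>X. X p) (X # Zs)" 0 "X p" "Y p" a b] that V_T
    by (force simp: vlists_def eval_form_def)
  show ?case
  proof (rule aform_SucI)
    fix X Y Zs assume *: "X \<in> V" "Y \<in> V" "Zs \<in> vlists k"
    show "eval_form \<omega> ((X + Y) # Zs) = eval_form \<omega> (X # Zs) + eval_form \<omega> (Y # Zs)"
    proof
      fix p
      show "eval_form \<omega> ((X + Y) # Zs) p = (eval_form \<omega> (X # Zs) + eval_form \<omega> (Y # Zs)) p"
        using lin[OF *, of p 1 1] by (simp add: eval_form_def plus_fun_def)
    qed
  next
    fix f X Zs assume *: "f \<in> C" "X \<in> V" "Zs \<in> vlists k"
    show "eval_form \<omega> (fscale f X # Zs) = f * eval_form \<omega> (X # Zs)"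
    proof
      fix p
      show "eval_form \<omega> (fscale f X # Zs) p = (f * eval_form \<omega> (X # Zs)) p"
        using lin[OF *(2,2,3), of p "f p" 0] by (simp add: eval_form_def fscale_def)
    qed
  next
    fix l X Zs assume *: "k = Suc l" "X \<in> V" "Zs \<in> vlists l"
    show "eval_form \<omega> (X # X # Zs) = 0"
    proof
      fix p
      show "eval_form \<omega> (X # X # Zs) p = 0 p"
        using alt_multilinearD(3)[OF alt[of p], of "map (\<lambda>X. X p) (X # X # Zs)" 0 1] * V_T
        by (force simp: vlists_def eval_form_def)
    qed
  next
    fix X assume "X \<in> V"
    then show "aform k (\<lambda>Zs. eval_form \<omega> (X # Zs))"
      using Suc.IH[OF int_prod_forms[OF Suc.prems]] by (simp add: eval_int_prod)
  qed
qed

lemma eval_form_of: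
  assumes F: "aform k F" and Xs: "Xs \<in> vlists k"
  shows "eval_form (form_of k F) Xs = F Xs"
proof
  fix p
  have "length Xs = k" "(\<lambda>X. X p) ` set Xs \<subseteq> T p" using Xs V_T by (auto simp: vlists_def)
  then have "eval_form (form_of k F) Xs p = F (map (extension p) (map (\<lambda>X. X p) Xs)) p"
    by (simp add: eval_form_def form_of_def)
  also have "\<dots> = F Xs p"
  proof (rule tensorial[OF F _ Xs])
    show "map (\<lambda>X. X p) (map (extension p) (map (\<lambda>X. X p) Xs)) = map (\<lambda>X. X p) Xs"
      using Xs by (auto simp: vlists_def extension_at V_T)
  qed (use Xs in \<open>auto simp: vlists_def extension_V\<close>)
  finally show "eval_form (form_of k F) Xs p = F Xs p" .
qed

lemma form_of_forms:
  assumes F: "aform k F"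
  shows "form_of k F \<in> forms k"
proof -
  have ext: "map (extension p) vs \<in> vlists k" if "length vs = k" for p vs
    using that by (auto simp: vlists_def extension_V)
  have upd: "form_of k F p (vs[i := w])
      = (-1) ^ i * F (extension p w # map (extension p) (take i vs @ drop (Suc i) vs)) p"
    if vs: "length vs = k" "set vs \<subseteq> T p" and i: "i < k" and w: "w \<in> T p" for p vs i w
  proof -
    have "set (vs[i := w]) \<subseteq> T p" using vs w set_update_subset_insert[of vs i w] by blast
    then have "form_of k F p (vs[i := w]) = F ((map (extension p) vs)[i := extension p w]) p"
      using vs by (simp add: form_of_def map_update)
    also have "\<dots> = ((-1) ^ i * F (extension p w # map (extension p) (take i vs @ drop (Suc i) vs))) p"
      unfolding aform_update[OF F ext[OF vs(1)] i extension_V] by (simp add: take_map drop_map)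
    finally show ?thesis by simp
  qed
  have "alt_multilinear (T p) k (form_of k F p)" for p
    unfolding alt_multilinear_def
  proof (intro conjI allI impI)
    fix vs i u v a b assume vs: "length vs = k" "set vs \<subseteq> T p" and i: "i < k" and uv: "u \<in> T p" "v \<in> T p"
    obtain l where k: "k = Suc l" using i by (cases k) auto
    let ?Zs = "map (extension p) (take i vs @ drop (Suc i) vs)"
    have Zs: "?Zs \<in> vlists l"
      using vs i k by (auto simp: vlists_def extension_V)
    note F' = F[unfolded k]
    have "F (extension p (\<lambda>f. a * u f + b * v f) # ?Zs) =
        (\<lambda>q. a) * F (extension p u # ?Zs) + (\<lambda>q. b) * F (extension p v # ?Zs)"
      unfolding extension_lin[OF uv]
      using Zs by (simp only: aform_add_left[OF F'] aform_scale_left[OF F'] extension_V V_scale C_const)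
    then show "form_of k F p (vs[i := (\<lambda>f. a * u f + b * v f)])
        = a * form_of k F p (vs[i := u]) + b * form_of k F p (vs[i := v])"
      by (simp add: upd[OF vs i] uv T_lin algebra_simps)
  next
    fix vs i j assume vs: "length vs = k" "set vs \<subseteq> T p" and ij: "i < j" "j < k" "vs ! i = vs ! j"
    obtain l where k: "k = Suc l" using ij by (cases k) auto
    let ?Zs = "map (extension p) (take i vs @ drop (Suc i) vs)"
    have vi: "vs ! i \<in> T p" using vs ij by auto
    have "F (extension p (vs ! i) # ?Zs) = 0"
    proof (rule aform_repeat[OF F[unfolded k]])
      have "vs ! j \<in> set (drop (Suc i) vs)"
        using ij vs by (auto simp: in_set_conv_nth intro!: exI[of _ "j - Suc i"])
      then show "extension p (vs ! i) \<in> set ?Zs" using ij(3) by auto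
      show "?Zs \<in> vlists l" using vs ij k by (auto simp: vlists_def extension_V)
    qed
    then show "form_of k F p vs = 0"
      using upd[OF vs _ vi, of i] ij(1,2) by simp
  qed (auto simp: form_of_def)
  then show ?thesis using eval_form_of[OF F] aform_smooth[OF F] by (simp add: forms_def)
qed

lemma forms_eqI:
  assumes \<omega>: "\<omega> \<in> forms k" and \<eta>: "\<eta> \<in> forms k"
    and eq: "\<And>Xs. Xs \<in> vlists k \<Longrightarrow> eval_form \<omega> Xs = eval_form \<eta> Xs"
  shows "\<omega> = \<eta>"
proof (intro ext)
  fix p vs
  show "\<omega> p vs = \<eta> p vs"
  proof (cases "length vs = k \<and> set vs \<subseteq> T p")
    case True
    then have vs: "map (\<lambda>X. X p) (map (extension p) vs) = vs"
      by (auto simp: extension_at intro!: map_idI)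
    have "map (extension p) vs \<in> vlists k" using True by (auto simp: vlists_def extension_V)
    then have "eval_form \<omega> (map (extension p) vs) p = eval_form \<eta> (map (extension p) vs) p"
      using eq by metis
    then show ?thesis unfolding eval_form_def vs .
  next
    case False
    then show ?thesis using \<omega> \<eta> by (simp add: forms_def alt_multilinear_def)
  qed
qed

end

section \<open>Exterior derivative and top-degree forms\<close>

lemma subseqs_length_le: "Zs \<in> set (subseqs Es) \<Longrightarrow> length Zs \<le> length Es"
  by (induction Es arbitrary: Zs) (fastforce simp: Let_def)+

lemma subseqs_full: "Zs \<in> set (subseqs Es) \<Longrightarrow> length Zs = length Es \<Longrightarrow> Zs = Es"
proof (induction Es arbitrary: Zs)
  case (Cons E Es)
  then show ?case using subseqs_length_le[of Zs Es] by (auto simp: Let_def)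
qed simp

lemma subseqs_drop_one:
  "Zs \<in> set (subseqs Es) \<Longrightarrow> Suc (length Zs) = length Es \<Longrightarrow> \<exists>l<length Es. Zs = take l Es @ drop (Suc l) Es"
proof (induction Es arbitrary: Zs)
  case (Cons E Es)
  show ?case
  proof (cases "Zs \<in> set (subseqs Es)")
    case True
    then have "Zs = Es" using Cons.prems(2) subseqs_full by simp
    then show ?thesis by (intro exI[of _ 0]) simp
  next
    case False
    then obtain Ws where Ws: "Zs = E # Ws" "Ws \<in> set (subseqs Es)"
      using Cons.prems(1) by (auto simp: Let_def)
    then obtain l where "l < length Es" "Ws = take l Es @ drop (Suc l) Es"
      using Cons.IH Cons.prems(2) by auto
    then show ?thesis using Ws by (intro exI[of _ "Suc l"]) simp
  qed
qed simp

context framed_algebra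
begin

lemma invariant_formula_eq_D:
  assumes F: "aform k (eval_form \<omega>)" and Xs: "Xs \<in> vlists (Suc k)"
  shows "invariant_formula k \<omega> Xs = D (eval_form \<omega>) Xs"
proof
  fix p
  show "invariant_formula k \<omega> Xs p = D (eval_form \<omega>) Xs p"
    unfolding D_eq_sum[OF F Xs] invariant_formula_def by (simp add: sum_fun_apply act_def)
qed

text \<open>The exterior derivative on pointwise forms; \<open>ext_d_the\<close> shows that it satisfies the characterisation by
  the invariant formula and that this characterisation determines it.\<close>

definition ext_d :: "nat \<Rightarrow> 'a dform \<Rightarrow> 'a dform" where
  "ext_d k \<omega> = form_of (Suc k) (D (eval_form \<omega>))"

lemma ext_d_forms: "\<omega> \<in> forms k \<Longrightarrow> ext_d k \<omega> \<in> forms (Suc k)"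
  unfolding ext_d_def by (intro form_of_forms aform_D aform_eval_form)

lemma eval_ext_d:
  "\<omega> \<in> forms k \<Longrightarrow> Xs \<in> vlists (Suc k) \<Longrightarrow> eval_form (ext_d k \<omega>) Xs = D (eval_form \<omega>) Xs"
  unfolding ext_d_def by (intro eval_form_of aform_D aform_eval_form)

lemma ext_d_the:
  assumes "\<omega> \<in> forms k"
  shows "(THE \<eta>. \<eta> \<in> forms (Suc k) \<and>
    (\<forall>Xs. length Xs = Suc k \<longrightarrow> set Xs \<subseteq> V \<longrightarrow> eval_form \<eta> Xs = invariant_formula k \<omega> Xs)) = ext_d k \<omega>"
proof (rule the_equality)
  have D: "invariant_formula k \<omega> Xs = D (eval_form \<omega>) Xs" if "Xs \<in> vlists (Suc k)" for Xs
    using invariant_formula_eq_D aform_eval_form assms that by blast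
  then show "ext_d k \<omega> \<in> forms (Suc k) \<and>
    (\<forall>Xs. length Xs = Suc k \<longrightarrow> set Xs \<subseteq> V \<longrightarrow> eval_form (ext_d k \<omega>) Xs = invariant_formula k \<omega> Xs)"
    using assms by (auto simp: ext_d_forms eval_ext_d vlists_def)
  fix \<eta> assume "\<eta> \<in> forms (Suc k) \<and>
    (\<forall>Xs. length Xs = Suc k \<longrightarrow> set Xs \<subseteq> V \<longrightarrow> eval_form \<eta> Xs = invariant_formula k \<omega> Xs)"
  then show "\<eta> = ext_d k \<omega>"
    using assms D by (intro forms_eqI[of _ "Suc k"]) (auto simp: ext_d_forms eval_ext_d vlists_def)
qed

text \<open>A form that vanishes on the sublists of a list of fields vanishes on all lists of members of it. If the
  head \<open>E\<close> occurs among the arguments, move it to the front and pass to \<open>\<iota>\<^sub>E F\<close>, which vanishes on the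
  sublists of the tail; if it does not occur, pass to the tail directly. No signs have to be followed.\<close>

lemma vanish_on_sublists:
  assumes "aform k F" "set Ls \<subseteq> V" "Xs \<in> vlists k" "set Xs \<subseteq> set Ls"
    and "\<And>Zs. Zs \<in> set (subseqs Ls) \<Longrightarrow> length Zs = k \<Longrightarrow> F Zs p = 0"
  shows "F Xs p = 0"
  using assms
proof (induction Ls arbitrary: k F Xs)
  case Nil
  then show ?case by simp
next
  case (Cons E Ls)
  note F = Cons.prems(1) and Xs = Cons.prems(3) and zero = Cons.prems(5)
  have E: "E \<in> V" and Ls: "set Ls \<subseteq> V" using Cons.prems(2) by auto
  show ?case
  proof (cases "E \<in> set Xs")
    case False
    then show ?thesis
      using Cons.prems(4) zero by (intro Cons.IH[OF F Ls Xs]) (auto simp: Let_def)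
  next
    case True
    then obtain Us Ws where eq: "Xs = Us @ E # Ws" by (auto simp: in_set_conv_decomp)
    then obtain l where k: "k = Suc l" using Xs by (cases k) auto
    note F' = F[unfolded k]
    have UW: "Us @ Ws \<in> vlists l" using Xs eq k by auto
    have "F Xs p = ((-1) ^ length Us * F (E # Us @ Ws)) p"
      using aform_move_to_front[OF F, of Us E Ws] Xs eq by simp
    moreover have "F (E # Us @ Ws) p = 0"
    proof (cases "E \<in> set (Us @ Ws)")
      case True
      then show ?thesis using aform_repeat[OF F' UW] by simp
    next
      case False
      show ?thesis
      proof (rule Cons.IH[OF aform_iota[OF F' E] Ls UW])
        show "set (Us @ Ws) \<subseteq> set Ls" using Cons.prems(4) False eq by auto
        show "F (E # Zs) p = 0" if "Zs \<in> set (subseqs Ls)" "length Zs = l" for Zs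
          using zero[of "E # Zs"] that k by (simp add: Let_def)
      qed
    qed
    ultimately show ?thesis by simp
  qed
qed

lemma vanish_on_frame_lists:
  assumes i: "i \<in> I" "r i p \<noteq> 0" and "aform k F" "Xs \<in> vlists k"
    and "\<And>Zs. Zs \<in> vlists k \<Longrightarrow> set Zs \<subseteq> set (Es i) \<Longrightarrow> F Zs p = 0"
  shows "F Xs p = 0"
  using assms(3-)
proof (induction k arbitrary: F Xs)
  case (Suc k)
  note F = Suc.prems(1)
  obtain X Ys where Xs: "Xs = X # Ys" "X \<in> V" "Ys \<in> vlists k"
    using Suc.prems(2) by (rule vlists_SucE)
  have "F (Es i ! j # Ys) p = 0" if j: "j < n" for j
  proof (rule Suc.IH[OF aform_iota[OF F Es_V[OF i(1) j]] Xs(3)])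
    fix Zs assume "Zs \<in> vlists k" "set Zs \<subseteq> set (Es i)"
    then show "F (Es i ! j # Zs) p = 0"
      using Es_vlists[OF i(1)] j by (intro Suc.prems(3)) (auto simp: Es_V[OF i(1)] vlists_def)
  qed
  then have "r i p * F (X # Ys) p = 0"
    unfolding expand_form[OF i(1) Xs(2) F Xs(3)] by (intro sum.neutral) auto
  then show ?case using i Xs by simp
qed simp

text \<open>An alternating form at a point is determined by its values on increasing selections from
  a spanning list.\<close>

lemma vanish_on_frame:
  assumes i: "i \<in> I" "r i p \<noteq> 0" and F: "aform k F" and Xs: "Xs \<in> vlists k"
    and zero: "\<And>Zs. Zs \<in> set (subseqs (Es i)) \<Longrightarrow> length Zs = k \<Longrightarrow> F Zs p = 0"
  shows "F Xs p = 0"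
proof (rule vanish_on_frame_lists[OF i F Xs])
  fix Zs assume Zs: "Zs \<in> vlists k" "set Zs \<subseteq> set (Es i)"
  have "set (Es i) \<subseteq> V" using Es_vlists[OF i(1)] by (simp add: vlists_def)
  then show "F Zs p = 0" by (rule vanish_on_sublists[OF F _ Zs zero])
qed

text \<open>A list of \<open>n\<close> fields has no sublist of length \<open>k > n\<close>, so the condition of \<open>vanish_on_frame\<close> is void.\<close>

lemma above_top_degree:
  assumes F: "aform k F" and k: "n < k" and Xs: "Xs \<in> vlists k"
  shows "F Xs = 0"
proof
  fix p
  obtain i where i: "i \<in> I" "r i p \<noteq> 0" using r_cover by blast
  show "F Xs p = 0 p"
    unfolding zero_fun_apply
  proof (rule vanish_on_frame[OF i F Xs])
    fix Zs assume "Zs \<in> set (subseqs (Es i))" "length Zs = k"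
    moreover have "length (Es i) = n" using Es_vlists[OF i(1)] by (simp add: vlists_def)
    ultimately show "F Zs p = 0" using subseqs_length_le[of Zs "Es i"] k by simp
  qed
qed

end

text \<open>A nowhere vanishing form \<open>M\<close> of top degree \<open>n = m + 1\<close>, as a map on fields.\<close>

locale framed_volume = framed_algebra C V T n I r Es \<theta>
  for C :: "('a \<Rightarrow> real) set" and V T n and I :: "'i set" and r Es \<theta> +
  fixes M :: "'a vfield list \<Rightarrow> 'a \<Rightarrow> real" and m :: nat
  assumes n: "n = Suc m"
    and M: "aform (Suc m) M"
    and M_nonzero: "\<exists>Xs\<in>vlists (Suc m). M Xs p \<noteq> 0"
begin

text \<open>The only sublist of full length is the frame itself, so if \<open>M\<close> vanished on it then \<open>M\<close> would vanish
  at \<open>p\<close> altogether.\<close>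

lemma M_frame: 
  assumes i: "i \<in> I" "r i p \<noteq> 0"
  shows "M (Es i) p \<noteq> 0"
proof
  assume zero: "M (Es i) p = 0"
  obtain Xs where Xs: "Xs \<in> vlists (Suc m)" "M Xs p \<noteq> 0" using M_nonzero by blast
  have "M Xs p = 0"
  proof (rule vanish_on_frame[OF i M Xs(1)])
    fix Zs assume "Zs \<in> set (subseqs (Es i))" "length Zs = Suc m"
    then show "M Zs p = 0"
      using subseqs_full[of Zs "Es i"] Es_vlists[OF i(1)] n zero by (simp add: vlists_def)
  qed
  then show False using Xs by simp
qed

lemma M_frame_replace:
  assumes i: "i \<in> I" and j: "j \<le> m" and l: "l \<le> m"
  shows "M (Es i ! j # nths (Es i) (- {l})) p = (if j = l then (-1) ^ l * M (Es i) p else 0)"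
proof -
  have Es: "Es i \<in> vlists (Suc m)" and len: "length (Es i) = Suc m"
    using Es_vlists[OF i] n by (auto simp: vlists_def)
  show ?thesis
  proof (cases "j = l")
    case True
    have "M ((Es i)[l := Es i ! l]) = (-1) ^ l * M (Es i ! l # take l (Es i) @ drop (Suc l) (Es i))"
      by (rule aform_update[OF M Es]) (use l n i in \<open>auto intro: Es_V\<close>)
    then have "M (Es i) p = (-1) ^ l * M (Es i ! l # nths (Es i) (- {l})) p"
      using l len by (simp add: nths_drop_one)
    moreover have "(-1) ^ l * (-1) ^ l = (1::real)" by (simp flip: power_mult_distrib)
    ultimately show ?thesis using True by (simp flip: mult.assoc)
  next
    case False
    have "M (Es i ! j # nths (Es i) (- {l})) = 0"
      by (rule aform_repeat[OF M vlists_drop_one[OF Es l]])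
         (use False j len in \<open>auto simp: set_nths\<close>)
    then show ?thesis using False by simp
  qed
qed

lemma frame_drop_one:
  assumes "i \<in> I" "l \<le> m" shows "nths (Es i) (- {l}) \<in> vlists m"
  using vlists_drop_one[of "Es i" m l] Es_vlists assms n by simp

text \<open>Contracting \<open>M\<close> with \<open>X\<close> and all frame fields except the \<open>l\<close>-th isolates the \<open>l\<close>-th coefficient of \<open>X\<close>.\<close>

lemma contraction_injective:
  assumes X: "X \<in> V" and zero: "\<And>Zs. Zs \<in> vlists m \<Longrightarrow> M (X # Zs) = 0"
  shows "X = 0"
proof (intro ext)
  fix p f
  obtain i where i: "i \<in> I" "r i p \<noteq> 0" using r_cover by blast
  have coeff: "\<theta> i l p (X p) = 0" if l: "l < n" for l
  proof -
    have l': "l \<le> m" using l n by simp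
    note Zs = frame_drop_one[OF i(1) l']
    have "(\<Sum>j<n. \<theta> i j p (X p) * M (Es i ! j # nths (Es i) (- {l})) p) = 0"
      using expand_form[OF i(1) X M Zs, of p] zero[OF Zs] by simp
    also have "(\<Sum>j<n. \<theta> i j p (X p) * M (Es i ! j # nths (Es i) (- {l})) p)
        = (\<Sum>j<n. if j = l then \<theta> i l p (X p) * ((-1) ^ l * M (Es i) p) else 0)"
      by (intro sum.cong) (use l' n in \<open>auto simp: M_frame_replace[OF i(1) _ l']\<close>)
    finally show ?thesis using l M_frame[OF i] by simp
  qed
  have "r i p * X p f = 0"
    unfolding expand[OF i(1) V_T[OF X]] using coeff by (intro sum.neutral) auto
  then show "X p f = 0 p f" using i by simp
qed

text \<open>Cramer's rule without the denominator: up to the factor \<open>M (Es i)\<close>, this is the field whose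
  contraction with \<open>M\<close> is \<open>W\<close>.\<close>

definition cofactor :: "('a vfield list \<Rightarrow> 'a \<Rightarrow> real) \<Rightarrow> 'i \<Rightarrow> 'a vfield" where
  "cofactor W i = (\<Sum>j\<le>m. fscale ((-1) ^ j * W (nths (Es i) (- {j}))) (Es i ! j))"

lemma C_minus_one_power: "(-1) ^ k \<in> C"
proof -
  have "((-1) ^ k :: 'a \<Rightarrow> real) = (\<lambda>p. (-1) ^ k)" by (rule ext) simp
  then show ?thesis by (simp only: C_const)
qed

lemma cofactor_terms:
  assumes W: "aform m W" and i: "i \<in> I" and j: "j \<in> {..m}"
  shows "(-1) ^ j * W (nths (Es i) (- {j})) \<in> C" "Es i ! j \<in> V"
proof -
  have "W (nths (Es i) (- {j})) \<in> C"
    by (rule aform_smooth[OF W frame_drop_one[OF i]]) (use j in simp)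
  then show "(-1) ^ j * W (nths (Es i) (- {j})) \<in> C" by (rule C_mult[OF C_minus_one_power])
  show "Es i ! j \<in> V" by (rule Es_V[OF i]) (use j n in simp)
qed

lemma cofactor_V:
  assumes "aform m W" "i \<in> I"
  shows "cofactor W i \<in> V"
  unfolding cofactor_def by (rule V_sum; rule cofactor_terms[OF assms])

text \<open>Both sides are alternating in \<open>Zs\<close>, so where the frame spans it suffices to compare them on the frame
  with one field left out; there a single summand of \<open>cofactor\<close> survives. Where the frame degenerates, all its
  fields vanish and both sides are \<open>0\<close>.\<close>

lemma contraction_cofactor:
  assumes W: "aform m W" and i: "i \<in> I" and Zs: "Zs \<in> vlists m"
  shows "M (cofactor W i # Zs) = M (Es i) * W Zs"
proof
  fix p
  have expand: "M (cofactor W i # Us) p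
      = (\<Sum>j\<le>m. (-1) ^ j * W (nths (Es i) (- {j})) p * M (Es i ! j # Us) p)" if Us: "Us \<in> vlists m" for Us
  proof -
    have "M (cofactor W i # Us) = (\<Sum>j\<le>m. ((-1) ^ j * W (nths (Es i) (- {j}))) * M (Es i ! j # Us))"
      unfolding cofactor_def
      by (rule aform_sum[OF M Us]; rule cofactor_terms[OF W i])
    then show ?thesis by (simp add: sum_fun_apply)
  qed
  show "M (cofactor W i # Zs) p = (M (Es i) * W Zs) p"
  proof (cases "r i p = 0")
    case True
    have zero: "M (Es i ! j # Us) p = 0" if "j \<le> m" "Us \<in> vlists m" for j Us
    proof -
      have "M (Es i ! j # Us) p = M (0 # Us) p"
      proof (rule tensorial_Cons[OF M _ V_0 that(2)])
        have "j < n" using that(1) n by simp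
        then show "Es i ! j \<in> V" "(Es i ! j) p = 0 p" using Es_V[OF i] Es_0[OF i _ True] by auto
      qed
      then show ?thesis using aform_0_left[OF M that(2)] by simp
    qed
    obtain E Fs where EF: "Es i = E # Fs" "Fs \<in> vlists m"
      using Es_vlists[OF i] unfolding n by (rule vlists_SucE)
    then have "M (Es i) p = 0" using zero[of 0 Fs] by simp
    moreover have "M (cofactor W i # Zs) p = 0"
      unfolding expand[OF Zs] using zero[OF _ Zs] by (intro sum.neutral) auto
    ultimately show ?thesis by simp
  next
    case False
    have MEs: "M (Es i) \<in> C" using aform_smooth[OF M] Es_vlists[OF i] n by simp
    have G: "aform m (\<lambda>Us. M (cofactor W i # Us) - M (Es i) * W Us)"
      by (rule aform_diff[OF aform_iota[OF M cofactor_V[OF W i]] aform_scale[OF MEs W]])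
    have "(M (cofactor W i # Zs) - M (Es i) * W Zs) p = 0"
    proof (rule vanish_on_frame[OF i False G Zs])
      fix Us assume Us: "Us \<in> set (subseqs (Es i))" "length Us = m"
      have "length (Es i) = Suc m" using Es_vlists[OF i] n by (simp add: vlists_def)
      then obtain l where "l < Suc m" "Us = take l (Es i) @ drop (Suc l) (Es i)"
        using subseqs_drop_one[OF Us(1)] Us(2) by metis
      then have l: "l \<le> m" "Us = nths (Es i) (- {l})"
        using \<open>length (Es i) = Suc m\<close> by (simp_all add: nths_drop_one)
      have "M (cofactor W i # Us) p
          = (\<Sum>j\<le>m. if j = l then (-1) ^ l * W Us p * ((-1) ^ l * M (Es i) p) else 0)"
        unfolding expand[OF frame_drop_one[OF i l(1), folded l(2)]]
        by (intro sum.cong) (use l in \<open>auto simp: M_frame_replace[OF i _ l(1)]\<close>)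
      also have "\<dots> = ((-1) ^ l * (-1) ^ l) * (W Us p * M (Es i) p)"
        using l(1) by (simp only: sum.delta finite_atMost atMost_iff if_True mult_ac)
      also have "\<dots> = W Us p * M (Es i) p" by (simp flip: power_mult_distrib)
      finally show "(M (cofactor W i # Us) - M (Es i) * W Us) p = 0" by simp
    qed
    then show ?thesis by simp
  qed
qed

text \<open>The local solutions \<open>cofactor W i / M (Es i)\<close> are averaged with the weights \<open>M (Es i)\<^sup>2\<close>, whose sum has no
  zeros.\<close>

lemma contraction_surjective:
  assumes W: "aform m W"
  obtains X where "X \<in> V" "\<And>Zs. Zs \<in> vlists m \<Longrightarrow> M (X # Zs) = W Zs"
proof -
  have MEs: "M (Es i) \<in> C" if "i \<in> I" for i
    using aform_smooth[OF M] Es_vlists[OF that] n by simp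
  define h where "h = (\<Sum>i\<in>I. M (Es i) * M (Es i))"
  have h_pos: "h p \<noteq> 0" for p
  proof -
    obtain i where i: "i \<in> I" "r i p \<noteq> 0" using r_cover by blast
    have "0 < (\<Sum>i\<in>I. M (Es i) p * M (Es i) p)"
      by (rule sum_pos2[OF I_finite i(1)]) (use M_frame[OF i] in \<open>auto simp: zero_less_mult_iff\<close>)
    then show ?thesis by (simp add: h_def sum_fun_apply)
  qed
  have "h \<in> C" unfolding h_def by (rule C_sum, rule C_mult; rule MEs)
  then have inv: "(\<lambda>p. inverse (h p)) \<in> C" by (intro C_inverse) (use h_pos in auto)
  define S where "S = (\<Sum>i\<in>I. fscale (M (Es i)) (cofactor W i))"
  have S: "S \<in> V" unfolding S_def by (rule V_sum) (simp_all add: MEs cofactor_V[OF W])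
  have MS: "M (S # Zs) = h * W Zs" if Zs: "Zs \<in> vlists m" for Zs
  proof -
    have "M (S # Zs) = (\<Sum>i\<in>I. M (Es i) * M (cofactor W i # Zs))"
      unfolding S_def by (rule aform_sum[OF M Zs]) (simp_all add: MEs cofactor_V[OF W])
    also have "\<dots> = (\<Sum>i\<in>I. M (Es i) * (M (Es i) * W Zs))"
      by (intro sum.cong) (simp_all add: contraction_cofactor[OF W _ Zs])
    finally show ?thesis by (simp add: h_def sum_distrib_right mult.assoc)
  qed
  show thesis
  proof
    show "fscale (\<lambda>p. inverse (h p)) S \<in> V" by (rule V_scale[OF inv S])
    show "M (fscale (\<lambda>p. inverse (h p)) S # Zs) = W Zs" if Zs: "Zs \<in> vlists m" for Zs
      unfolding aform_scale_left[OF M inv S Zs] MS[OF Zs] by (simp add: fun_eq_iff h_pos)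
  qed
qed

end

section \<open>Hamiltonian vector fields\<close>

context framed_volume
begin

text \<open>Cartan's formula \<open>L\<^sub>X M = \<iota>\<^sub>X dM + d \<iota>\<^sub>X M\<close>, where \<open>dM\<close> vanishes for degree reasons.\<close>

lemma contraction_closed:
  assumes X: "X \<in> V" and Zs: "Zs \<in> vlists (Suc m)" and closed: "\<And>Us. Us \<in> vlists (Suc m) \<Longrightarrow> D (\<lambda>Zs. M (X # Zs)) Us = 0"
  shows "Lie X M Zs = 0"
proof -
  have "D M (X # Zs) = 0"
    by (rule above_top_degree[OF aform_D[OF M]]) (use n X Zs in auto)
  then show ?thesis using closed[OF Zs] by simp
qed

end

text \<open>The degree of the volume form is \<open>k + 2\<close>, so that Hamiltonian fields belong to forms of degree \<open>k\<close>.\<close>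

locale hamiltonian = framed_volume C V T n I r Es \<theta> M "Suc k"
  for C :: "('a \<Rightarrow> real) set" and V T n and I :: "'i set" and r Es \<theta> M k
begin

definition is_ham :: "('a vfield list \<Rightarrow> 'a \<Rightarrow> real) \<Rightarrow> 'a vfield \<Rightarrow> bool" where
  "is_ham F X \<longleftrightarrow> X \<in> V \<and> (\<forall>Zs\<in>vlists (Suc k). M (X # Zs) = - D F Zs)"

lemma is_ham_V: "is_ham F X \<Longrightarrow> X \<in> V"
  by (simp add: is_ham_def)

lemma is_ham_exists:
  assumes F: "aform k F" obtains X where "is_ham F X"
proof -
  obtain X where "X \<in> V" "\<And>Zs. Zs \<in> vlists (Suc k) \<Longrightarrow> M (X # Zs) = - D F Zs"
    by (rule contraction_surjective[OF aform_uminus[OF aform_D[OF F]]]) blast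
  then have "is_ham F X" by (simp add: is_ham_def)
  then show thesis by (rule that)
qed

lemma is_ham_unique:
  assumes X: "is_ham F X" and Y: "is_ham F Y"
  shows "X = Y"
proof -
  note V = is_ham_V[OF X] is_ham_V[OF Y]
  have "X - Y = 0"
  proof (rule contraction_injective[OF V_diff[OF V]])
    fix Zs assume Zs: "Zs \<in> vlists (Suc k)"
    show "M ((X - Y) # Zs) = 0"
      unfolding aform_diff_left[OF M V Zs] using X Y Zs by (simp add: is_ham_def)
  qed
  then show ?thesis by simp
qed

lemma is_ham_closed:
  assumes F: "aform k F" and X: "is_ham F X" and Us: "Us \<in> vlists (Suc (Suc k))"
  shows "D (\<lambda>Zs. M (X # Zs)) Us = 0"
proof -
  have "D (\<lambda>Zs. M (X # Zs)) Us = D (\<lambda>Zs. - D F Zs) Us"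
    by (rule D_cong[OF _ Us]) (use X in \<open>simp add: is_ham_def\<close>)
  also have "\<dots> = - D (D F) Us"
    by (rule D_uminus[OF aform_D[OF F] Us])
  finally show ?thesis using D_D[OF F Us] by (simp add: fun_eq_iff)
qed

lemma Lie_ham:
  assumes "aform k F" "is_ham F X" "Zs \<in> vlists (Suc (Suc k))"
  shows "Lie X M Zs = 0"
  using assms by (intro contraction_closed is_ham_closed[OF assms(1)]) (auto simp: is_ham_V)

text \<open>\<open>0 = \<iota>\<^sub>Y L\<^sub>X M = L\<^sub>X \<iota>\<^sub>Y M - \<iota>\<^bsub>[X,Y]\<^esub> M\<close>, and \<open>L\<^sub>X \<iota>\<^sub>Y M = d \<iota>\<^sub>X \<iota>\<^sub>Y M\<close> because \<open>\<iota>\<^sub>Y M\<close> is closed.\<close>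

lemma is_ham_br:
  assumes F: "aform k F" "is_ham F X" and G: "aform k G" "is_ham G Y"
  shows "is_ham (\<lambda>Zs. M (X # Y # Zs)) (commutator X Y)"
  unfolding is_ham_def
proof (intro conjI ballI)
  note X = is_ham_V[OF F(2)] and Y = is_ham_V[OF G(2)]
  show "commutator X Y \<in> V" by (rule V_br[OF X Y])
  fix Zs assume Zs: "Zs \<in> vlists (Suc k)"
  note MXY = aform_iota[OF aform_iota[OF M X] Y]
  have "M (commutator X Y # Zs) = Lie X (\<lambda>Zs. M (Y # Zs)) Zs"
    using Lie_ham[OF F, of "Y # Zs"] Y Zs by simp
  also have "\<dots> = D (\<lambda>Zs. M (Y # Zs)) (X # Zs) + D (\<lambda>Zs. M (Y # X # Zs)) Zs"
    by simp
  also have "D (\<lambda>Zs. M (Y # Zs)) (X # Zs) = 0"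
    by (rule is_ham_closed[OF G]) (use X Zs in simp)
  also have "D (\<lambda>Zs. M (Y # X # Zs)) Zs = D (\<lambda>Zs. - M (X # Y # Zs)) Zs"
    by (rule D_cong[OF aform_swap[OF M Y X] Zs])
  also have "\<dots> = - D (\<lambda>Zs. M (X # Y # Zs)) Zs"
    by (rule D_uminus[OF MXY Zs])
  finally show "M (commutator X Y # Zs) = - D (\<lambda>Zs. M (X # Y # Zs)) Zs"
    by (simp add: fun_eq_iff)
qed

text \<open>Cartan's formula gives \<open>d \<iota>\<^sub>Z \<iota>\<^sub>Y \<iota>\<^sub>X M = L\<^sub>Z \<iota>\<^sub>Y \<iota>\<^sub>X M - \<iota>\<^sub>Z d \<iota>\<^sub>Y \<iota>\<^sub>X M\<close>. Since \<open>L\<^sub>Z M = 0\<close>, the first term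
  consists of the two brackets with \<open>Z\<close>; the second one is the bracket of \<open>X\<close> and \<open>Y\<close> by \<open>is_ham_br\<close>.\<close>

lemma ham_jacobi:
  assumes F: "aform k F" "is_ham F X" and G: "aform k G" "is_ham G Y" and H: "aform k H" "is_ham H Z"
    and Ws: "Ws \<in> vlists k"
  shows "M (X # commutator Y Z # Ws) + M (Y # commutator Z X # Ws) + M (Z # commutator X Y # Ws)
    = - D (\<lambda>Ws. M (X # Y # Z # Ws)) Ws"
proof -
  note X = is_ham_V[OF F(2)] and Y = is_ham_V[OF G(2)] and Z = is_ham_V[OF H(2)]
  have "Lie Z M (X # Y # Ws) = 0"
    by (rule Lie_ham[OF H]) (use X Y Ws in simp)
  then have Lie: "Lie Z (\<lambda>Zs. M (X # Y # Zs)) Ws = M (X # commutator Z Y # Ws) + M (commutator Z X # Y # Ws)"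
    by (simp add: algebra_simps)
  have "D (\<lambda>Zs. M (X # Y # Zs)) (Z # Ws) = - M (commutator X Y # Z # Ws)"
    using is_ham_br[OF F G] Z Ws by (simp add: is_ham_def del: D.simps)
  also have "M (commutator X Y # Z # Ws) = - M (Z # commutator X Y # Ws)"
    by (rule aform_swap[OF M V_br[OF X Y] Z Ws])
  finally have "D (\<lambda>Ws. M (X # Y # Z # Ws)) Ws
      = M (X # commutator Z Y # Ws) + M (commutator Z X # Y # Ws) - M (Z # commutator X Y # Ws)"
    using Lie by (simp add: fun_eq_iff algebra_simps)
  moreover have "M (commutator Z X # Y # Ws) = - M (Y # commutator Z X # Ws)"
    by (rule aform_swap[OF M V_br[OF Z X] Y Ws])
  moreover have "M (X # commutator Z Y # Ws) = - M (X # commutator Y Z # Ws)"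
  proof -
    note MX = aform_iota[OF M X]
    have "commutator Z Y = 0 - commutator Y Z" using br_anti[OF Z Y] by simp
    then show ?thesis
      using aform_diff_left[OF MX V_0 V_br[OF Y Z] Ws] aform_0_left[OF MX Ws] by simp
  qed
  ultimately show ?thesis by simp
qed

end

section \<open>Derivations and vector fields on a manifold\<close>

lemma smooth_on_cong: "open S \<Longrightarrow> smooth_on S f \<Longrightarrow> (\<And>x. x \<in> S \<Longrightarrow> f x = g x) \<Longrightarrow> smooth_on S g"
  unfolding smooth_on_def by (intro allI) (rule Ck_on_cong[of S f]; simp)

lemma smooth_on_subset: "open S \<Longrightarrow> smooth_on S f \<Longrightarrow> T \<subseteq> S \<Longrightarrow> open T \<Longrightarrow> smooth_on T f"
  unfolding smooth_on_def by (intro allI) (rule Ck_on_subset[of S]; simp)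

lemma smooth_on_Un: "open S \<Longrightarrow> open T \<Longrightarrow> smooth_on S f \<Longrightarrow> smooth_on T f \<Longrightarrow> smooth_on (S \<union> T) f"
  by (simp add: smooth_on_def Ck_on_Un)

lemma smooth_on_const: "smooth_on S (\<lambda>x. c)"
  by (simp add: smooth_on_def Ck_on_const)

lemma smooth_on_add: "open S \<Longrightarrow> smooth_on S f \<Longrightarrow> smooth_on S g \<Longrightarrow> smooth_on S (\<lambda>x. f x + g x)"
  by (simp add: smooth_on_def Ck_on_add)

lemma smooth_on_mult:
  fixes f g :: "'a::real_normed_vector \<Rightarrow> real"
  shows "open S \<Longrightarrow> smooth_on S f \<Longrightarrow> smooth_on S g \<Longrightarrow> smooth_on S (\<lambda>x. f x * g x)"
  by (simp add: smooth_on_def Ck_on_mult)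

lemma smooth_on_inverse:
  fixes f :: "'a::real_normed_vector \<Rightarrow> real"
  shows "open S \<Longrightarrow> smooth_on S f \<Longrightarrow> (\<And>x. x \<in> S \<Longrightarrow> f x \<noteq> 0) \<Longrightarrow> smooth_on S (\<lambda>x. inverse (f x))"
  by (simp add: smooth_on_def Ck_on_inverse)

lemma smooth_on_compose:
  fixes f :: "'a::euclidean_space \<Rightarrow> 'b::euclidean_space" and g :: "'b \<Rightarrow> 'c::real_normed_vector"
  shows "open S \<Longrightarrow> open T \<Longrightarrow> f ` S \<subseteq> T \<Longrightarrow> smooth_on S f \<Longrightarrow> smooth_on T g \<Longrightarrow> smooth_on S (\<lambda>x. g (f x))"
  by (simp add: smooth_on_def Ck_on_compose[of S T])

lemma smooth_on_deriv: "open S \<Longrightarrow> smooth_on S f \<Longrightarrow> smooth_on S (\<lambda>x. frechet_derivative f (at x) v)"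
  by (simp add: smooth_on_def Ck_on_SucD(2))

lemma smooth_on_has_derivative:
  "open S \<Longrightarrow> smooth_on S f \<Longrightarrow> x \<in> S \<Longrightarrow> (f has_derivative frechet_derivative f (at x)) (at x)"
  unfolding smooth_on_def by (rule Ck_on_SucD(1)[where k = 0]) (auto simp del: Ck_on.simps)

lemma smooth_on_linear: "bounded_linear f \<Longrightarrow> open S \<Longrightarrow> smooth_on S f"
  by (simp add: smooth_on_def Ck_on_linear)

text \<open>Positive exactly on the open ball, where it can therefore be divided out again. This makes it a
  substitute for a cut-off function that equals \<open>1\<close> near the centre.\<close>

definition bump :: "'e::euclidean_space \<Rightarrow> real \<Rightarrow> 'e \<Rightarrow> real" where
  "bump c r x = flat 0 (r\<^sup>2 - (x - c) \<bullet> (x - c))"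

lemma bump_zero_iff:
  assumes r: "r > 0" shows "bump c r x = 0 \<longleftrightarrow> x \<notin> ball c r"
proof -
  have ball: "(x - c) \<bullet> (x - c) < r\<^sup>2 \<longleftrightarrow> x \<in> ball c r"
    using r norm_lt_square[of "x - c" r] by (simp only: mem_ball dist_norm norm_minus_commute[of c]) simp
  have flat: "flat 0 t = 0 \<longleftrightarrow> \<not> t > 0" for t
    by (simp add: flat_def)
  show ?thesis unfolding bump_def flat diff_gt_0_iff_gt ball ..
qed

lemma smooth_on_bump: "smooth_on UNIV (bump c r)"
proof -
  have lin: "smooth_on UNIV (\<lambda>x :: 'a. (x - c) \<bullet> b)" for b
    using smooth_on_add[OF open_UNIV smooth_on_linear[OF bounded_linear_inner_left open_UNIV]
        smooth_on_const[of _ "- (c \<bullet> b)"], of b]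
    by (simp add: inner_diff_left)
  have "Ck_on k UNIV (\<lambda>x :: 'a. \<Sum>b\<in>Basis. ((x - c) \<bullet> b) * ((x - c) \<bullet> b))" for k
    using lin unfolding smooth_on_def
    by (intro Ck_on_sum[OF open_UNIV] Ck_on_mult[OF open_UNIV]) simp_all
  then have "smooth_on UNIV (\<lambda>x :: 'a. \<Sum>b\<in>Basis. ((x - c) \<bullet> b) * ((x - c) \<bullet> b))"
    by (simp add: smooth_on_def)
  then have "smooth_on UNIV (\<lambda>x :: 'a. r\<^sup>2 + (-1) * (\<Sum>b\<in>Basis. ((x - c) \<bullet> b) * ((x - c) \<bullet> b)))"
    by (rule smooth_on_add[OF open_UNIV smooth_on_const smooth_on_mult[OF open_UNIV smooth_on_const]])
  then have "smooth_on UNIV (\<lambda>x :: 'a. flat 0 (r\<^sup>2 + (-1) * (\<Sum>b\<in>Basis. ((x - c) \<bullet> b) * ((x - c) \<bullet> b))))"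
    by (rule smooth_on_compose[OF open_UNIV open_UNIV subset_UNIV, where g = "flat 0"])
       (simp add: smooth_on_def Ck_on_flat)
  moreover have "bump c r = (\<lambda>x. flat 0 (r\<^sup>2 + (-1) * (\<Sum>b\<in>Basis. ((x - c) \<bullet> b) * ((x - c) \<bullet> b))))"
    unfolding bump_def by (rule ext, subst euclidean_inner) simp
  ultimately show ?thesis by (simp only:)
qed

locale smooth_manifold =
  fixes A :: "('a::{t2_space, second_countable_topology}, 'e::euclidean_space) atlas"
  assumes atlas: "smooth_atlas A"
begin

lemma chart_cover: obtains U \<phi> where "(U, \<phi>) \<in> A" "p \<in> U"
proof -
  have "p \<in> (\<Union>(U, \<phi>)\<in>A. U)" using atlas unfolding smooth_atlas_def by simp
  then show thesis using that by blast
qed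

lemma chart:
  assumes "(U, \<phi>) \<in> A"
  shows "open U" "open (\<phi> ` U)" "homeomorphism U (\<phi> ` U) \<phi> (inv_into U \<phi>)"
  using assms atlas unfolding smooth_atlas_def by blast+

lemma chart_inv:
  assumes "(U, \<phi>) \<in> A"
  shows "q \<in> U \<Longrightarrow> inv_into U \<phi> (\<phi> q) = q" "x \<in> \<phi> ` U \<Longrightarrow> \<phi> (inv_into U \<phi> x) = x"
    "x \<in> \<phi> ` U \<Longrightarrow> inv_into U \<phi> x \<in> U"
  using homeomorphism_apply1[OF chart(3)[OF assms]] homeomorphism_apply2[OF chart(3)[OF assms]]
    homeomorphism_image2[OF chart(3)[OF assms]] by blast+

lemma transition:
  assumes "(U, \<phi>) \<in> A" "(W, \<psi>) \<in> A"
  shows "smooth_on (\<phi> ` (U \<inter> W)) (\<psi> \<circ> inv_into U \<phi>)"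
  using assms atlas unfolding smooth_atlas_def by blast

lemma chart_open_image:
  assumes c: "(U, \<phi>) \<in> A" and "open O'" "O' \<subseteq> U" shows "open (\<phi> ` O')"
proof -
  have "openin (top_of_set (\<phi> ` U)) (\<phi> ` O')"
    using homeomorphism_imp_open_map[OF chart(3)[OF c], of O'] assms chart(1)[OF c]
    by (simp add: openin_open_eq)
  then show ?thesis using chart(2)[OF c] openin_open_trans by blast
qed

lemma chart_open_vimage:
  assumes c: "(U, \<phi>) \<in> A" and "open S" shows "open {q \<in> U. \<phi> q \<in> S}"
proof -
  have "open (U \<inter> \<phi> -` S)"
    using chart[OF c] assms(2) by (intro continuous_open_preimage) (auto simp: homeomorphism_def)
  also have "U \<inter> \<phi> -` S = {q \<in> U. \<phi> q \<in> S}" by auto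
  finally show ?thesis .
qed

lemma smooth_fun_chart: "smooth_fun A f \<Longrightarrow> (U, \<phi>) \<in> A \<Longrightarrow> smooth_on (\<phi> ` U) (\<lambda>x. f (inv_into U \<phi> x))"
  unfolding smooth_fun_def o_def by blast

lemma smooth_funI: "(\<And>U \<phi>. (U, \<phi>) \<in> A \<Longrightarrow> smooth_on (\<phi> ` U) (\<lambda>x. f (inv_into U \<phi> x))) \<Longrightarrow> smooth_fun A f"
  unfolding smooth_fun_def o_def by blast

lemma smooth_fun_const: "smooth_fun A (\<lambda>q. c)"
  by (rule smooth_funI) (rule smooth_on_const)

lemma smooth_fun_add:
  assumes f: "smooth_fun A f" and g: "smooth_fun A g" shows "smooth_fun A (\<lambda>q. f q + g q)"
proof (rule smooth_funI)
  fix U \<phi> assume c: "(U, \<phi>) \<in> A"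
  show "smooth_on (\<phi> ` U) (\<lambda>x. f (inv_into U \<phi> x) + g (inv_into U \<phi> x))"
    by (rule smooth_on_add[OF chart(2)[OF c] smooth_fun_chart[OF f c] smooth_fun_chart[OF g c]])
qed

lemma smooth_fun_mult:
  assumes f: "smooth_fun A f" and g: "smooth_fun A g" shows "smooth_fun A (\<lambda>q. f q * g q)"
proof (rule smooth_funI)
  fix U \<phi> assume c: "(U, \<phi>) \<in> A"
  show "smooth_on (\<phi> ` U) (\<lambda>x. f (inv_into U \<phi> x) * g (inv_into U \<phi> x))"
    by (rule smooth_on_mult[OF chart(2)[OF c] smooth_fun_chart[OF f c] smooth_fun_chart[OF g c]])
qed

lemma smooth_fun_diff: "smooth_fun A f \<Longrightarrow> smooth_fun A g \<Longrightarrow> smooth_fun A (\<lambda>q. f q - g q)"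
  using smooth_fun_add[of f "\<lambda>q. (-1) * g q"] smooth_fun_mult[OF smooth_fun_const, of g "-1"] by simp

lemma smooth_fun_inverse:
  assumes f: "smooth_fun A f" and nz: "\<And>q. f q \<noteq> 0" shows "smooth_fun A (\<lambda>q. inverse (f q))"
proof (rule smooth_funI)
  fix U \<phi> assume c: "(U, \<phi>) \<in> A"
  show "smooth_on (\<phi> ` U) (\<lambda>x. inverse (f (inv_into U \<phi> x)))"
    by (rule smooth_on_inverse[OF chart(2)[OF c] smooth_fun_chart[OF f c] nz])
qed

lemma smooth_fun_sum: "(\<And>b. b \<in> J \<Longrightarrow> smooth_fun A (F b)) \<Longrightarrow> smooth_fun A (\<lambda>q. \<Sum>b\<in>J. F b q)"
  by (induction J rule: infinite_finite_induct) (auto simp: smooth_fun_const smooth_fun_add)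

lemma tangentD:
  assumes "v \<in> tangent_space A p"
  shows "smooth_fun A f \<Longrightarrow> smooth_fun A g \<Longrightarrow> v (\<lambda>q. f q + g q) = v f + v g"
    and "smooth_fun A f \<Longrightarrow> v (\<lambda>q. c * f q) = c * v f"
    and "smooth_fun A f \<Longrightarrow> smooth_fun A g \<Longrightarrow> v (\<lambda>q. f q * g q) = f p * v g + g p * v f"
    and "\<not> smooth_fun A f \<Longrightarrow> v f = 0"
  using assms unfolding tangent_space_def by blast+

lemma tangentI:
  assumes "\<And>f g. smooth_fun A f \<Longrightarrow> smooth_fun A g \<Longrightarrow> v (\<lambda>q. f q + g q) = v f + v g"
    and "\<And>c f. smooth_fun A f \<Longrightarrow> v (\<lambda>q. c * f q) = c * v f"
    and "\<And>f g. smooth_fun A f \<Longrightarrow> smooth_fun A g \<Longrightarrow> v (\<lambda>q. f q * g q) = f p * v g + g p * v f"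
    and "\<And>f. \<not> smooth_fun A f \<Longrightarrow> v f = 0"
  shows "v \<in> tangent_space A p"
  unfolding tangent_space_def using assms by blast

lemma tangent_zero: "v \<in> tangent_space A p \<Longrightarrow> v (\<lambda>q. 0) = 0"
  using tangentD(2)[of v p "\<lambda>q. 0" 0] smooth_fun_const by simp

text \<open>\<open>v(1) = v(1 \<cdot> 1) = 2 v(1)\<close>.\<close>

lemma tangent_const: "v \<in> tangent_space A p \<Longrightarrow> v (\<lambda>q. c) = 0"
proof -
  assume v: "v \<in> tangent_space A p"
  have "v (\<lambda>q. 1 * 1) = 1 * v (\<lambda>q. 1) + 1 * v (\<lambda>q. 1)"
    by (rule tangentD(3)[OF v smooth_fun_const smooth_fun_const])
  then have "v (\<lambda>q. 1) = 0" by simp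
  then show ?thesis using tangentD(2)[OF v smooth_fun_const[of 1], of c] by simp
qed

lemma tangent_diff:
  assumes v: "v \<in> tangent_space A p" and "smooth_fun A f" "smooth_fun A g"
  shows "v (\<lambda>q. f q - g q) = v f - v g"
proof -
  have "v (\<lambda>q. f q + (-1) * g q) = v f + v (\<lambda>q. (-1) * g q)"
    by (rule tangentD(1)[OF v assms(2) smooth_fun_mult[OF smooth_fun_const assms(3)]])
  then show ?thesis using tangentD(2)[OF v assms(3), of "-1"] by simp
qed

lemma tangent_sum:
  assumes v: "v \<in> tangent_space A p" and "\<And>b. b \<in> J \<Longrightarrow> smooth_fun A (F b)"
  shows "v (\<lambda>q. \<Sum>b\<in>J. F b q) = (\<Sum>b\<in>J. v (F b))"
  using assms(2)
proof (induction J rule: infinite_finite_induct)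
  case (insert b J)
  then show ?case using tangentD(1)[OF v, of "F b" "\<lambda>q. \<Sum>b\<in>J. F b q"] by (simp add: smooth_fun_sum)
qed (simp_all add: tangent_zero[OF v])

lemma tangent_lin:
  assumes u: "u \<in> tangent_space A p" and v: "v \<in> tangent_space A p"
  shows "(\<lambda>f. a * u f + b * v f) \<in> tangent_space A p"
proof (rule tangentI)
  fix f g assume f: "smooth_fun A f" and g: "smooth_fun A g"
  show "a * u (\<lambda>q. f q + g q) + b * v (\<lambda>q. f q + g q) = a * u f + b * v f + (a * u g + b * v g)"
    unfolding tangentD(1)[OF u f g] tangentD(1)[OF v f g] by (simp add: algebra_simps)
  show "a * u (\<lambda>q. f q * g q) + b * v (\<lambda>q. f q * g q) = f p * (a * u g + b * v g) + g p * (a * u f + b * v f)"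
    unfolding tangentD(3)[OF u f g] tangentD(3)[OF v f g] by (simp add: algebra_simps)
next
  fix c f assume f: "smooth_fun A f"
  show "a * u (\<lambda>q. c * f q) + b * v (\<lambda>q. c * f q) = c * (a * u f + b * v f)"
    unfolding tangentD(2)[OF u f] tangentD(2)[OF v f] by (simp add: algebra_simps)
qed (simp add: tangentD(4)[OF u] tangentD(4)[OF v])

text \<open>A function \<open>g\<close> of the coordinates, cut off by the bump function of a ball whose closure lies in \<open>S\<close>, as a
  function on the manifold.\<close>

definition extend :: "'a set \<Rightarrow> ('a \<Rightarrow> 'e) \<Rightarrow> 'e set \<Rightarrow> 'e \<Rightarrow> real \<Rightarrow> ('e \<Rightarrow> real) \<Rightarrow> 'a \<Rightarrow> real" where
  "extend U \<phi> S c r g q = (if q \<in> U \<and> \<phi> q \<in> S then bump c r (\<phi> q) * g (\<phi> q) else 0)"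

text \<open>Smoothness is local and has to be tested in every chart. The points with coordinates in \<open>S\<close> and the
  complement of the preimage \<open>K\<close> of the closed ball form an open cover; on the latter set the function is \<open>0\<close>.
  The complement is open because \<open>K\<close> is compact in a Hausdorff space.\<close>

lemma smooth_fun_extend:
  assumes c: "(U, \<phi>) \<in> A" and S: "open S" "S \<subseteq> \<phi> ` U" "cball c r \<subseteq> S" and r: "r > 0" and g: "smooth_on S g"
  shows "smooth_fun A (extend U \<phi> S c r g)"
proof (rule smooth_funI)
  fix W \<psi> assume c': "(W, \<psi>) \<in> A"
  let ?F = "\<lambda>x. extend U \<phi> S c r g (inv_into W \<psi> x)"
  define K where "K = inv_into U \<phi> ` cball c r"
  have "compact K"
    unfolding K_def
    by (rule compact_continuous_image[OF continuous_on_subset[OF homeomorphism_cont2[OF chart(3)[OF c]]]])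
       (use S in auto)
  then have "closed K" by (rule compact_imp_closed)
  define O1 where "O1 = W \<inter> {q \<in> U. \<phi> q \<in> S}"
  define O2 where "O2 = W - K"
  have O: "open O1" "open O2" "O1 \<subseteq> W" "O2 \<subseteq> W" "O1 \<subseteq> U"
    unfolding O1_def O2_def using chart(1)[OF c'] chart_open_vimage[OF c S(1)] \<open>closed K\<close> by auto
  have K: "q \<in> U" "\<phi> q \<in> S" if qK: "q \<in> K" for q
  proof -
    obtain x where "x \<in> cball c r" and q: "q = inv_into U \<phi> x" using qK unfolding K_def by blast
    then have x: "x \<in> S" "x \<in> \<phi> ` U" using S(2,3) by auto
    show "q \<in> U" unfolding q by (rule chart_inv(3)[OF c x(2)])
    show "\<phi> q \<in> S" unfolding q chart_inv(2)[OF c x(2)] by (rule x(1))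
  qed
  have "W = O1 \<union> O2" unfolding O1_def O2_def using K by blast
  then have img: "\<psi> ` W = \<psi> ` O1 \<union> \<psi> ` O2" by blast
  note op = chart_open_image[OF c' O(1,3)] chart_open_image[OF c' O(2,4)]
  have "smooth_on (\<psi> ` O1) ?F"
  proof -
    have sub: "\<psi> ` O1 \<subseteq> \<psi> ` (W \<inter> U)" using O by blast
    have "smooth_on (\<psi> ` O1) (\<phi> \<circ> inv_into W \<psi>)"
      by (rule smooth_on_subset[OF _ transition[OF c' c] sub op(1)])
         (rule chart_open_image[OF c'], use chart(1)[OF c] chart(1)[OF c'] in auto)
    moreover have "smooth_on S (\<lambda>x. bump c r x * g x)"
      by (rule smooth_on_mult[OF S(1) smooth_on_subset[OF open_UNIV smooth_on_bump subset_UNIV S(1)] g])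
    moreover have "(\<phi> \<circ> inv_into W \<psi>) ` \<psi> ` O1 \<subseteq> S"
      using chart_inv(1)[OF c'] unfolding O1_def by auto
    ultimately have "smooth_on (\<psi> ` O1) (\<lambda>x. bump c r ((\<phi> \<circ> inv_into W \<psi>) x) * g ((\<phi> \<circ> inv_into W \<psi>) x))"
      using smooth_on_compose[OF op(1) S(1)] by blast
    then show ?thesis
      by (rule smooth_on_cong[OF op(1)])
         (use chart_inv(1)[OF c'] in \<open>auto simp: O1_def extend_def\<close>)
  qed
  moreover have "smooth_on (\<psi> ` O2) ?F"
  proof (rule smooth_on_cong[OF op(2) smooth_on_const[of _ 0]])
    fix x assume "x \<in> \<psi> ` O2"
    then obtain q where q: "q \<in> W" "q \<notin> K" "x = \<psi> q" unfolding O2_def by blast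
    have "\<phi> q \<notin> ball c r" if "q \<in> U"
    proof
      assume "\<phi> q \<in> ball c r"
      then have "q \<in> K" unfolding K_def using chart_inv(1)[OF c that] by (metis ball_subset_cball image_eqI subsetD)
      then show False using q by simp
    qed
    then have "extend U \<phi> S c r g q = 0"
      unfolding extend_def bump_zero_iff[OF r, symmetric] by auto
    then show "0 = ?F x" using q chart_inv(1)[OF c'] by simp
  qed
  ultimately show "smooth_on (\<psi> ` W) ?F"
    unfolding img by (rule smooth_on_Un[OF op])
qed

lemma vector_fieldsD:
  assumes "X \<in> vector_fields A"
  shows "X p \<in> tangent_space A p" "smooth_fun A f \<Longrightarrow> smooth_fun A (\<lambda>p. X p f)"
  using assms unfolding vector_fields_def by blast+

lemma vector_fieldsI:
  "(\<And>p. X p \<in> tangent_space A p) \<Longrightarrow> (\<And>f. smooth_fun A f \<Longrightarrow> smooth_fun A (\<lambda>p. X p f)) \<Longrightarrow> X \<in> vector_fields A"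
  unfolding vector_fields_def by blast

lemma vector_field_nonsmooth: "X \<in> vector_fields A \<Longrightarrow> \<not> smooth_fun A f \<Longrightarrow> X p f = 0"
  using vector_fieldsD(1) tangentD(4) by blast

lemma commutator_vector_fields:
  assumes X: "X \<in> vector_fields A" and Y: "Y \<in> vector_fields A"
  shows "commutator X Y \<in> vector_fields A"
proof (rule vector_fieldsI)
  note X1 = vector_fieldsD(1)[OF X] and Y1 = vector_fieldsD(1)[OF Y]
  fix p
  show "commutator X Y p \<in> tangent_space A p"
    unfolding commutator_def
  proof (rule tangentI)
    fix f g assume f: "smooth_fun A f" and g: "smooth_fun A g"
    note Xs = vector_fieldsD(2)[OF X f] vector_fieldsD(2)[OF X g]
    note Ys = vector_fieldsD(2)[OF Y f] vector_fieldsD(2)[OF Y g]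
    show "X p (\<lambda>q. Y q (\<lambda>q. f q + g q)) - Y p (\<lambda>q. X q (\<lambda>q. f q + g q))
        = X p (\<lambda>q. Y q f) - Y p (\<lambda>q. X q f) + (X p (\<lambda>q. Y q g) - Y p (\<lambda>q. X q g))"
      unfolding tangentD(1)[OF X1 f g] tangentD(1)[OF Y1 f g] tangentD(1)[OF X1 Ys] tangentD(1)[OF Y1 Xs]
      by simp
    have "X p (\<lambda>q. f q * Y q g + g q * Y q f) = X p (\<lambda>q. f q * Y q g) + X p (\<lambda>q. g q * Y q f)"
      by (rule tangentD(1)[OF X1 smooth_fun_mult[OF f Ys(2)] smooth_fun_mult[OF g Ys(1)]])
    also have "\<dots> = f p * X p (\<lambda>q. Y q g) + Y p g * X p f + (g p * X p (\<lambda>q. Y q f) + Y p f * X p g)"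
      unfolding tangentD(3)[OF X1 f Ys(2)] tangentD(3)[OF X1 g Ys(1)] ..
    finally have 1: "X p (\<lambda>q. f q * Y q g + g q * Y q f)
        = f p * X p (\<lambda>q. Y q g) + Y p g * X p f + (g p * X p (\<lambda>q. Y q f) + Y p f * X p g)" .
    have "Y p (\<lambda>q. f q * X q g + g q * X q f) = Y p (\<lambda>q. f q * X q g) + Y p (\<lambda>q. g q * X q f)"
      by (rule tangentD(1)[OF Y1 smooth_fun_mult[OF f Xs(2)] smooth_fun_mult[OF g Xs(1)]])
    also have "\<dots> = f p * Y p (\<lambda>q. X q g) + X p g * Y p f + (g p * Y p (\<lambda>q. X q f) + X p f * Y p g)"
      unfolding tangentD(3)[OF Y1 f Xs(2)] tangentD(3)[OF Y1 g Xs(1)] ..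
    finally have 2: "Y p (\<lambda>q. f q * X q g + g q * X q f)
        = f p * Y p (\<lambda>q. X q g) + X p g * Y p f + (g p * Y p (\<lambda>q. X q f) + X p f * Y p g)" .
    show "X p (\<lambda>q. Y q (\<lambda>q. f q * g q)) - Y p (\<lambda>q. X q (\<lambda>q. f q * g q))
        = f p * (X p (\<lambda>q. Y q g) - Y p (\<lambda>q. X q g)) + g p * (X p (\<lambda>q. Y q f) - Y p (\<lambda>q. X q f))"
      unfolding tangentD(3)[OF X1 f g] tangentD(3)[OF Y1 f g] 1 2 by (simp add: algebra_simps)
  next
    fix c f assume f: "smooth_fun A f"
    show "X p (\<lambda>q. Y q (\<lambda>q. c * f q)) - Y p (\<lambda>q. X q (\<lambda>q. c * f q))
        = c * (X p (\<lambda>q. Y q f) - Y p (\<lambda>q. X q f))"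
      unfolding tangentD(2)[OF X1 f] tangentD(2)[OF Y1 f]
        tangentD(2)[OF X1 vector_fieldsD(2)[OF Y f]] tangentD(2)[OF Y1 vector_fieldsD(2)[OF X f]]
      by (simp add: right_diff_distrib)
  next
    fix f assume f: "\<not> smooth_fun A f"
    show "X p (\<lambda>q. Y q f) - Y p (\<lambda>q. X q f) = 0"
      unfolding vector_field_nonsmooth[OF X f] vector_field_nonsmooth[OF Y f] tangent_zero[OF X1] tangent_zero[OF Y1]
      by simp
  qed
next
  fix f assume f: "smooth_fun A f"
  show "smooth_fun A (\<lambda>p. commutator X Y p f)"
    unfolding commutator_def
    by (rule smooth_fun_diff[OF vector_fieldsD(2)[OF X vector_fieldsD(2)[OF Y f]] vector_fieldsD(2)[OF Y vector_fieldsD(2)[OF X f]]])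
qed

lemma lin_vector_fields:
  assumes X: "X \<in> vector_fields A" and Y: "Y \<in> vector_fields A" and f: "smooth_fun A f" and g: "smooth_fun A g"
  shows "(\<lambda>p h. f p * X p h + g p * Y p h) \<in> vector_fields A"
  by (rule vector_fieldsI[OF tangent_lin[OF vector_fieldsD(1)[OF X] vector_fieldsD(1)[OF Y]]
        smooth_fun_add[OF smooth_fun_mult[OF f vector_fieldsD(2)[OF X]] smooth_fun_mult[OF g vector_fieldsD(2)[OF Y]]]])

text \<open>The partial derivative in the direction \<open>b\<close>, cut off in the same way.\<close>

definition coord_field :: "'a set \<Rightarrow> ('a \<Rightarrow> 'e) \<Rightarrow> 'e set \<Rightarrow> 'e \<Rightarrow> real \<Rightarrow> 'e \<Rightarrow> 'a vfield" where
  "coord_field U \<phi> S c r b = (\<lambda>p f. if smooth_fun A f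
     then extend U \<phi> S c r (\<lambda>x. frechet_derivative (\<lambda>x. f (inv_into U \<phi> x)) (at x) b) p else 0)"

lemma coord_field_vector_fields:
  assumes c: "(U, \<phi>) \<in> A" and S: "open S" "S \<subseteq> \<phi> ` U" "cball c r \<subseteq> S" and r: "r > 0"
  shows "coord_field U \<phi> S c r b \<in> vector_fields A"
proof (rule vector_fieldsI)
  fix p
  show "coord_field U \<phi> S c r b p \<in> tangent_space A p"
  proof (cases "p \<in> U \<and> \<phi> p \<in> S")
    case False
    then have "coord_field U \<phi> S c r b p = (\<lambda>f. 0)"
      by (auto simp: coord_field_def extend_def)
    then show ?thesis by (simp add: tangent_space_def)
  next
    case True
    define x where "x = \<phi> p"
    define d :: "('a \<Rightarrow> real) \<Rightarrow> real" where "d f = frechet_derivative (\<lambda>x. f (inv_into U \<phi> x)) (at x) b" for f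
    have inv: "inv_into U \<phi> x = p" using chart_inv(1)[OF c] True by (simp add: x_def)
    have der: "((\<lambda>x. f (inv_into U \<phi> x)) has_derivative frechet_derivative (\<lambda>x. f (inv_into U \<phi> x)) (at x)) (at x)"
      if "smooth_fun A f" for f
      by (rule smooth_on_has_derivative[OF chart(2)[OF c] smooth_fun_chart[OF that c]]) (use True x_def in simp)
    have Y: "coord_field U \<phi> S c r b p f = (if smooth_fun A f then bump c r x * d f else 0)" for f
      using True by (simp add: coord_field_def extend_def d_def x_def)
    show ?thesis
    proof (rule tangentI)
      fix f g assume fg: "smooth_fun A f" "smooth_fun A g"
      have "d (\<lambda>q. f q + g q) = d f + d g"
        unfolding d_def
        by (subst frechet_derivative_at[OF has_derivative_add[OF der[OF fg(1)] der[OF fg(2)]], symmetric]) (rule refl)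
      then show "coord_field U \<phi> S c r b p (\<lambda>q. f q + g q) = coord_field U \<phi> S c r b p f + coord_field U \<phi> S c r b p g"
        unfolding Y using fg smooth_fun_add[OF fg] by (simp add: algebra_simps)
      have "d (\<lambda>q. f q * g q) = f p * d g + d f * g p"
        unfolding d_def
        by (subst frechet_derivative_at[OF has_derivative_mult[OF der[OF fg(1)] der[OF fg(2)]], symmetric])
          (simp only: inv)
      then show "coord_field U \<phi> S c r b p (\<lambda>q. f q * g q) = f p * coord_field U \<phi> S c r b p g + g p * coord_field U \<phi> S c r b p f"
        unfolding Y using fg smooth_fun_mult[OF fg] by (simp add: algebra_simps)
    next
      fix k f assume f: "smooth_fun A f"
      have "d (\<lambda>q. k * f q) = k * d f"
        unfolding d_def
        by (subst frechet_derivative_at[OF has_derivative_mult_right[OF der[OF f]], symmetric]) (rule refl)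
      then show "coord_field U \<phi> S c r b p (\<lambda>q. k * f q) = k * coord_field U \<phi> S c r b p f"
        unfolding Y using f smooth_fun_mult[OF smooth_fun_const f, of k] by simp
    qed (simp add: Y)
  qed
next
  fix f assume f: "smooth_fun A f"
  have "smooth_on S (\<lambda>x. frechet_derivative (\<lambda>x. f (inv_into U \<phi> x)) (at x) b)"
    by (rule smooth_on_deriv[OF S(1) smooth_on_subset[OF chart(2)[OF c] smooth_fun_chart[OF f c] S(2,1)]])
  from smooth_fun_extend[OF c S r this]
  show "smooth_fun A (\<lambda>p. coord_field U \<phi> S c r b p f)"
    using f by (simp add: coord_field_def)
qed

text \<open>Every derivation at \<open>p\<close> is a combination of coordinate derivatives. With \<open>x\<close> the coordinates of \<open>p\<close>,
  Hadamard's lemma writes \<open>f = f(p) + \<Sum>\<^sub>b (y\<^sub>b - x\<^sub>b) g\<^sub>b\<close> in the chart. Multiplied by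
  \<open>\<rho>\<^sup>2\<close> this becomes an identity \<open>\<rho>\<^sup>2 f = f(p) \<rho>\<^sup>2 + \<Sum>\<^sub>b (a\<^sub>b - x\<^sub>b \<rho>) (\<rho> g\<^sub>b)\<close> between global smooth functions, to
  which \<open>v\<close> can be applied. The factors \<open>a\<^sub>b - x\<^sub>b \<rho>\<close> vanish at \<open>p\<close>, so only their derivatives contribute. The third
  factor \<open>\<rho>\<close> in the claim serves to replace \<open>x\<^sub>b \<rho>(p)\<close> by \<open>a\<^sub>b(p)\<close>, which makes the coefficients smooth in \<open>p\<close>.\<close>

lemma coord_expansion:
  assumes c: "(U, \<phi>) \<in> A" and S: "open S" "S \<subseteq> \<phi> ` U" "cball c r \<subseteq> S" and r: "r > 0" and conv: "convex S"
    and v: "v \<in> tangent_space A p"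
  defines "\<rho> \<equiv> extend U \<phi> S c r (\<lambda>x. 1)" and "a \<equiv> \<lambda>b. extend U \<phi> S c r (\<lambda>x. x \<bullet> b)"
  shows "\<rho> p ^ 3 * v f = (\<Sum>b\<in>Basis. (\<rho> p * v (a b) - a b p * v \<rho>) * coord_field U \<phi> S c r b p f)"
proof (cases "smooth_fun A f \<and> \<rho> p \<noteq> 0")
  case False
  have "a b p = 0" if "\<rho> p = 0" for b
    using that by (auto simp: a_def \<rho>_def extend_def)
  then show ?thesis
    using False tangentD(4)[OF v, of f] by (auto simp: coord_field_def intro!: sum.neutral[symmetric])
next
  case True
  then have f: "smooth_fun A f" and \<rho>p: "\<rho> p \<noteq> 0" by auto
  have p: "p \<in> U" "\<phi> p \<in> S" using \<rho>p unfolding \<rho>_def extend_def by (auto split: if_splits)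
  define x where "x = \<phi> p"
  define u where "u = (\<lambda>x. f (inv_into U \<phi> x))"
  have u: "smooth_on S u"
    unfolding u_def by (rule smooth_on_subset[OF chart(2)[OF c] smooth_fun_chart[OF f c] S(2,1)])
  obtain g where g: "\<And>b. smooth_on S (g b)" "\<And>b. g b x = frechet_derivative u (at x) b"
    "\<And>y. y \<in> S \<Longrightarrow> u y = u x + (\<Sum>b\<in>Basis. ((y - x) \<bullet> b) * g b y)"
    by (rule hadamard[OF S(1) conv p(2)[folded x_def] u]) (rule that, assumption+)
  define G where "G b = extend U \<phi> S c r (g b)" for b
  have sm_\<rho>: "smooth_fun A \<rho>"
    unfolding \<rho>_def by (rule smooth_fun_extend[OF c S r smooth_on_const])
  have sm_a: "smooth_fun A (a b)" for b
    unfolding a_def by (rule smooth_fun_extend[OF c S r smooth_on_linear[OF bounded_linear_inner_left S(1)]])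
  have sm_G: "smooth_fun A (G b)" for b
    unfolding G_def by (rule smooth_fun_extend[OF c S r g(1)])
  have sm_diff: "smooth_fun A (\<lambda>q. a b q - (x \<bullet> b) * \<rho> q)" for b
    by (rule smooth_fun_diff[OF sm_a smooth_fun_mult[OF smooth_fun_const sm_\<rho>]])
  have sm_term: "smooth_fun A (\<lambda>q. (a b q - (x \<bullet> b) * \<rho> q) * G b q)" for b
    by (rule smooth_fun_mult[OF sm_diff sm_G])
  have ap: "a b p = (x \<bullet> b) * \<rho> p" for b
    using p by (simp add: a_def \<rho>_def extend_def x_def)
  have Gp: "G b p = coord_field U \<phi> S c r b p f" for b
    using p f g(2) by (simp add: G_def coord_field_def extend_def x_def u_def)
  have expand: "\<rho> q * \<rho> q * f q = f p * (\<rho> q * \<rho> q) + (\<Sum>b\<in>Basis. (a b q - (x \<bullet> b) * \<rho> q) * G b q)" for q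
  proof (cases "q \<in> U \<and> \<phi> q \<in> S")
    case True
    then have "f q = f p + (\<Sum>b\<in>Basis. ((\<phi> q - x) \<bullet> b) * g b (\<phi> q))"
      using g(3)[of "\<phi> q"] chart_inv(1)[OF c] p by (simp add: u_def x_def)
    then show ?thesis using True
      by (simp add: \<rho>_def a_def G_def extend_def inner_diff_left sum_distrib_left algebra_simps)
  qed (auto simp: \<rho>_def a_def G_def extend_def)
  have "\<rho> p * \<rho> p * v f + f p * v (\<lambda>q. \<rho> q * \<rho> q) = v (\<lambda>q. \<rho> q * \<rho> q * f q)"
    using tangentD(3)[OF v smooth_fun_mult[OF sm_\<rho> sm_\<rho>] f] by simp
  also have "\<dots> = v (\<lambda>q. f p * (\<rho> q * \<rho> q) + (\<Sum>b\<in>Basis. (a b q - (x \<bullet> b) * \<rho> q) * G b q))"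
    by (simp only: expand)
  also have "\<dots> = v (\<lambda>q. f p * (\<rho> q * \<rho> q)) + v (\<lambda>q. \<Sum>b\<in>Basis. (a b q - (x \<bullet> b) * \<rho> q) * G b q)"
    by (rule tangentD(1)[OF v smooth_fun_mult[OF smooth_fun_const smooth_fun_mult[OF sm_\<rho> sm_\<rho>]]
          smooth_fun_sum[OF sm_term]])
  also have "v (\<lambda>q. f p * (\<rho> q * \<rho> q)) = f p * v (\<lambda>q. \<rho> q * \<rho> q)"
    by (rule tangentD(2)[OF v smooth_fun_mult[OF sm_\<rho> sm_\<rho>]])
  also have "v (\<lambda>q. \<Sum>b\<in>Basis. (a b q - (x \<bullet> b) * \<rho> q) * G b q)
      = (\<Sum>b\<in>Basis. v (\<lambda>q. (a b q - (x \<bullet> b) * \<rho> q) * G b q))"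
    by (rule tangent_sum[OF v sm_term])
  also have "\<dots> = (\<Sum>b\<in>Basis. G b p * (v (a b) - (x \<bullet> b) * v \<rho>))"
  proof (rule sum.cong)
    fix b :: 'e
    have "v (\<lambda>q. (a b q - (x \<bullet> b) * \<rho> q) * G b q)
        = (a b p - (x \<bullet> b) * \<rho> p) * v (G b) + G b p * v (\<lambda>q. a b q - (x \<bullet> b) * \<rho> q)"
      by (rule tangentD(3)[OF v sm_diff sm_G])
    also have "v (\<lambda>q. a b q - (x \<bullet> b) * \<rho> q) = v (a b) - v (\<lambda>q. (x \<bullet> b) * \<rho> q)"
      by (rule tangent_diff[OF v sm_a smooth_fun_mult[OF smooth_fun_const sm_\<rho>]])
    also have "v (\<lambda>q. (x \<bullet> b) * \<rho> q) = (x \<bullet> b) * v \<rho>"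
      by (rule tangentD(2)[OF v sm_\<rho>])
    finally show "v (\<lambda>q. (a b q - (x \<bullet> b) * \<rho> q) * G b q) = G b p * (v (a b) - (x \<bullet> b) * v \<rho>)"
      by (simp add: ap)
  qed simp
  finally have "\<rho> p * \<rho> p * v f = (\<Sum>b\<in>Basis. G b p * (v (a b) - (x \<bullet> b) * v \<rho>))"
    by simp
  then have "\<rho> p * (\<rho> p * \<rho> p * v f) = \<rho> p * (\<Sum>b\<in>Basis. G b p * (v (a b) - (x \<bullet> b) * v \<rho>))"
    by simp
  also have "\<dots> = (\<Sum>b\<in>Basis. (\<rho> p * v (a b) - a b p * v \<rho>) * coord_field U \<phi> S c r b p f)"
    by (simp add: sum_distrib_left ap Gp algebra_simps)
  finally show ?thesis by (simp add: power3_eq_cube)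
qed

text \<open>The local origin of the frames in \<open>framed_algebra\<close>, with \<open>r = \<rho>\<^sup>3\<close> and \<open>\<theta>(v) = \<rho> v(a\<^sub>b) - a\<^sub>b v(\<rho>)\<close>.\<close>

definition local_frame :: "('a \<Rightarrow> real) \<Rightarrow> ('e \<Rightarrow> 'a \<Rightarrow> real) \<Rightarrow> ('e \<Rightarrow> 'a vfield) \<Rightarrow> bool" where
  "local_frame \<rho> a Y \<longleftrightarrow> smooth_fun A \<rho> \<and> (\<forall>b. smooth_fun A (a b)) \<and> (\<forall>b. Y b \<in> vector_fields A) \<and>
     open {p. \<rho> p \<noteq> 0} \<and> (\<forall>p b. \<rho> p = 0 \<longrightarrow> Y b p = 0) \<and>
     (\<forall>p v f. v \<in> tangent_space A p \<longrightarrow>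
       \<rho> p ^ 3 * v f = (\<Sum>b\<in>Basis. (\<rho> p * v (a b) - a b p * v \<rho>) * Y b p f))"

text \<open>The ball of radius \<open>R\<close> is a convex neighbourhood, as Hadamard's lemma requires, of the closed ball of radius
  \<open>R / 2\<close>, outside of which the functions are cut off.\<close>

lemma local_frame_exists: "\<exists>\<rho> a Y. local_frame \<rho> a Y \<and> \<rho> p0 \<noteq> 0"
proof -
  obtain U \<phi> where c: "(U, \<phi>) \<in> A" "p0 \<in> U" by (rule chart_cover)
  obtain R where R: "R > 0" "ball (\<phi> p0) R \<subseteq> \<phi> ` U"
    using chart(2)[OF c(1)] c(2) open_contains_ball by blast
  define S where "S = ball (\<phi> p0) R"
  have S: "open S" "S \<subseteq> \<phi> ` U" "cball (\<phi> p0) (R / 2) \<subseteq> S" "convex S" "R / 2 > 0"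
    using R by (auto simp: S_def)
  let ?\<rho> = "extend U \<phi> S (\<phi> p0) (R / 2) (\<lambda>x. 1)"
  have \<rho>: "?\<rho> p \<noteq> 0 \<longleftrightarrow> p \<in> U \<and> \<phi> p \<in> ball (\<phi> p0) (R / 2)" for p
  proof -
    have "\<phi> p \<in> ball (\<phi> p0) (R / 2) \<Longrightarrow> \<phi> p \<in> S"
      using S(3) ball_subset_cball[of "\<phi> p0" "R / 2"] by blast
    then show ?thesis
      using bump_zero_iff[OF S(5), of "\<phi> p0" "\<phi> p"] by (auto simp: extend_def simp del: mem_ball)
  qed
  have "local_frame ?\<rho> (\<lambda>b. extend U \<phi> S (\<phi> p0) (R / 2) (\<lambda>x. x \<bullet> b)) (coord_field U \<phi> S (\<phi> p0) (R / 2))"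
    unfolding local_frame_def
  proof (intro conjI allI impI)
    show "smooth_fun A ?\<rho>" by (rule smooth_fun_extend[OF c(1) S(1,2,3,5) smooth_on_const])
    show "smooth_fun A (extend U \<phi> S (\<phi> p0) (R / 2) (\<lambda>x. x \<bullet> b))" for b
      by (rule smooth_fun_extend[OF c(1) S(1,2,3,5) smooth_on_linear[OF bounded_linear_inner_left S(1)]])
    show "open {p. ?\<rho> p \<noteq> 0}" unfolding \<rho> by (rule chart_open_vimage[OF c(1) open_ball])
    show "coord_field U \<phi> S (\<phi> p0) (R / 2) b p = 0" if "?\<rho> p = 0" for p b
      using that by (auto simp: coord_field_def extend_def fun_eq_iff)
  qed (rule coord_field_vector_fields[OF c(1) S(1,2,3,5)], rule coord_expansion[OF c(1) S(1,2,3,5,4)])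
  moreover have "?\<rho> p0 \<noteq> 0" unfolding \<rho> using c(2) R by simp
  ultimately show ?thesis by blast
qed

end

context smooth_manifold
begin

text \<open>Fields are determined by their action on smooth functions because they are normalised to vanish on
  all other functions.\<close>

lemma lie_rinehart_vector_fields:
  "lie_rinehart (Collect (smooth_fun A)) (vector_fields A) act fscale commutator"
proof (unfold_locales, unfold mem_Collect_eq)
  show "smooth_fun A 0" unfolding zero_fun_def by (rule smooth_fun_const)
  show "(0 :: 'a vfield) \<in> vector_fields A"
    using lin_vector_fields
    by (intro vector_fieldsI) (simp_all add: tangent_space_def zero_fun_def smooth_fun_const)
next
  fix f g assume "smooth_fun A f" "smooth_fun A g"
  then show "smooth_fun A (f + g)" "smooth_fun A (f - g)" "smooth_fun A (f * g)"
    unfolding plus_fun_def fun_diff_def times_fun_def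
    by (rule smooth_fun_add, rule smooth_fun_diff, rule smooth_fun_mult)
next
  fix X Y :: "'a vfield" assume X: "X \<in> vector_fields A" and Y: "Y \<in> vector_fields A"
  show "X + Y \<in> vector_fields A" "X - Y \<in> vector_fields A"
    using lin_vector_fields[OF X Y smooth_fun_const[of 1] smooth_fun_const[of 1]]
      lin_vector_fields[OF X Y smooth_fun_const[of 1] smooth_fun_const[of "-1"]]
    by (simp_all add: plus_fun_def fun_diff_def)
  show "commutator X Y \<in> vector_fields A" by (rule commutator_vector_fields[OF X Y])
  show "act (X + Y) f = act X f + act Y f" for f
    by (simp add: act_def fun_eq_iff)
  show "act (commutator X Y) f = act X (act Y f) - act Y (act X f)" for f
    by (simp add: act_def commutator_def fun_eq_iff)
  assume eq: "\<And>f. smooth_fun A f \<Longrightarrow> act X f = act Y f"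
  show "X = Y"
  proof (intro ext)
    fix p f
    show "X p f = Y p f"
      using eq[of f] vector_field_nonsmooth[OF X, of f p] vector_field_nonsmooth[OF Y, of f p]
      by (cases "smooth_fun A f") (auto simp: act_def dest: fun_cong)
  qed
next
  fix X :: "'a vfield" and f assume f: "smooth_fun A f" and X: "X \<in> vector_fields A"
  show "fscale f X \<in> vector_fields A"
    using lin_vector_fields[OF X X f smooth_fun_const[of 0]] by (simp add: fscale_def)
  show "act (fscale f X) g = f * act X g" for g
    by (simp add: act_def fscale_def fun_eq_iff)
next
  fix X :: "'a vfield" and f assume X: "X \<in> vector_fields A" and f: "smooth_fun A f"
  show "smooth_fun A (act X f)" unfolding act_def by (rule vector_fieldsD(2)[OF X f])
  fix g assume g: "smooth_fun A g"
  show "act X (f + g) = act X f + act X g"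
    using tangentD(1)[OF vector_fieldsD(1)[OF X] f g] by (simp add: act_def plus_fun_def)
  show "act X (f * g) = f * act X g + g * act X f"
    using tangentD(3)[OF vector_fieldsD(1)[OF X] f g] by (simp add: act_def plus_fun_def times_fun_def)
qed

end

locale closed_manifold = smooth_manifold A
  for A :: "('a::{t2_space, second_countable_topology}, 'e::euclidean_space) atlas" +
  assumes compact: "compact (UNIV :: 'a set)"
begin

text \<open>Compactness makes finitely many of the local frames sufficient.\<close>

lemma finite_frames:
  obtains I :: "'a set" and r Es \<theta> where
    "framed_algebra (Collect (smooth_fun A)) (vector_fields A) (tangent_space A) DIM('e) I r Es \<theta>"
proof -
  obtain \<rho> a Y where frame: "local_frame (\<rho> i) (a i) (Y i)" and at: "\<rho> i i \<noteq> 0" for i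
    using local_frame_exists by metis
  have sm: "smooth_fun A (\<rho> i)" "smooth_fun A (a i b)" and YV: "Y i b \<in> vector_fields A"
    and op: "open {p. \<rho> i p \<noteq> 0}" and Y0: "\<rho> i p = 0 \<Longrightarrow> Y i b p = 0"
    and expansion: "v \<in> tangent_space A p \<Longrightarrow>
      \<rho> i p ^ 3 * v f = (\<Sum>b\<in>Basis. (\<rho> i p * v (a i b) - a i b p * v (\<rho> i)) * Y i b p f)" for i p b v f
    using frame[of i] unfolding local_frame_def by blast+
  obtain I where I: "finite I" "UNIV \<subseteq> (\<Union>i\<in>I. {p. \<rho> i p \<noteq> 0})"
    using compactE_image[OF compact, of UNIV "\<lambda>i. {p. \<rho> i p \<noteq> 0}"] op at by (metis (mono_tags, lifting) UNIV_I UN_iff mem_Collect_eq subsetI)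
  obtain bs :: "'e list" where bs: "set bs = Basis" "distinct bs"
    using finite_distinct_list[OF finite_Basis] by blast
  have len: "length bs = DIM('e)" using bs distinct_card by metis
  have bij: "bij_betw ((!) bs) {..<DIM('e)} Basis"
    by (rule bij_betw_nth[OF bs(2)]) (simp_all add: len bs(1))
  interpret lie_rinehart "Collect (smooth_fun A)" "vector_fields A" act fscale commutator
    by (rule lie_rinehart_vector_fields)
  have "framed_algebra (Collect (smooth_fun A)) (vector_fields A) (tangent_space A) DIM('e) I
    (\<lambda>i p. \<rho> i p ^ 3) (\<lambda>i. map (Y i) bs) (\<lambda>i j p v. \<rho> i p * v (a i (bs ! j)) - a i (bs ! j) p * v (\<rho> i))"
  proof (unfold_locales, unfold mem_Collect_eq)
    show "smooth_fun A (\<lambda>p. c)" for c by (rule smooth_fun_const)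
    show "act X (\<lambda>p. c) = 0" if "X \<in> vector_fields A" for X c
      using tangent_const[OF vector_fieldsD(1)[OF that]] by (simp add: act_def fun_eq_iff)
    show "smooth_fun A (\<lambda>p. inverse (f p))" if "smooth_fun A f" "\<And>p. f p \<noteq> 0" for f
      by (rule smooth_fun_inverse[OF that])
    show "X p \<in> tangent_space A p" if "X \<in> vector_fields A" for X p
      by (rule vector_fieldsD(1)[OF that])
    show "(\<lambda>f. \<alpha> * u f + \<beta> * v f) \<in> tangent_space A p" if "u \<in> tangent_space A p" "v \<in> tangent_space A p" for u v p \<alpha> \<beta>
      by (rule tangent_lin[OF that])
    show "finite I" by (rule I)
    show "smooth_fun A (\<lambda>p. \<rho> i p ^ 3)" for i
      unfolding power3_eq_cube by (rule smooth_fun_mult[OF smooth_fun_mult[OF sm(1) sm(1)] sm(1)])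
    show "\<exists>i\<in>I. \<rho> i p ^ 3 \<noteq> 0" for p using I(2) by auto
    show "map (Y i) bs \<in> vlists DIM('e)" for i
      using YV by (auto simp: vlists_def len)
    show "(map (Y i) bs ! j) p = 0" if "j < DIM('e)" "\<rho> i p ^ 3 = 0" for i j p
      using that Y0 len by simp
    show "smooth_fun A (\<lambda>p. \<rho> i p * X p (a i (bs ! j)) - a i (bs ! j) p * X p (\<rho> i))" if "X \<in> vector_fields A" for i j X
      by (rule smooth_fun_diff[OF smooth_fun_mult[OF sm(1) vector_fieldsD(2)[OF that sm(2)]]
            smooth_fun_mult[OF sm(2) vector_fieldsD(2)[OF that sm(1)]]])
    show "\<rho> i p * (\<alpha> * u (a i (bs ! j)) + \<beta> * v (a i (bs ! j))) - a i (bs ! j) p * (\<alpha> * u (\<rho> i) + \<beta> * v (\<rho> i))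
      = \<alpha> * (\<rho> i p * u (a i (bs ! j)) - a i (bs ! j) p * u (\<rho> i)) + \<beta> * (\<rho> i p * v (a i (bs ! j)) - a i (bs ! j) p * v (\<rho> i))"
      for i j p u v \<alpha> \<beta>
      by (simp add: algebra_simps)
    show "\<rho> i p ^ 3 * v f = (\<Sum>j<DIM('e). (\<rho> i p * v (a i (bs ! j)) - a i (bs ! j) p * v (\<rho> i)) * (map (Y i) bs ! j) p f)"
      if "v \<in> tangent_space A p" for i p v f
    proof -
      have "\<rho> i p ^ 3 * v f = (\<Sum>j<DIM('e). (\<rho> i p * v (a i (bs ! j)) - a i (bs ! j) p * v (\<rho> i)) * Y i (bs ! j) p f)"
        unfolding expansion[OF that] by (rule sum.reindex_bij_betw[OF bij, symmetric])
      also have "\<dots> = (\<Sum>j<DIM('e). (\<rho> i p * v (a i (bs ! j)) - a i (bs ! j) p * v (\<rho> i)) * (map (Y i) bs ! j) p f)"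
        by (rule sum.cong) (simp_all add: len)
      finally show ?thesis .
    qed
  qed
  then show thesis by (rule that)
qed

end

section \<open>Quotients of grounded L-infinity algebras\<close>

lemma real_ring_cring: "cring real_ring"
  by unfold_locales
     (auto simp: real_ring_def Units_def algebra_simps intro: exI[of _ "- x" for x :: real])

lemma real_ring_simps [simp]:
  "carrier real_ring = UNIV" "x \<oplus>\<^bsub>real_ring\<^esub> y = x + y" "x \<otimes>\<^bsub>real_ring\<^esub> y = x * y"
  "\<one>\<^bsub>real_ring\<^esub> = 1" "\<zero>\<^bsub>real_ring\<^esub> = 0"
  by (simp_all add: real_ring_def)

text \<open>What is needed of a grounded L-infinity algebra to obtain a Lie algebra from its degree \<open>0\<close> part: the
  binary bracket is bilinear and alternating, vanishes on boundaries, and satisfies the Jacobi identity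
  up to a boundary.\<close>

locale grounded_linf_data = module real_ring "grade L 0" for L :: "'v linf" +
  assumes boundaries: "additive_subgroup (linf_boundaries L) (grade L 0)"
    and boundaries_smult: "b \<in> linf_boundaries L \<Longrightarrow> c \<odot>\<^bsub>grade L 0\<^esub> b \<in> linf_boundaries L"
    and l2_closed: "x \<in> carrier (grade L 0) \<Longrightarrow> y \<in> carrier (grade L 0) \<Longrightarrow>
      brk L [(0, x), (0, y)] \<in> carrier (grade L 0)"
    and l2_add_left: "x \<in> carrier (grade L 0) \<Longrightarrow> y \<in> carrier (grade L 0) \<Longrightarrow> z \<in> carrier (grade L 0) \<Longrightarrow>
      brk L [(0, x \<oplus>\<^bsub>grade L 0\<^esub> y), (0, z)] = brk L [(0, x), (0, z)] \<oplus>\<^bsub>grade L 0\<^esub> brk L [(0, y), (0, z)]"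
    and l2_add_right: "x \<in> carrier (grade L 0) \<Longrightarrow> y \<in> carrier (grade L 0) \<Longrightarrow> z \<in> carrier (grade L 0) \<Longrightarrow>
      brk L [(0, z), (0, x \<oplus>\<^bsub>grade L 0\<^esub> y)] = brk L [(0, z), (0, x)] \<oplus>\<^bsub>grade L 0\<^esub> brk L [(0, z), (0, y)]"
    and l2_smult_left: "x \<in> carrier (grade L 0) \<Longrightarrow> y \<in> carrier (grade L 0) \<Longrightarrow>
      brk L [(0, c \<odot>\<^bsub>grade L 0\<^esub> x), (0, y)] = c \<odot>\<^bsub>grade L 0\<^esub> brk L [(0, x), (0, y)]"
    and l2_smult_right: "x \<in> carrier (grade L 0) \<Longrightarrow> y \<in> carrier (grade L 0) \<Longrightarrow>
      brk L [(0, x), (0, c \<odot>\<^bsub>grade L 0\<^esub> y)] = c \<odot>\<^bsub>grade L 0\<^esub> brk L [(0, x), (0, y)]"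
    and l2_self: "x \<in> carrier (grade L 0) \<Longrightarrow> brk L [(0, x), (0, x)] = \<zero>\<^bsub>grade L 0\<^esub>"
    and l2_boundary_left: "b \<in> linf_boundaries L \<Longrightarrow> x \<in> carrier (grade L 0) \<Longrightarrow>
      brk L [(0, b), (0, x)] = \<zero>\<^bsub>grade L 0\<^esub>"
    and l2_boundary_right: "b \<in> linf_boundaries L \<Longrightarrow> x \<in> carrier (grade L 0) \<Longrightarrow>
      brk L [(0, x), (0, b)] = \<zero>\<^bsub>grade L 0\<^esub>"
    and l2_jacobi: "x \<in> carrier (grade L 0) \<Longrightarrow> y \<in> carrier (grade L 0) \<Longrightarrow> z \<in> carrier (grade L 0) \<Longrightarrow>
      brk L [(0, x), (0, brk L [(0, y), (0, z)])] \<oplus>\<^bsub>grade L 0\<^esub> brk L [(0, y), (0, brk L [(0, z), (0, x)])]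
        \<oplus>\<^bsub>grade L 0\<^esub> brk L [(0, z), (0, brk L [(0, x), (0, y)])] \<in> linf_boundaries L"
begin

abbreviation "W \<equiv> grade L 0"
abbreviation "BB \<equiv> linf_boundaries L"
abbreviation l2 :: "'v \<Rightarrow> 'v \<Rightarrow> 'v" where "l2 x y \<equiv> brk L [(0, x), (0, y)]"
abbreviation q :: "'v \<Rightarrow> 'v set" where "q \<equiv> linf_coset L"
abbreviation "Q \<equiv> linf_quotient L"

lemma boundaries_abelian_subgroup: "abelian_subgroup BB W"
  by (rule abelian_subgroupI3[OF boundaries M.abelian_group_axioms])

lemma boundary_carrier: "b \<in> BB \<Longrightarrow> b \<in> carrier W"
  using additive_subgroup.a_Hcarr[OF boundaries] .

lemma in_coset_iff: "y \<in> q x \<longleftrightarrow> (\<exists>b\<in>BB. y = b \<oplus>\<^bsub>W\<^esub> x)"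
  by (auto simp: linf_coset_def a_r_coset_def')

lemma coset_boundary_add:
  assumes "b \<in> BB" "x \<in> carrier W" shows "q (b \<oplus>\<^bsub>W\<^esub> x) = q x"
proof -
  have "b \<oplus>\<^bsub>W\<^esub> x \<in> BB +>\<^bsub>W\<^esub> x" using assms in_coset_iff unfolding linf_coset_def by blast
  then show ?thesis
    unfolding linf_coset_def
    by (rule M.a_repr_independence[OF _ assms(2) additive_subgroup.a_subgroup[OF boundaries], symmetric])
qed

lemma self_in_coset: "x \<in> carrier W \<Longrightarrow> x \<in> q x"
  unfolding linf_coset_def by (rule abelian_subgroup.a_rcos_self[OF boundaries_abelian_subgroup])

lemma quotient_carrier: "carrier Q = q ` carrier W"
  by (auto simp: linf_quotient_def A_RCOSETS_def' linf_coset_def)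

lemma quotient_zero: "\<zero>\<^bsub>Q\<^esub> = q \<zero>\<^bsub>W\<^esub>"
  using abelian_subgroup.a_rcos_const[OF boundaries_abelian_subgroup, of "\<zero>\<^bsub>W\<^esub>"]
    additive_subgroup.zero_closed[OF boundaries]
  by (simp add: linf_quotient_def linf_coset_def)

lemma quotient_zero_eq: "b \<in> BB \<Longrightarrow> q b = \<zero>\<^bsub>Q\<^esub>"
  using coset_boundary_add[of b "\<zero>\<^bsub>W\<^esub>"] boundary_carrier by (simp add: quotient_zero)

lemma quotient_add:
  "x \<in> carrier W \<Longrightarrow> y \<in> carrier W \<Longrightarrow> q x \<oplus>\<^bsub>Q\<^esub> q y = q (x \<oplus>\<^bsub>W\<^esub> y)"
  using abelian_subgroup.a_rcos_sum[OF boundaries_abelian_subgroup, of x y]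
  by (simp add: linf_quotient_def linf_coset_def)

lemma quotient_smult:
  assumes x: "x \<in> carrier W" shows "c \<odot>\<^bsub>Q\<^esub> q x = q (c \<odot>\<^bsub>W\<^esub> x)"
proof -
  have "q (c \<odot>\<^bsub>W\<^esub> y) = q (c \<odot>\<^bsub>W\<^esub> x)" if y: "y \<in> q x" for y
  proof -
    obtain b where b: "b \<in> BB" "y = b \<oplus>\<^bsub>W\<^esub> x" using y in_coset_iff by blast
    then have "c \<odot>\<^bsub>W\<^esub> y = c \<odot>\<^bsub>W\<^esub> b \<oplus>\<^bsub>W\<^esub> c \<odot>\<^bsub>W\<^esub> x"
      using smult_r_distr[of c b x] x boundary_carrier by simp
    then show ?thesis using coset_boundary_add[OF boundaries_smult[OF b(1)]] x by simp
  qed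
  then have "(\<Union>y\<in>q x. q (c \<odot>\<^bsub>W\<^esub> y)) = q (c \<odot>\<^bsub>W\<^esub> x)"
    by (intro UN_constant_eq[OF self_in_coset[OF x]] ballI)
  then show ?thesis by (simp only: linf_quotient_def module.simps)
qed

text \<open>The bracket is unchanged when boundaries are added to its arguments, so the union over all
  representatives that defines the induced bracket is a single coset.\<close>

lemma quotient_bracket:
  assumes x: "x \<in> carrier W" and y: "y \<in> carrier W" shows "bracket Q (q x) (q y) = q (l2 x y)"
proof -
  have "l2 x' y' = l2 x y" if x': "x' \<in> q x" and y': "y' \<in> q y" for x' y'
  proof -
    obtain a b where ab: "a \<in> BB" "x' = a \<oplus>\<^bsub>W\<^esub> x" "b \<in> BB" "y' = b \<oplus>\<^bsub>W\<^esub> y"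
      using x' y' in_coset_iff by blast
    have "l2 x' y' = l2 a y' \<oplus>\<^bsub>W\<^esub> l2 x y'"
      unfolding ab using ab(1,3) x y boundary_carrier by (intro l2_add_left) auto
    also have "l2 a y' = \<zero>\<^bsub>W\<^esub>"
      unfolding ab using ab(1,3) x y boundary_carrier by (intro l2_boundary_left) auto
    also have "l2 x y' = l2 x b \<oplus>\<^bsub>W\<^esub> l2 x y"
      unfolding ab using ab(1,3) x y boundary_carrier by (intro l2_add_right) auto
    also have "l2 x b = \<zero>\<^bsub>W\<^esub>" using ab(3) x by (intro l2_boundary_right)
    finally show ?thesis using l2_closed[OF x y] by simp
  qed
  then have "q (l2 x' y') = q (l2 x y)" if "x' \<in> q x" "y' \<in> q y" for x' y'
    using that by (simp only:)
  then have "(\<Union>x'\<in>q x. \<Union>y'\<in>q y. q (l2 x' y')) = q (l2 x y)"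
    by (intro UN_constant_eq[OF self_in_coset[OF x]] UN_constant_eq[OF self_in_coset[OF y]] ballI)
  then show ?thesis by (simp only: linf_quotient_def lie_alg.simps)
qed

lemmas quotient_simps = quotient_add quotient_smult quotient_bracket

lemma quotient_ball: "(\<forall>C\<in>carrier Q. P C) \<longleftrightarrow> (\<forall>x\<in>carrier W. P (q x))"
  by (simp add: quotient_carrier)

lemma quotient_abelian_group: "abelian_group Q"
proof (rule abelian_groupI)
  show "\<exists>Y\<in>carrier Q. Y \<oplus>\<^bsub>Q\<^esub> X = \<zero>\<^bsub>Q\<^esub>" if "X \<in> carrier Q" for X
  proof -
    obtain x where x: "x \<in> carrier W" "X = q x" using \<open>X \<in> carrier Q\<close> by (auto simp: quotient_carrier)
    then have "q (\<ominus>\<^bsub>W\<^esub> x) \<oplus>\<^bsub>Q\<^esub> X = \<zero>\<^bsub>Q\<^esub>"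
      by (simp add: quotient_add quotient_zero M.l_neg)
    then show ?thesis using x by (auto simp: quotient_carrier)
  qed
qed (auto simp: quotient_carrier quotient_add quotient_zero M.a_ac)

lemma quotient_module: "module real_ring Q"
  by (rule moduleI[OF real_ring_cring quotient_abelian_group])
     (auto simp: quotient_carrier quotient_add quotient_smult smult_l_distr[simplified] smult_r_distr[simplified]
       smult_assoc1[simplified] smult_one[simplified])

lemma quotient_lie_algebra: "lie_algebra Q"
proof -
  have "q (l2 x (l2 y z)) \<oplus>\<^bsub>Q\<^esub> q (l2 y (l2 z x)) \<oplus>\<^bsub>Q\<^esub> q (l2 z (l2 x y)) = \<zero>\<^bsub>Q\<^esub>"
    if "x \<in> carrier W" "y \<in> carrier W" "z \<in> carrier W" for x y z
    using quotient_zero_eq[OF l2_jacobi[OF that]] that by (simp add: quotient_add l2_closed)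
  then show ?thesis
    unfolding lie_algebra_def quotient_ball
    by (simp add: quotient_module quotient_simps l2_closed l2_add_left l2_add_right l2_smult_left
        l2_smult_right l2_self quotient_zero quotient_carrier)
qed

lemma quotient_map_real_linear: "real_linear W Q q"
  by (simp add: real_linear_def quotient_carrier quotient_add quotient_smult)

lemma quotient_map_linf_morphism: "grounded_linf_morphism L Q q"
  by (auto simp: grounded_linf_morphism_def quotient_map_real_linear quotient_bracket
      intro!: quotient_zero_eq simp: linf_boundaries_def)

end

section \<open>The bracket on forms\<close>

context framed_algebra
begin

lemma forms_lin:
  assumes \<omega>: "\<omega> \<in> forms j" and \<eta>: "\<eta> \<in> forms j"
  shows "(\<lambda>p vs. a * \<omega> p vs + b * \<eta> p vs) \<in> forms j"
proof -
  have alt: "alt_multilinear (T p) j (\<lambda>vs. a * \<omega> p vs + b * \<eta> p vs)" for p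
  proof -
    have w: "alt_multilinear (T p) j (\<omega> p)" and e: "alt_multilinear (T p) j (\<eta> p)"
      using \<omega> \<eta> by (simp_all add: forms_def)
    show ?thesis
      unfolding alt_multilinear_def
    proof (intro conjI allI impI)
      fix vs i u v c d assume *: "length vs = j" "set vs \<subseteq> T p" "i < j" "u \<in> T p" "v \<in> T p"
      show "a * \<omega> p (vs[i := (\<lambda>f. c * u f + d * v f)]) + b * \<eta> p (vs[i := (\<lambda>f. c * u f + d * v f)])
        = c * (a * \<omega> p (vs[i := u]) + b * \<eta> p (vs[i := u])) + d * (a * \<omega> p (vs[i := v]) + b * \<eta> p (vs[i := v]))"
        unfolding alt_multilinearD(2)[OF w *] alt_multilinearD(2)[OF e *] by (simp add: algebra_simps)
    next
      fix vs i l assume *: "length vs = j" "set vs \<subseteq> T p" "i < l" "l < j" "vs ! i = vs ! l"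
      show "a * \<omega> p vs + b * \<eta> p vs = 0"
        unfolding alt_multilinearD(3)[OF w *] alt_multilinearD(3)[OF e *] by simp
    next
      fix vs assume *: "\<not> (length vs = j \<and> set vs \<subseteq> T p)"
      show "a * \<omega> p vs + b * \<eta> p vs = 0"
        unfolding alt_multilinearD(1)[OF w *] alt_multilinearD(1)[OF e *] by simp
    qed
  qed
  have "eval_form (\<lambda>p vs. a * \<omega> p vs + b * \<eta> p vs) Xs \<in> C" if Xs: "Xs \<in> vlists j" for Xs
  proof -
    have "(\<lambda>p. a) * eval_form \<omega> Xs + (\<lambda>p. b) * eval_form \<eta> Xs \<in> C"
      by (rule C_add[OF C_mult[OF C_const] C_mult[OF C_const]]) (use \<omega> \<eta> Xs in \<open>simp_all add: forms_def\<close>)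
    then show ?thesis by (simp add: eval_form_def plus_fun_def times_fun_def)
  qed
  then show ?thesis using alt by (simp add: forms_def)
qed

lemma zero_form: "(\<lambda>p vs. 0) \<in> forms j"
  using C_const by (simp add: forms_def alt_multilinear_def eval_form_def)

lemma eval_form_lin:
  "eval_form (\<lambda>p vs. a * \<omega> p vs + b * \<eta> p vs) = (\<lambda>Zs. (\<lambda>p. a) * eval_form \<omega> Zs + (\<lambda>p. b) * eval_form \<eta> Zs)"
  by (simp add: eval_form_def fun_eq_iff)

lemma wedge_d_const: "set Xs \<subseteq> V \<Longrightarrow> wedge_d (\<lambda>p. c) F Xs = 0"
  by (induction Xs arbitrary: F) (simp_all add: act_const)

lemma D_lin:
  assumes F: "aform j F" and G: "aform j G" and Zs: "Zs \<in> vlists (Suc j)"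
  shows "D (\<lambda>Zs. (\<lambda>p. a) * F Zs + (\<lambda>p. b) * G Zs) Zs = (\<lambda>p. a) * D F Zs + (\<lambda>p. b) * D G Zs"
proof -
  have V: "set Zs \<subseteq> V" using Zs by (simp add: vlists_def)
  have "D (\<lambda>Zs. (\<lambda>p. a) * F Zs + (\<lambda>p. b) * G Zs) Zs = D (\<lambda>Zs. (\<lambda>p. a) * F Zs) Zs + D (\<lambda>Zs. (\<lambda>p. b) * G Zs) Zs"
    by (rule D_add[OF aform_scale[OF C_const F] aform_scale[OF C_const G] Zs])
  then show ?thesis
    unfolding D_scale[OF C_const F Zs] D_scale[OF C_const G Zs] wedge_d_const[OF V] by (simp only: add_0_right)
qed

lemma ext_d_lin:
  assumes \<omega>: "\<omega> \<in> forms j" and \<eta>: "\<eta> \<in> forms j"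
  shows "ext_d j (\<lambda>p vs. a * \<omega> p vs + b * \<eta> p vs) = (\<lambda>p vs. a * ext_d j \<omega> p vs + b * ext_d j \<eta> p vs)"
proof (rule forms_eqI[OF ext_d_forms[OF forms_lin[OF \<omega> \<eta>]] forms_lin[OF ext_d_forms[OF \<omega>] ext_d_forms[OF \<eta>]]])
  fix Xs assume Xs: "Xs \<in> vlists (Suc j)"
  show "eval_form (ext_d j (\<lambda>p vs. a * \<omega> p vs + b * \<eta> p vs)) Xs
      = eval_form (\<lambda>p vs. a * ext_d j \<omega> p vs + b * ext_d j \<eta> p vs) Xs"
    unfolding eval_ext_d[OF forms_lin[OF \<omega> \<eta>] Xs] eval_form_lin eval_ext_d[OF \<omega> Xs] eval_ext_d[OF \<eta> Xs]
    by (rule D_lin[OF aform_eval_form[OF \<omega>] aform_eval_form[OF \<eta>] Xs])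
qed

lemma ext_d_ext_d: 
  assumes \<omega>: "\<omega> \<in> forms j" shows "ext_d (Suc j) (ext_d j \<omega>) = (\<lambda>p vs. 0)"
proof (rule forms_eqI[OF ext_d_forms[OF ext_d_forms[OF \<omega>]] zero_form])
  fix Xs assume Xs: "Xs \<in> vlists (Suc (Suc j))"
  have "eval_form (ext_d (Suc j) (ext_d j \<omega>)) Xs = D (eval_form (ext_d j \<omega>)) Xs"
    by (rule eval_ext_d[OF ext_d_forms[OF \<omega>] Xs])
  also have "\<dots> = D (D (eval_form \<omega>)) Xs"
    by (rule D_cong[OF eval_ext_d[OF \<omega>] Xs])
  also have "\<dots> = 0" by (rule D_D[OF aform_eval_form[OF \<omega>] Xs])
  finally show "eval_form (ext_d (Suc j) (ext_d j \<omega>)) Xs = eval_form (\<lambda>p vs. 0) Xs"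
    by (simp add: eval_form_def zero_fun_def)
qed

lemma ext_d_zero: "ext_d j (\<lambda>p vs. 0) = (\<lambda>p vs. 0)"
  using ext_d_lin[OF zero_form[of j] zero_form[of j], of 0 0] by simp

lemma module_forms: "module real_ring (form_space (forms j))"
proof (rule moduleI[OF real_ring_cring abelian_groupI])
  note lin = forms_lin[where j = j]
  show "\<alpha> \<oplus>\<^bsub>form_space (forms j)\<^esub> \<beta> \<in> carrier (form_space (forms j))"
    if "\<alpha> \<in> carrier (form_space (forms j))" "\<beta> \<in> carrier (form_space (forms j))" for \<alpha> \<beta>
    using forms_lin[of \<alpha> j \<beta> 1 1] that by (simp add: form_space_def)
  show "\<exists>\<beta>\<in>carrier (form_space (forms j)). \<beta> \<oplus>\<^bsub>form_space (forms j)\<^esub> \<alpha> = \<zero>\<^bsub>form_space (forms j)\<^esub>"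
    if "\<alpha> \<in> carrier (form_space (forms j))" for \<alpha>
    using forms_lin[of \<alpha> j \<alpha> "-1" 0] that
    by (intro bexI[of _ "\<lambda>p vs. - \<alpha> p vs"]) (simp_all add: form_space_def)
  show "c \<odot>\<^bsub>form_space (forms j)\<^esub> \<alpha> \<in> carrier (form_space (forms j))"
    if "\<alpha> \<in> carrier (form_space (forms j))" for c \<alpha>
    using forms_lin[of \<alpha> j \<alpha> c 0] that by (simp add: form_space_def)
qed (simp_all add: form_space_def zero_form algebra_simps)

end

locale hamiltonian_forms = hamiltonian C V T n I r Es \<theta> "eval_form \<mu>" k
  for C :: "('a \<Rightarrow> real) set" and V T n and I :: "'i set" and r Es \<theta> \<mu> k +
  assumes \<mu>: "\<mu> \<in> forms (Suc (Suc k))"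
begin

definition ham :: "'a dform \<Rightarrow> 'a vfield" where
  "ham \<alpha> = (THE X. X \<in> V \<and> int_prod X \<mu> = (\<lambda>p vs. - ext_d k \<alpha> p vs))"

definition l2_form :: "'a dform \<Rightarrow> 'a dform \<Rightarrow> 'a dform" where
  "l2_form \<alpha> \<beta> = int_prod (ham \<beta>) (int_prod (ham \<alpha>) \<mu>)"

text \<open>For \<open>k = 0\<close> the boundaries come from degree \<open>-1\<close>, where there is only the zero form.\<close>

definition boundary_forms :: "'a dform set" where
  "boundary_forms = (if k = 0 then {\<lambda>p vs. 0} else ext_d (k - 1) ` forms (k - 1))"

text \<open>Forms are determined by their values on fields, so the defining equation of a Hamiltonian field
  can be tested there.\<close>

lemma ham_equation_iff:
  assumes \<alpha>: "\<alpha> \<in> forms k"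
  shows "X \<in> V \<and> int_prod X \<mu> = (\<lambda>p vs. - ext_d k \<alpha> p vs) \<longleftrightarrow> is_ham (eval_form \<alpha>) X"
proof -
  have neg: "(\<lambda>p vs. - ext_d k \<alpha> p vs) \<in> forms (Suc k)"
    using forms_lin[OF ext_d_forms[OF \<alpha>] ext_d_forms[OF \<alpha>], of "-1" 0] by simp
  have eval: "eval_form (\<lambda>p vs. - ext_d k \<alpha> p vs) Zs = - D (eval_form \<alpha>) Zs" if "Zs \<in> vlists (Suc k)" for Zs
    unfolding eval_ext_d[OF \<alpha> that, symmetric] by (simp add: eval_form_def fun_eq_iff)
  have "int_prod X \<mu> = (\<lambda>p vs. - ext_d k \<alpha> p vs) \<longleftrightarrow> (\<forall>Zs\<in>vlists (Suc k). eval_form \<mu> (X # Zs) = - D (eval_form \<alpha>) Zs)"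
    if X: "X \<in> V"
  proof
    assume eq: "int_prod X \<mu> = (\<lambda>p vs. - ext_d k \<alpha> p vs)"
    show "\<forall>Zs\<in>vlists (Suc k). eval_form \<mu> (X # Zs) = - D (eval_form \<alpha>) Zs"
      using eval eval_int_prod[of X \<mu>] unfolding eq by (simp add: fun_eq_iff)
  next
    assume eq: "\<forall>Zs\<in>vlists (Suc k). eval_form \<mu> (X # Zs) = - D (eval_form \<alpha>) Zs"
    show "int_prod X \<mu> = (\<lambda>p vs. - ext_d k \<alpha> p vs)"
      by (rule forms_eqI[OF int_prod_forms[OF \<mu> X] neg]) (simp add: eval_int_prod eq eval)
  qed
  then show ?thesis unfolding is_ham_def by blast
qed

lemma is_ham_ham:
  assumes \<alpha>: "\<alpha> \<in> forms k" shows "is_ham (eval_form \<alpha>) (ham \<alpha>)"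
proof -
  obtain X where X: "is_ham (eval_form \<alpha>) X" by (rule is_ham_exists[OF aform_eval_form[OF \<alpha>]])
  have "ham \<alpha> = X"
    unfolding ham_def ham_equation_iff[OF \<alpha>]
  proof (rule the_equality)
    show "Y = X" if "is_ham (eval_form \<alpha>) Y" for Y by (rule is_ham_unique[OF that X])
  qed (rule X)
  then show ?thesis using X by simp
qed

lemma ham_eqI: "\<alpha> \<in> forms k \<Longrightarrow> is_ham (eval_form \<alpha>) X \<Longrightarrow> ham \<alpha> = X"
  by (rule is_ham_unique[OF is_ham_ham])

lemma ham_V: "\<alpha> \<in> forms k \<Longrightarrow> ham \<alpha> \<in> V"
  by (rule is_ham_V[OF is_ham_ham])

lemma ham_lin:
  assumes \<alpha>: "\<alpha> \<in> forms k" and \<beta>: "\<beta> \<in> forms k"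
  shows "ham (\<lambda>p vs. a * \<alpha> p vs + b * \<beta> p vs) = fscale (\<lambda>p. a) (ham \<alpha>) + fscale (\<lambda>p. b) (ham \<beta>)"
proof (rule ham_eqI[OF forms_lin[OF \<alpha> \<beta>]], unfold is_ham_def eval_form_lin, intro conjI ballI)
  note V = ham_V[OF \<alpha>] ham_V[OF \<beta>]
  note sV = V_scale[OF C_const V(1), of a] V_scale[OF C_const V(2), of b]
  show "fscale (\<lambda>p. a) (ham \<alpha>) + fscale (\<lambda>p. b) (ham \<beta>) \<in> V" by (rule V_add[OF sV])
  fix Zs assume Zs: "Zs \<in> vlists (Suc k)"
  have h: "eval_form \<mu> (ham \<alpha> # Zs) = - D (eval_form \<alpha>) Zs" "eval_form \<mu> (ham \<beta> # Zs) = - D (eval_form \<beta>) Zs"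
    using is_ham_ham[OF \<alpha>] is_ham_ham[OF \<beta>] Zs by (simp_all add: is_ham_def)
  show "eval_form \<mu> ((fscale (\<lambda>p. a) (ham \<alpha>) + fscale (\<lambda>p. b) (ham \<beta>)) # Zs)
      = - D (\<lambda>Zs. (\<lambda>p. a) * eval_form \<alpha> Zs + (\<lambda>p. b) * eval_form \<beta> Zs) Zs"
    unfolding aform_add_left[OF M sV Zs] aform_scale_left[OF M C_const V(1) Zs] aform_scale_left[OF M C_const V(2) Zs]
      D_lin[OF aform_eval_form[OF \<alpha>] aform_eval_form[OF \<beta>] Zs] h
    by simp
qed

lemma ham_zero_of_closed:
  assumes \<alpha>: "\<alpha> \<in> forms k" and d: "ext_d k \<alpha> = (\<lambda>p vs. 0)"
  shows "ham \<alpha> = 0"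
proof (rule ham_eqI[OF \<alpha>], unfold is_ham_def, intro conjI ballI)
  fix Zs assume Zs: "Zs \<in> vlists (Suc k)"
  have "D (eval_form \<alpha>) Zs = 0"
    unfolding eval_ext_d[OF \<alpha> Zs, symmetric] d by (simp add: eval_form_def zero_fun_def)
  then show "eval_form \<mu> (0 # Zs) = - D (eval_form \<alpha>) Zs"
    using aform_0_left[OF M Zs] by simp
qed (rule V_0)

lemma boundary_forms_0: "k = 0 \<Longrightarrow> boundary_forms = {\<lambda>p vs. 0}"
  and boundary_forms_Suc: "k = Suc j \<Longrightarrow> boundary_forms = ext_d j ` forms j"
  unfolding boundary_forms_def by simp_all

lemma boundary_forms_closed:
  assumes "\<beta> \<in> boundary_forms" shows "\<beta> \<in> forms k" "ext_d k \<beta> = (\<lambda>p vs. 0)"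
proof -
  have "\<beta> \<in> forms k \<and> ext_d k \<beta> = (\<lambda>p vs. 0)"
  proof (cases k)
    case 0
    show ?thesis using assms unfolding boundary_forms_0[OF 0] by (simp add: zero_form ext_d_zero)
  next
    case (Suc j)
    then obtain \<gamma> where "\<gamma> \<in> forms j" "\<beta> = ext_d j \<gamma>"
      using assms unfolding boundary_forms_Suc[OF Suc] by blast
    then show ?thesis using Suc by (simp add: ext_d_forms ext_d_ext_d)
  qed
  then show "\<beta> \<in> forms k" "ext_d k \<beta> = (\<lambda>p vs. 0)" by auto
qed

lemma ham_boundary: "\<beta> \<in> boundary_forms \<Longrightarrow> ham \<beta> = 0"
  by (rule ham_zero_of_closed[OF boundary_forms_closed])

lemma boundary_forms_lin:
  assumes "\<beta> \<in> boundary_forms" "\<gamma> \<in> boundary_forms"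
  shows "(\<lambda>p vs. a * \<beta> p vs + b * \<gamma> p vs) \<in> boundary_forms"
proof (cases k)
  case 0
  show ?thesis using assms unfolding boundary_forms_0[OF 0] by simp
next
  case (Suc j)
  then obtain \<beta>' \<gamma>' where *: "\<beta>' \<in> forms j" "\<beta> = ext_d j \<beta>'" "\<gamma>' \<in> forms j" "\<gamma> = ext_d j \<gamma>'"
    using assms unfolding boundary_forms_Suc[OF Suc] by blast
  then have "(\<lambda>p vs. a * \<beta> p vs + b * \<gamma> p vs) = ext_d j (\<lambda>p vs. a * \<beta>' p vs + b * \<gamma>' p vs)"
    by (simp add: ext_d_lin)
  then show ?thesis using forms_lin[OF *(1,3), of a b] unfolding boundary_forms_Suc[OF Suc] by blast
qed

lemma zero_boundary: "(\<lambda>p vs. 0) \<in> boundary_forms"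
proof (cases k)
  case 0
  show ?thesis unfolding boundary_forms_0[OF 0] by simp
next
  case (Suc j)
  show ?thesis
    unfolding boundary_forms_Suc[OF Suc] using zero_form[of j] ext_d_zero[of j] by (metis imageI)
qed

lemma l2_forms: "\<alpha> \<in> forms k \<Longrightarrow> \<beta> \<in> forms k \<Longrightarrow> l2_form \<alpha> \<beta> \<in> forms k"
  unfolding l2_form_def by (rule int_prod_forms[OF int_prod_forms[OF \<mu> ham_V] ham_V])

lemma eval_l2: "eval_form (l2_form \<alpha> \<beta>) = (\<lambda>Zs. eval_form \<mu> (ham \<alpha> # ham \<beta> # Zs))"
  unfolding l2_form_def eval_int_prod ..

lemma ham_l2:
  assumes \<alpha>: "\<alpha> \<in> forms k" and \<beta>: "\<beta> \<in> forms k"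
  shows "ham (l2_form \<alpha> \<beta>) = commutator (ham \<alpha>) (ham \<beta>)"
proof (rule ham_eqI[OF l2_forms[OF \<alpha> \<beta>]])
  show "is_ham (eval_form (l2_form \<alpha> \<beta>)) (commutator (ham \<alpha>) (ham \<beta>))"
    unfolding eval_l2
    by (rule is_ham_br[OF aform_eval_form[OF \<alpha>] is_ham_ham[OF \<alpha>] aform_eval_form[OF \<beta>] is_ham_ham[OF \<beta>]])
qed

lemma l2_lin_left:
  assumes \<alpha>: "\<alpha> \<in> forms k" and \<beta>: "\<beta> \<in> forms k" and \<gamma>: "\<gamma> \<in> forms k"
  shows "l2_form (\<lambda>p vs. a * \<alpha> p vs + b * \<beta> p vs) \<gamma> = (\<lambda>p vs. a * l2_form \<alpha> \<gamma> p vs + b * l2_form \<beta> \<gamma> p vs)"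
proof (rule forms_eqI[OF l2_forms[OF forms_lin[OF \<alpha> \<beta>] \<gamma>] forms_lin[OF l2_forms[OF \<alpha> \<gamma>] l2_forms[OF \<beta> \<gamma>]]])
  fix Xs assume "Xs \<in> vlists k"
  then have Zs: "ham \<gamma> # Xs \<in> vlists (Suc k)" using ham_V[OF \<gamma>] by simp
  note V = ham_V[OF \<alpha>] ham_V[OF \<beta>]
  note sV = V_scale[OF C_const V(1), of a] V_scale[OF C_const V(2), of b]
  show "eval_form (l2_form (\<lambda>p vs. a * \<alpha> p vs + b * \<beta> p vs) \<gamma>) Xs
      = eval_form (\<lambda>p vs. a * l2_form \<alpha> \<gamma> p vs + b * l2_form \<beta> \<gamma> p vs) Xs"
    unfolding eval_form_lin eval_l2 ham_lin[OF \<alpha> \<beta>]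
      aform_add_left[OF M sV Zs] aform_scale_left[OF M C_const V(1) Zs] aform_scale_left[OF M C_const V(2) Zs] ..
qed

lemma l2_anti:
  assumes \<alpha>: "\<alpha> \<in> forms k" and \<beta>: "\<beta> \<in> forms k"
  shows "l2_form \<alpha> \<beta> = (\<lambda>p vs. - l2_form \<beta> \<alpha> p vs)"
proof (rule forms_eqI[OF l2_forms[OF \<alpha> \<beta>]])
  show "(\<lambda>p vs. - l2_form \<beta> \<alpha> p vs) \<in> forms k"
    using forms_lin[OF l2_forms[OF \<beta> \<alpha>] l2_forms[OF \<beta> \<alpha>], of "-1" 0] by simp
  fix Xs assume Xs: "Xs \<in> vlists k"
  have "eval_form (\<lambda>p vs. - l2_form \<beta> \<alpha> p vs) Xs = - eval_form (l2_form \<beta> \<alpha>) Xs"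
    by (simp add: eval_form_def fun_eq_iff)
  then show "eval_form (l2_form \<alpha> \<beta>) Xs = eval_form (\<lambda>p vs. - l2_form \<beta> \<alpha> p vs) Xs"
    using aform_swap[OF M ham_V[OF \<alpha>] ham_V[OF \<beta>] Xs] by (simp add: eval_l2)
qed

lemma l2_zero:
  assumes \<alpha>: "\<alpha> \<in> forms k" and \<beta>: "\<beta> \<in> forms k" and zero: "ham \<alpha> = 0"
  shows "l2_form \<alpha> \<beta> = (\<lambda>p vs. 0)"
proof (rule forms_eqI[OF l2_forms[OF \<alpha> \<beta>] zero_form])
  fix Xs assume "Xs \<in> vlists k"
  then have "ham \<beta> # Xs \<in> vlists (Suc k)" using ham_V[OF \<beta>] by simp
  from aform_0_left[OF M this]
  show "eval_form (l2_form \<alpha> \<beta>) Xs = eval_form (\<lambda>p vs. 0) Xs"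
    unfolding eval_l2 zero by (simp add: eval_form_def fun_eq_iff)
qed

text \<open>The boundary provided by \<open>ham_jacobi\<close> is \<open>- d\<xi>\<close> with \<open>\<xi>\<close> the threefold contraction of \<open>\<mu>\<close>, a form of degree
  \<open>k - 1\<close>. For \<open>k = 0\<close> there is no such form; there the formula has to be evaluated at the empty list, where
  \<open>D\<close> gives \<open>0\<close>.\<close>

lemma l2_jacobi_boundary:
  assumes \<alpha>: "\<alpha> \<in> forms k" and \<beta>: "\<beta> \<in> forms k" and \<gamma>: "\<gamma> \<in> forms k"
  shows "(\<lambda>p vs. l2_form \<alpha> (l2_form \<beta> \<gamma>) p vs + l2_form \<beta> (l2_form \<gamma> \<alpha>) p vs + l2_form \<gamma> (l2_form \<alpha> \<beta>) p vs)
    \<in> boundary_forms" (is "?J \<in> _")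
proof -
  note f = l2_forms[OF \<alpha> l2_forms[OF \<beta> \<gamma>]] l2_forms[OF \<beta> l2_forms[OF \<gamma> \<alpha>]] l2_forms[OF \<gamma> l2_forms[OF \<alpha> \<beta>]]
  have J: "?J \<in> forms k"
    using forms_lin[OF forms_lin[OF f(1,2), of 1 1] f(3), of 1 1] by simp
  have eval: "eval_form ?J Ws = - D (\<lambda>Ws. eval_form \<mu> (ham \<alpha> # ham \<beta> # ham \<gamma> # Ws)) Ws"
    if Ws: "Ws \<in> vlists k" for Ws
  proof -
    have "eval_form ?J Ws = eval_form (l2_form \<alpha> (l2_form \<beta> \<gamma>)) Ws + eval_form (l2_form \<beta> (l2_form \<gamma> \<alpha>)) Ws
        + eval_form (l2_form \<gamma> (l2_form \<alpha> \<beta>)) Ws"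
      by (simp add: eval_form_def fun_eq_iff)
    also have "\<dots> = - D (\<lambda>Ws. eval_form \<mu> (ham \<alpha> # ham \<beta> # ham \<gamma> # Ws)) Ws"
      unfolding eval_l2 ham_l2[OF \<alpha> \<beta>] ham_l2[OF \<beta> \<gamma>] ham_l2[OF \<gamma> \<alpha>]
      by (rule ham_jacobi[OF aform_eval_form[OF \<alpha>] is_ham_ham[OF \<alpha>] aform_eval_form[OF \<beta>] is_ham_ham[OF \<beta>]
            aform_eval_form[OF \<gamma>] is_ham_ham[OF \<gamma>] Ws])
    finally show ?thesis .
  qed
  show ?thesis
  proof (cases k)
    case 0
    have "?J = (\<lambda>p vs. 0)"
    proof (rule forms_eqI[OF J zero_form])
      fix Xs assume Xs: "Xs \<in> vlists k"
      then have "Xs = []" using 0 by simp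
      then show "eval_form ?J Xs = eval_form (\<lambda>p vs. 0) Xs"
        using eval[OF Xs] by (simp add: eval_form_def fun_eq_iff)
    qed
    then show ?thesis using zero_boundary by simp
  next
    case (Suc j)
    define \<xi> where "\<xi> = int_prod (ham \<gamma>) (int_prod (ham \<beta>) (int_prod (ham \<alpha>) \<mu>))"
    have \<xi>: "\<xi> \<in> forms j"
      unfolding \<xi>_def
      by (rule int_prod_forms[OF int_prod_forms[OF int_prod_forms[OF \<mu>[unfolded Suc] ham_V[OF \<alpha>]] ham_V[OF \<beta>]] ham_V[OF \<gamma>]])
    have d\<xi>: "ext_d j \<xi> \<in> boundary_forms" using \<xi> unfolding boundary_forms_Suc[OF Suc] by blast
    have neg: "(\<lambda>p vs. - ext_d j \<xi> p vs) \<in> boundary_forms"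
      using boundary_forms_lin[OF d\<xi> d\<xi>, of "-1" 0] by simp
    have "?J = (\<lambda>p vs. - ext_d j \<xi> p vs)"
    proof (rule forms_eqI[OF J boundary_forms_closed(1)[OF neg]])
      fix Xs assume Xs: "Xs \<in> vlists k"
      have "eval_form (\<lambda>p vs. - ext_d j \<xi> p vs) Xs = - eval_form (ext_d j \<xi>) Xs"
        by (simp add: eval_form_def fun_eq_iff)
      also have "eval_form (ext_d j \<xi>) Xs = D (eval_form \<xi>) Xs"
        by (rule eval_ext_d[OF \<xi>]) (use Xs Suc in simp)
      also have "eval_form \<xi> = (\<lambda>Ws. eval_form \<mu> (ham \<alpha> # ham \<beta> # ham \<gamma> # Ws))"
        unfolding \<xi>_def eval_int_prod ..
      finally show "eval_form ?J Xs = eval_form (\<lambda>p vs. - ext_d j \<xi> p vs) Xs"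
        using eval[OF Xs] by (simp add: fun_eq_iff)
    qed
    then show ?thesis using neg by simp
  qed
qed

end

section \<open>The central extension\<close>

text \<open>Frames on the manifold are a parameter here; they are supplied by \<open>finite_frames\<close> in the end.\<close>

locale manifold_hamiltonian = smooth_manifold A +
  hamiltonian_forms "Collect (smooth_fun A)" "vector_fields A" "tangent_space A" "DIM('e)" I r Es \<theta> \<mu> k
  for A :: "('a::{t2_space, second_countable_topology}, 'e::euclidean_space) atlas" and I :: "'i set" and r Es \<theta> \<mu> k
begin

abbreviation "L \<equiv> multisymplectic_linf A \<mu>"

lemma diff_forms_eq: "diff_forms A j = forms j"
  unfolding diff_forms_def forms_def vlists_def by blast

lemma ext_deriv_eq: "\<omega> \<in> forms j \<Longrightarrow> ext_deriv A j \<omega> = ext_d j \<omega>"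
  unfolding ext_deriv_def diff_forms_eq by (rule ext_d_the)

lemma degree: "int DIM('e) - 2 = int k"
  using n by simp

lemma Omega_eq: "Omega A (int k) = forms k"
  by (simp add: Omega_def diff_forms_eq)

lemma d_Omega_eq: "\<alpha> \<in> forms k \<Longrightarrow> d_Omega A (int k) \<alpha> = ext_d k \<alpha>"
  by (simp add: d_Omega_def ext_deriv_eq)

lemma d_image_eq: "d_Omega A (int k - 1) ` Omega A (int k - 1) = boundary_forms"
proof (cases k)
  case 0
  show ?thesis unfolding boundary_forms_0[OF 0] using 0 by (simp add: d_Omega_def Omega_def)
next
  case (Suc j)
  have "int k - 1 = int j" using Suc by simp
  then show ?thesis
    unfolding boundary_forms_Suc[OF Suc] by (simp add: d_Omega_def Omega_def diff_forms_eq ext_deriv_eq)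
qed

lemma is_ham_field_iff: "\<alpha> \<in> forms k \<Longrightarrow> is_ham_field A \<mu> \<alpha> X \<longleftrightarrow> is_ham (eval_form \<alpha>) X"
  unfolding is_ham_field_def degree d_Omega_eq by (rule ham_equation_iff)

lemma ham_field_eq:
  assumes "\<alpha> \<in> forms k" shows "ham_field A \<mu> \<alpha> = ham \<alpha>"
  unfolding ham_field_def ham_def is_ham_field_iff[OF assms] ham_equation_iff[OF assms] ..

lemma grade_0: "grade L 0 = form_space (forms k)"
  using degree by (simp add: multisymplectic_linf_def Omega_eq)

lemma brk_1: "brk L [(-1, x)] = d_Omega A (int k - 1) x"
  using degree by (simp add: multisymplectic_linf_def Let_def)

lemma grade_minus_1: "carrier (grade L (-1)) = Omega A (int k - 1)"
  using degree by (auto simp: multisymplectic_linf_def form_space_def Omega_def)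

lemma boundaries_eq: "linf_boundaries L = boundary_forms"
  unfolding linf_boundaries_def brk_1 grade_minus_1 by (rule d_image_eq)

text \<open>For \<open>k = 2\<close> the sign in the definition of the brackets is \<open>- (-1)\<^sup>3 = 1\<close>.\<close>

lemma brk_2:
  assumes "\<alpha> \<in> forms k" "\<beta> \<in> forms k" shows "brk L [(0, \<alpha>), (0, \<beta>)] = l2_form \<alpha> \<beta>"
  using degree by (simp add: multisymplectic_linf_def Let_def l2_form_def ham_field_eq assms)

lemma l2_lin_right:
  assumes \<alpha>: "\<alpha> \<in> forms k" and \<beta>: "\<beta> \<in> forms k" and \<gamma>: "\<gamma> \<in> forms k"
  shows "l2_form \<gamma> (\<lambda>p vs. a * \<alpha> p vs + b * \<beta> p vs) = (\<lambda>p vs. a * l2_form \<gamma> \<alpha> p vs + b * l2_form \<gamma> \<beta> p vs)"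
  unfolding l2_anti[OF \<gamma> forms_lin[OF \<alpha> \<beta>]] l2_lin_left[OF \<alpha> \<beta> \<gamma>] l2_anti[OF \<gamma> \<alpha>] l2_anti[OF \<gamma> \<beta>]
  by (simp add: algebra_simps)

lemma form_space_simps:
  "carrier (form_space S) = S" "\<zero>\<^bsub>form_space S\<^esub> = (\<lambda>p vs. 0)"
  "\<alpha> \<oplus>\<^bsub>form_space S\<^esub> \<beta> = (\<lambda>p vs. \<alpha> p vs + \<beta> p vs)" "c \<odot>\<^bsub>form_space S\<^esub> \<alpha> = (\<lambda>p vs. c * \<alpha> p vs)"
  by (simp_all add: form_space_def)

lemma forms_add: "\<alpha> \<in> forms j \<Longrightarrow> \<beta> \<in> forms j \<Longrightarrow> (\<lambda>p vs. \<alpha> p vs + \<beta> p vs) \<in> forms j"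
  using forms_lin[of \<alpha> j \<beta> 1 1] by simp

lemma forms_smult: "\<alpha> \<in> forms j \<Longrightarrow> (\<lambda>p vs. c * \<alpha> p vs) \<in> forms j"
  using forms_lin[of \<alpha> j \<alpha> c 0] by simp

lemma ham_add: "\<alpha> \<in> forms k \<Longrightarrow> \<beta> \<in> forms k \<Longrightarrow> ham (\<lambda>p vs. \<alpha> p vs + \<beta> p vs) = ham \<alpha> + ham \<beta>"
  using ham_lin[of \<alpha> \<beta> 1 1] by (simp add: fscale_def)

lemma ham_smult: "\<alpha> \<in> forms k \<Longrightarrow> ham (\<lambda>p vs. c * \<alpha> p vs) = fscale (\<lambda>p. c) (ham \<alpha>)"
  using ham_lin[of \<alpha> \<alpha> c 0] by (simp add: fscale_def plus_fun_def)

lemma boundaries_additive: "additive_subgroup boundary_forms (form_space (forms k))"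
proof (rule additive_subgroup.intro)
  interpret W: module real_ring "form_space (forms k)" by (rule module_forms)
  show "subgroup boundary_forms (add_monoid (form_space (forms k)))"
  proof (rule group.subgroupI[OF W.M.a_group])
    show "boundary_forms \<subseteq> carrier (add_monoid (form_space (forms k)))"
      using boundary_forms_closed(1) by (auto simp: form_space_simps)
    show "boundary_forms \<noteq> {}" using zero_boundary by blast
  next
    fix \<beta> assume \<beta>: "\<beta> \<in> boundary_forms"
    have f: "\<beta> \<in> forms k" by (rule boundary_forms_closed(1)[OF \<beta>])
    have neg: "(\<lambda>p vs. - \<beta> p vs) \<in> boundary_forms"
      using boundary_forms_lin[OF \<beta> \<beta>, of "-1" 0] by simp
    have "\<ominus>\<^bsub>form_space (forms k)\<^esub> \<beta> = (\<lambda>p vs. - \<beta> p vs)"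
      by (rule W.M.minus_equality)
         (simp_all add: form_space_simps f boundary_forms_closed(1)[OF neg])
    then show "inv\<^bsub>add_monoid (form_space (forms k))\<^esub> \<beta> \<in> boundary_forms"
      using neg by (simp add: a_inv_def)
  next
    fix \<beta> \<gamma> assume "\<beta> \<in> boundary_forms" "\<gamma> \<in> boundary_forms"
    from boundary_forms_lin[OF this, of 1 1]
    show "\<beta> \<otimes>\<^bsub>add_monoid (form_space (forms k))\<^esub> \<gamma> \<in> boundary_forms"
      by (simp add: form_space_simps)
  qed
qed

lemma grounded: "grounded_linf_data L"
proof (rule grounded_linf_data.intro)
  show "module real_ring (grade L 0)" unfolding grade_0 by (rule module_forms)
  show "grounded_linf_data_axioms L"
  proof (rule grounded_linf_data_axioms.intro, unfold grade_0 boundaries_eq form_space_simps)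
    show "additive_subgroup boundary_forms (form_space (forms k))" by (rule boundaries_additive)
    show "(\<lambda>p vs. c * \<beta> p vs) \<in> boundary_forms" if "\<beta> \<in> boundary_forms" for c \<beta>
      using boundary_forms_lin[OF that that, of c 0] by simp
  next
    fix \<alpha> \<beta> assume \<alpha>: "\<alpha> \<in> forms k" and \<beta>: "\<beta> \<in> forms k"
    show "brk L [(0, \<alpha>), (0, \<beta>)] \<in> forms k"
      unfolding brk_2[OF \<alpha> \<beta>] by (rule l2_forms[OF \<alpha> \<beta>])
    show "brk L [(0, \<lambda>p vs. c * \<alpha> p vs), (0, \<beta>)] = (\<lambda>p vs. c * brk L [(0, \<alpha>), (0, \<beta>)] p vs)" for c
      unfolding brk_2[OF forms_smult[OF \<alpha>] \<beta>] brk_2[OF \<alpha> \<beta>] using l2_lin_left[OF \<alpha> \<alpha> \<beta>, of c 0] by simp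
    show "brk L [(0, \<alpha>), (0, \<lambda>p vs. c * \<beta> p vs)] = (\<lambda>p vs. c * brk L [(0, \<alpha>), (0, \<beta>)] p vs)" for c
      unfolding brk_2[OF \<alpha> forms_smult[OF \<beta>]] brk_2[OF \<alpha> \<beta>] using l2_lin_right[OF \<beta> \<beta> \<alpha>, of c 0] by simp
    fix \<gamma> assume \<gamma>: "\<gamma> \<in> forms k"
    show "brk L [(0, \<lambda>p vs. \<alpha> p vs + \<beta> p vs), (0, \<gamma>)] = (\<lambda>p vs. brk L [(0, \<alpha>), (0, \<gamma>)] p vs + brk L [(0, \<beta>), (0, \<gamma>)] p vs)"
      unfolding brk_2[OF forms_add[OF \<alpha> \<beta>] \<gamma>] brk_2[OF \<alpha> \<gamma>] brk_2[OF \<beta> \<gamma>]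
      using l2_lin_left[OF \<alpha> \<beta> \<gamma>, of 1 1] by simp
    show "brk L [(0, \<gamma>), (0, \<lambda>p vs. \<alpha> p vs + \<beta> p vs)] = (\<lambda>p vs. brk L [(0, \<gamma>), (0, \<alpha>)] p vs + brk L [(0, \<gamma>), (0, \<beta>)] p vs)"
      unfolding brk_2[OF \<gamma> forms_add[OF \<alpha> \<beta>]] brk_2[OF \<gamma> \<alpha>] brk_2[OF \<gamma> \<beta>]
      using l2_lin_right[OF \<alpha> \<beta> \<gamma>, of 1 1] by simp
    show "(\<lambda>p vs. brk L [(0, \<alpha>), (0, brk L [(0, \<beta>), (0, \<gamma>)])] p vs + brk L [(0, \<beta>), (0, brk L [(0, \<gamma>), (0, \<alpha>)])] p vs
        + brk L [(0, \<gamma>), (0, brk L [(0, \<alpha>), (0, \<beta>)])] p vs) \<in> boundary_forms"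
      unfolding brk_2[OF \<alpha> \<beta>] brk_2[OF \<beta> \<gamma>] brk_2[OF \<gamma> \<alpha>] brk_2[OF \<alpha> l2_forms[OF \<beta> \<gamma>]]
        brk_2[OF \<beta> l2_forms[OF \<gamma> \<alpha>]] brk_2[OF \<gamma> l2_forms[OF \<alpha> \<beta>]]
      by (rule l2_jacobi_boundary[OF \<alpha> \<beta> \<gamma>])
  next
    fix \<alpha> assume \<alpha>: "\<alpha> \<in> forms k"
    have "l2_form \<alpha> \<alpha> p vs = - l2_form \<alpha> \<alpha> p vs" for p vs
      using l2_anti[OF \<alpha> \<alpha>] by (rule fun_cong[THEN fun_cong])
    then have "l2_form \<alpha> \<alpha> p vs = 0" for p vs by (metis equation_minus_iff neg_equal_zero)
    then show "brk L [(0, \<alpha>), (0, \<alpha>)] = (\<lambda>p vs. 0)"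
      unfolding brk_2[OF \<alpha> \<alpha>] by (intro ext)
    fix \<beta> assume \<beta>: "\<beta> \<in> boundary_forms"
    note f = boundary_forms_closed(1)[OF \<beta>]
    note z = l2_zero[OF f \<alpha> ham_boundary[OF \<beta>]]
    show "brk L [(0, \<beta>), (0, \<alpha>)] = (\<lambda>p vs. 0)" unfolding brk_2[OF f \<alpha>] by (rule z)
    show "brk L [(0, \<alpha>), (0, \<beta>)] = (\<lambda>p vs. 0)"
      unfolding brk_2[OF \<alpha> f] l2_anti[OF \<alpha> f] z by simp
  qed
qed

abbreviation "G \<equiv> exact_div_free A \<mu>"

lemma exact_simps:
  "carrier G = ham ` forms k" "\<zero>\<^bsub>G\<^esub> = 0" "X \<oplus>\<^bsub>G\<^esub> Y = X + Y" "c \<odot>\<^bsub>G\<^esub> X = fscale (\<lambda>p. c) X"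
  "bracket G X Y = commutator X Y"
proof -
  have "carrier G = {X. \<exists>\<alpha>\<in>forms k. is_ham_field A \<mu> \<alpha> X}"
    by (simp add: exact_div_free_def degree Omega_eq)
  also have "\<dots> = ham ` forms k"
  proof (intro equalityI subsetI)
    fix X assume "X \<in> {X. \<exists>\<alpha>\<in>forms k. is_ham_field A \<mu> \<alpha> X}"
    then obtain \<alpha> where \<alpha>: "\<alpha> \<in> forms k" and "is_ham_field A \<mu> \<alpha> X" by blast
    then have "ham \<alpha> = X" unfolding is_ham_field_iff[OF \<alpha>] by (intro ham_eqI[OF \<alpha>])
    then show "X \<in> ham ` forms k" using \<alpha> by blast
  next
    fix X assume "X \<in> ham ` forms k"
    then obtain \<alpha> where \<alpha>: "\<alpha> \<in> forms k" "X = ham \<alpha>" by blast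
    then have "is_ham_field A \<mu> \<alpha> X" using is_ham_ham[OF \<alpha>(1)] unfolding is_ham_field_iff[OF \<alpha>(1)] by simp
    then show "X \<in> {X. \<exists>\<alpha>\<in>forms k. is_ham_field A \<mu> \<alpha> X}" using \<alpha>(1) by blast
  qed
  finally show "carrier G = ham ` forms k" .
qed (simp_all add: exact_div_free_def fscale_def zero_fun_def plus_fun_def)

lemma exact_V: "X \<in> carrier G \<Longrightarrow> X \<in> vector_fields A"
  unfolding exact_simps using ham_V by blast

lemma exact_zero: "0 \<in> carrier G"
  unfolding exact_simps ham_boundary[OF zero_boundary, symmetric] by (rule imageI[OF zero_form])

lemma exact_add: "X \<in> carrier G \<Longrightarrow> Y \<in> carrier G \<Longrightarrow> X + Y \<in> carrier G"
  unfolding exact_simps by (elim imageE) (simp only: ham_add[symmetric] imageI forms_add)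

lemma exact_scale: "X \<in> carrier G \<Longrightarrow> fscale (\<lambda>p. c) X \<in> carrier G"
  unfolding exact_simps by (elim imageE) (simp only: ham_smult[symmetric] imageI forms_smult)

lemma exact_commutator: "X \<in> carrier G \<Longrightarrow> Y \<in> carrier G \<Longrightarrow> commutator X Y \<in> carrier G"
  unfolding exact_simps by (elim imageE) (simp only: ham_l2[symmetric] imageI l2_forms)

lemma exact_abelian_group: "abelian_group G"
proof (rule abelian_groupI, unfold exact_simps(2,3))
  fix X assume X: "X \<in> carrier G"
  have "fscale (\<lambda>p. - 1) X + X = 0" by (simp add: fscale_def fun_eq_iff)
  then show "\<exists>Y\<in>carrier G. Y + X = 0" using exact_scale[OF X] by blast
qed (simp_all add: exact_add exact_zero ac_simps)

lemma exact_module: "module real_ring G"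
proof (rule moduleI[OF real_ring_cring exact_abelian_group], unfold exact_simps(3,4) real_ring_simps)
  show "fscale (\<lambda>p. c) X \<in> carrier G" if "X \<in> carrier G" for c X by (rule exact_scale[OF that])
qed (simp_all add: fscale_def fun_eq_iff algebra_simps)

lemma exact_lie_algebra: "lie_algebra G"
  unfolding lie_algebra_def exact_simps(2-5)
proof (intro conjI ballI allI)
  show "module real_ring G" by (rule exact_module)
next
  fix X Y assume X: "X \<in> carrier G" and Y: "Y \<in> carrier G"
  show "commutator X Y \<in> carrier G" by (rule exact_commutator[OF X Y])
  have const: "fscale (act Z (\<lambda>p. c)) W = 0" if "Z \<in> carrier G" for Z W c
    unfolding act_const[OF exact_V[OF that]] by (simp add: fscale_def zero_fun_def)
  show "commutator (fscale (\<lambda>p. c) X) Y = fscale (\<lambda>p. c) (commutator X Y)" for c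
    using br_scale_left[OF exact_V[OF X] exact_V[OF Y], of "\<lambda>p. c"] C_const by (simp only: const[OF Y] diff_0_right)
  show "commutator X (fscale (\<lambda>p. c) Y) = fscale (\<lambda>p. c) (commutator X Y)" for c
    using br_scale_right[OF exact_V[OF X] exact_V[OF Y], of "\<lambda>p. c"] C_const by (simp only: const[OF X] add_0_right)
next
  fix X assume "X \<in> carrier G"
  then show "commutator X X = 0" by (rule br_self[OF exact_V])
next
  fix X Y Z assume "X \<in> carrier G" "Y \<in> carrier G" "Z \<in> carrier G"
  then have V: "X \<in> vector_fields A" "Y \<in> vector_fields A" "Z \<in> vector_fields A" by (simp_all only: exact_V)
  show "commutator (X + Y) Z = commutator X Z + commutator Y Z" by (rule br_add_left[OF V])
  show "commutator Z (X + Y) = commutator Z X + commutator Z Y" by (rule br_add_right[OF V(3,1,2)])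
  show "commutator X (commutator Y Z) + commutator Y (commutator Z X) + commutator Z (commutator X Y) = 0"
    by (rule br_jacobi_cyclic[OF V])
qed

text \<open>Adding a boundary does not change the Hamiltonian field, so the image of a coset is a singleton.\<close>

lemma class_field_coset:
  assumes \<alpha>: "\<alpha> \<in> forms k" shows "class_field A \<mu> (linf_coset L \<alpha>) = ham \<alpha>"
proof -
  interpret L: grounded_linf_data L by (rule grounded)
  have "ham_field A \<mu> \<beta> = ham \<alpha>" if \<beta>: "\<beta> \<in> linf_coset L \<alpha>" for \<beta>
  proof -
    obtain b where b: "b \<in> boundary_forms" and eq: "\<beta> = (\<lambda>p vs. b p vs + \<alpha> p vs)"
      using \<beta> unfolding L.in_coset_iff boundaries_eq grade_0 form_space_simps by blast
    note f = boundary_forms_closed(1)[OF b]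
    show ?thesis
      unfolding eq ham_field_eq[OF forms_add[OF f \<alpha>]] ham_add[OF f \<alpha>] ham_boundary[OF b] by simp
  qed
  then have "ham_field A \<mu> ` linf_coset L \<alpha> = (\<lambda>\<beta>. ham \<alpha>) ` linf_coset L \<alpha>" by (rule image_cong[OF refl])
  also have "\<dots> = {ham \<alpha>}"
    by (rule image_constant[OF L.self_in_coset]) (simp add: grade_0 form_space_simps \<alpha>)
  finally have "ham_field A \<mu> ` linf_coset L \<alpha> = {ham \<alpha>}" .
  then show ?thesis by (simp add: class_field_def)
qed

lemma central_extension_quotient: "central_extension (linf_quotient L) G (class_field A \<mu>)"
proof -
  interpret L: grounded_linf_data L by (rule grounded)
  have carrier_Q: "carrier (linf_quotient L) = linf_coset L ` forms k"
    unfolding L.quotient_carrier grade_0 form_space_simps ..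
  have carrier_L: "\<alpha> \<in> carrier (grade L 0) \<longleftrightarrow> \<alpha> \<in> forms k" for \<alpha>
    unfolding grade_0 form_space_simps ..
  have hom: "lie_hom (linf_quotient L) G (class_field A \<mu>)"
    unfolding lie_hom_def real_linear_def carrier_Q ball_simps exact_simps
  proof (intro conjI ballI allI)
    fix \<alpha> assume \<alpha>: "\<alpha> \<in> forms k"
    show "class_field A \<mu> (linf_coset L \<alpha>) \<in> ham ` forms k"
      unfolding class_field_coset[OF \<alpha>] using \<alpha> by (rule imageI)
    show "class_field A \<mu> (c \<odot>\<^bsub>linf_quotient L\<^esub> linf_coset L \<alpha>) = fscale (\<lambda>p. c) (class_field A \<mu> (linf_coset L \<alpha>))" for c
      unfolding L.quotient_smult[unfolded carrier_L, OF \<alpha>] grade_0 form_space_simps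
        class_field_coset[OF forms_smult[OF \<alpha>]] class_field_coset[OF \<alpha>] by (rule ham_smult[OF \<alpha>])
    fix \<beta> assume \<beta>: "\<beta> \<in> forms k"
    show "class_field A \<mu> (linf_coset L \<alpha> \<oplus>\<^bsub>linf_quotient L\<^esub> linf_coset L \<beta>)
        = class_field A \<mu> (linf_coset L \<alpha>) + class_field A \<mu> (linf_coset L \<beta>)"
      unfolding L.quotient_add[unfolded carrier_L, OF \<alpha> \<beta>] grade_0 form_space_simps
        class_field_coset[OF forms_add[OF \<alpha> \<beta>]] class_field_coset[OF \<alpha>] class_field_coset[OF \<beta>]
      by (rule ham_add[OF \<alpha> \<beta>])
    show "class_field A \<mu> (bracket (linf_quotient L) (linf_coset L \<alpha>) (linf_coset L \<beta>))
        = commutator (class_field A \<mu> (linf_coset L \<alpha>)) (class_field A \<mu> (linf_coset L \<beta>))"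
      unfolding L.quotient_bracket[unfolded carrier_L, OF \<alpha> \<beta>] brk_2[OF \<alpha> \<beta>]
        class_field_coset[OF l2_forms[OF \<alpha> \<beta>]] class_field_coset[OF \<alpha>] class_field_coset[OF \<beta>]
      by (rule ham_l2[OF \<alpha> \<beta>])
  qed
  have surj: "class_field A \<mu> ` carrier (linf_quotient L) = carrier G"
    unfolding carrier_Q exact_simps image_image by (rule image_cong[OF refl class_field_coset])
  have central: "a_kernel (linf_quotient L) G (class_field A \<mu>) \<subseteq> lie_center (linf_quotient L)"
  proof
    fix K assume "K \<in> a_kernel (linf_quotient L) G (class_field A \<mu>)"
    then have "K \<in> carrier (linf_quotient L)" and zero: "class_field A \<mu> K = 0"
      unfolding a_kernel_def kernel_def by (simp_all add: exact_simps)
    then obtain \<alpha> where \<alpha>: "\<alpha> \<in> forms k" and K: "K = linf_coset L \<alpha>" unfolding carrier_Q by blast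
    have h: "ham \<alpha> = 0" using zero unfolding K class_field_coset[OF \<alpha>] .
    have "bracket (linf_quotient L) K (linf_coset L \<beta>) = \<zero>\<^bsub>linf_quotient L\<^esub>" if \<beta>: "\<beta> \<in> forms k" for \<beta>
      unfolding K L.quotient_bracket[unfolded carrier_L, OF \<alpha> \<beta>] brk_2[OF \<alpha> \<beta>] l2_zero[OF \<alpha> \<beta> h]
        L.quotient_zero grade_0 form_space_simps ..
    then show "K \<in> lie_center (linf_quotient L)"
      unfolding lie_center_def carrier_Q using \<alpha> K by blast
  qed
  show ?thesis
    unfolding central_extension_def using L.quotient_lie_algebra exact_lie_algebra hom surj central by blast
qed

end

theorem proposition3p10:
  fixes A :: "('a::{t2_space, second_countable_topology}, 'e::euclidean_space) atlas"
    and \<mu> :: "'a dform"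
  assumes "smooth_atlas A"
    and "compact (UNIV :: 'a set)"
    and "DIM('e) \<ge> 2"
    and "volume_form A \<mu>"
  shows "carrier (linf_quotient (multisymplectic_linf A \<mu>)) =
           a_rcosets\<^bsub>form_space (Omega A (int DIM('e) - 2))\<^esub>
             (d_Omega A (int DIM('e) - 3) ` Omega A (int DIM('e) - 3)) \<and>
         (\<forall>\<alpha>\<in>Omega A (int DIM('e) - 2).
           class_field A \<mu> (linf_coset (multisymplectic_linf A \<mu>) \<alpha>) = ham_field A \<mu> \<alpha>) \<and>
         central_extension (linf_quotient (multisymplectic_linf A \<mu>)) (exact_div_free A \<mu>)
           (class_field A \<mu>) \<and>
         grounded_linf_morphism (multisymplectic_linf A \<mu>) (linf_quotient (multisymplectic_linf A \<mu>))
           (linf_coset (multisymplectic_linf A \<mu>)) \<and>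
         linf_coset (multisymplectic_linf A \<mu>) ` carrier (grade (multisymplectic_linf A \<mu>) 0) =
           carrier (linf_quotient (multisymplectic_linf A \<mu>))"
proof -
  interpret closed_manifold A by unfold_locales (use assms in auto)
  obtain I :: "'a set" and r Es \<theta> where
    frames: "framed_algebra (Collect (smooth_fun A)) (vector_fields A) (tangent_space A) DIM('e) I r Es \<theta>"
    by (rule finite_frames)
  interpret F: framed_algebra "Collect (smooth_fun A)" "vector_fields A" "tangent_space A" "DIM('e)" I r Es \<theta>
    by (rule frames)
  define k where "k = DIM('e) - 2"
  have k: "DIM('e) = Suc (Suc k)" using assms(3) by (simp add: k_def)
  have forms: "diff_forms A j = F.forms j" for j
    unfolding diff_forms_def F.forms_def F.vlists_def by blast
  have \<mu>: "\<mu> \<in> F.forms (Suc (Suc k))"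
    using assms(4) by (simp add: volume_form_def Omega_def forms k del: of_nat_Suc)
  have nonzero: "\<exists>Xs\<in>F.vlists (Suc (Suc k)). eval_form \<mu> Xs p \<noteq> 0" for p
  proof -
    obtain vs where vs: "\<mu> p vs \<noteq> 0" using assms(4) by (auto simp: volume_form_def)
    have "alt_multilinear (tangent_space A p) (Suc (Suc k)) (\<mu> p)" using \<mu> by (simp add: F.forms_def)
    then have len: "length vs = Suc (Suc k) \<and> set vs \<subseteq> tangent_space A p"
      using F.alt_multilinearD(1) vs by blast
    have "map (\<lambda>X. X p) (map (F.extension p) vs) = vs"
      unfolding map_map by (rule map_idI) (use len F.extension_at in auto)
    then have "eval_form \<mu> (map (F.extension p) vs) p \<noteq> 0" unfolding eval_form_def using vs by metis
    moreover have "map (F.extension p) vs \<in> F.vlists (Suc (Suc k))"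
      using len F.extension_V by (auto simp: F.vlists_def)
    ultimately show ?thesis by blast
  qed
  interpret H: manifold_hamiltonian A I r Es \<theta> \<mu> k
    by unfold_locales (use k \<mu> nonzero F.aform_eval_form[OF \<mu>] in auto)
  interpret L: grounded_linf_data "multisymplectic_linf A \<mu>" by (rule H.grounded)
  have deg: "int DIM('e) - 2 = int k" "int DIM('e) - 3 = int k - 1" using k by simp_all
  have "carrier (linf_quotient (multisymplectic_linf A \<mu>)) =
      a_rcosets\<^bsub>form_space (Omega A (int k))\<^esub> (d_Omega A (int k - 1) ` Omega A (int k - 1))"
    unfolding linf_quotient_def H.grade_0 H.boundaries_eq H.d_image_eq H.Omega_eq by simp
  moreover have "\<forall>\<alpha>\<in>Omega A (int k). class_field A \<mu> (linf_coset (multisymplectic_linf A \<mu>) \<alpha>) = ham_field A \<mu> \<alpha>"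
    unfolding H.Omega_eq using H.class_field_coset H.ham_field_eq by metis
  ultimately show ?thesis
    unfolding deg
    using H.central_extension_quotient L.quotient_map_linf_morphism L.quotient_carrier[symmetric] by blast
qed

end
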